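(* Let $\Xi$ be a simple stationary Poisson cylinder process in $\mathbb{R}^d$ with $k$-dimensional direction spaces, intensity $\lambda$ and shape distribution $\theta$, with union set $U_\Xi=\bigcup_{Z\in\Xi}Z$ and volume fraction $p=\mathbf{P}(\mathbf{o}\in U_\Xi)\in(0,1)$. Suppose that $K(Z)$ is convex for $\theta$-almost all $Z$. Then for every $r>0$ the spherical contact distribution function $H_{B_1(\mathbf{o})}(r)=\mathbf{P}(U_\Xi\cap B_r(\mathbf{o})\ne\emptyset\mid\mathbf{o}\notin U_\Xi)$ is $$H_{B_1(\mathbf{o})}(r)=1-\exp\left\{-\lambda\sum_{i=1}^{d-k}\kappa_i\,r^i\int_{\mathcal{Z}_k^o}V_{d-k-i}^{d-k}(K(Z))\,\theta(\mathrm{d}Z)\right\}.$$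
   Context: Let $0\le k\le d-1$ and let $G(k,d)$ be the Grassmannian of $k$-dimensional linear subspaces of $\mathbb{R}^d$. Let $\mathcal{R}$ be the convex ring, i.e. the family of finite unions of non-empty compact convex sets in $\mathbb{R}^d$ (Borel $\sigma$-algebra of the Hausdorff metric). A cylinder is a set $Z=K\oplus\xi$ (Minkowski sum) with direction space $\xi\in G(k,d)$ and base (cross-section) $K\in\mathcal{R}$, $K\subset\xi^\perp$; write $L(Z)=\xi$, $K(Z)=K$. $\mathcal{Z}_k$ is the set of all such cylinders, and $\mathcal{Z}_k^o\subset\mathcal{Z}_k$ is the set of those for which the midpoint of the circumsphere of $K(Z)$ is the origin $\mathbf{o}$. $\nu_{d-k}^{\xi}$ is $(d-k)$-dimensional Lebesgue measure on $\xi^\perp$. $B_r(\mathbf{o})$ is the closed ball of radius $r$ centered at the origin; $\kappa_i$ is the volume of the unit ball in $\mathbb{R}^i$; $V_j^{n}(K)$ is the $j$-th intrinsic volume of a convex body $K$ in an $n$-dimensional Euclidean space (here $L(Z)^\perp$, $n=d-k$), normalized so that the volume of the parallel body of $K$ at distance $r$ is $\sum_{j=0}^n r^{n-j}\kappa_{n-j}V_j^n(K)$. A measure on $\mathcal{Z}_k$ is locally finite if for every compact $C\subset\mathbb{R}^d$ the set of cylinders hitting $C$ has finite measure. A Poisson cylinder process $\Xi$ is a Poisson point process on $\mathcal{Z}_k$ with locally finite intensity measure $\Lambda$; it is simple if it has no multiple points (equivalently $\Lambda$ is diffuse). It is stationary if its distribution is invariant under translations of $\mathbb{R}^d$. In that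 case there are $\lambda\ge 0$ (the intensity) and a probability measure $\theta$ on $\mathcal{Z}_k^o$ (the shape distribution) such that, for every measurable $f\ge 0$, $$\int_{\mathcal{Z}_k}f\,\mathrm{d}\Lambda=\lambda\int_{\mathcal{Z}_k^o}\int_{L(Z)^\perp}f(\mathbf{x}+Z)\,\nu_{d-k}^{L(Z)}(\mathrm{d}\mathbf{x})\,\theta(\mathrm{d}Z).$$ Here $Z\in\Xi$ means that $Z$ lies in the support of $\Xi$; $U_\Xi$ is a random closed set. *)

theory Defs
  imports "HOL-Probability.Probability"
begin

section \<open>Hausdorff metric, convex ring and Grassmannian\<close>

text \<open>The value 0 on empty or unbounded arguments is a convention; it makes \<^term>\<open>hausdorff_dist\<close>
  non-negative everywhere, as the locale \<^locale>\<open>Metric_space\<close> requires.\<close>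

definition hausdorff_dist :: "'a::metric_space set \<Rightarrow> 'a set \<Rightarrow> real" where
  "hausdorff_dist A B =
     (if A \<noteq> {} \<and> B \<noteq> {} \<and> bounded A \<and> bounded B
      then max (SUP a\<in>A. infdist a B) (SUP b\<in>B. infdist b A) else 0)"

text \<open>The empty union is excluded: bases of cylinders are non-empty.\<close>

definition convex_ring :: "'a::euclidean_space set set" where
  "convex_ring = {\<Union>\<F> | \<F>. finite \<F> \<and> \<F> \<noteq> {} \<and> (\<forall>C\<in>\<F>. C \<noteq> {} \<and> compact C \<and> convex C)}"

definition grassmannian :: "nat \<Rightarrow> 'a::euclidean_space set set" where
  "grassmannian k = {\<xi>. subspace \<xi> \<and> dim \<xi> = k}"

text \<open>The usual topology of the Grassmannian, metrized by the Hausdorff distance of unit balls.\<close>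

definition subspace_dist :: "'a::euclidean_space set \<Rightarrow> 'a set \<Rightarrow> real" where
  "subspace_dist \<xi> \<eta> = hausdorff_dist (\<xi> \<inter> cball 0 1) (\<eta> \<inter> cball 0 1)"

definition convex_ring_borel :: "'a::euclidean_space set measure" where
  "convex_ring_borel =
     sigma convex_ring {U. openin (Metric_space.mtopology convex_ring hausdorff_dist) U}"

definition grassmannian_borel :: "nat \<Rightarrow> 'a::euclidean_space set measure" where
  "grassmannian_borel k =
     sigma (grassmannian k) {U. openin (Metric_space.mtopology (grassmannian k) subspace_dist) U}"

lemma hausdorff_dist_le_iff:
  fixes A B :: "'a::metric_space set"
  assumes "A \<noteq> {}" "B \<noteq> {}" "bounded A" "bounded B"
  shows "hausdorff_dist A B \<le> e \<longleftrightarrow> (\<forall>a\<in>A. infdist a B \<le> e) \<and> (\<forall>b\<in>B. infdist b A \<le> e)"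
proof -
  have bdd: "bdd_above ((\<lambda>x. infdist x Y) ` X)" if X: "bounded X" and Y: "Y \<noteq> {}" for X Y :: "'a set"
  proof -
    obtain y where y: "y \<in> Y" using Y by auto
    obtain c where c: "\<And>x. x \<in> X \<Longrightarrow> dist y x \<le> c"
      using X unfolding bounded_any_center[where a = y] by auto
    show ?thesis
      by (rule bdd_aboveI2[where M = c]) (metis c dist_commute infdist_le2 y)
  qed
  show ?thesis
    unfolding hausdorff_dist_def
    using assms cSUP_le_iff[OF assms(1) bdd[OF assms(3,2)]] cSUP_le_iff[OF assms(2) bdd[OF assms(4,1)]]
    by auto
qed

lemma hausdorff_dist_nonneg: "0 \<le> hausdorff_dist A B"
proof (cases "A \<noteq> {} \<and> B \<noteq> {} \<and> bounded A \<and> bounded B")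
  case True
  then obtain x where "x \<in> A" by auto
  then have "infdist x B \<le> hausdorff_dist A B"
    using hausdorff_dist_le_iff[of A B] True by blast
  then show ?thesis using infdist_nonneg[of x B] by linarith
qed (auto simp: hausdorff_dist_def)

lemma hausdorff_dist_commute: "hausdorff_dist A B = hausdorff_dist B A"
  by (auto simp: hausdorff_dist_def max.commute)

lemma hausdorff_dist_triangle:
  fixes A B C :: "'a::metric_space set"
  assumes "A \<noteq> {}" "B \<noteq> {}" "C \<noteq> {}" "bounded A" "bounded B" "bounded C"
  shows "hausdorff_dist A C \<le> hausdorff_dist A B + hausdorff_dist B C"
proof -
  have *: "infdist x Z \<le> e1 + e2"
    if h: "infdist x Y \<le> e1" "\<forall>y\<in>Y. infdist y Z \<le> e2" "Y \<noteq> {}" for x Y e1 e2 and Z :: "'a set"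
  proof (rule field_le_epsilon)
    fix e :: real assume "e > 0"
    then have "infdist x Y < e1 + e" using h(1) by linarith
    then obtain y where y: "y \<in> Y" "dist x y < e1 + e"
      using h(3) by (auto simp: infdist_def cINF_less_iff)
    have "infdist x Z \<le> infdist y Z + dist x y" by (rule infdist_triangle)
    then show "infdist x Z \<le> e1 + e2 + e" using y h(2) by fastforce
  qed
  have ab: "(\<forall>a\<in>A. infdist a B \<le> hausdorff_dist A B) \<and> (\<forall>b\<in>B. infdist b A \<le> hausdorff_dist A B)"
    using hausdorff_dist_le_iff assms by blast
  have bc: "(\<forall>a\<in>B. infdist a C \<le> hausdorff_dist B C) \<and> (\<forall>b\<in>C. infdist b B \<le> hausdorff_dist B C)"
    using hausdorff_dist_le_iff assms by blast
  have "infdist a C \<le> hausdorff_dist A B + hausdorff_dist B C" if "a \<in> A" for a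
    using *[of a B "hausdorff_dist A B" C "hausdorff_dist B C"] ab bc assms(2) that by blast
  moreover have "infdist c A \<le> hausdorff_dist B C + hausdorff_dist A B" if "c \<in> C" for c
    using *[of c B "hausdorff_dist B C" A "hausdorff_dist A B"] ab bc assms(2) that by blast
  ultimately show ?thesis
    unfolding hausdorff_dist_le_iff[OF assms(1,3,4,6)] by (simp add: add.commute)
qed

lemma Metric_space_hausdorff:
  fixes \<M> :: "'a::metric_space set set"
  assumes "\<And>A. A \<in> \<M> \<Longrightarrow> A \<noteq> {} \<and> compact A"
  shows "Metric_space \<M> hausdorff_dist"
proof -
  have M: "A \<noteq> {}" "bounded A" "closed A" if "A \<in> \<M>" for A
    using assms[OF that] by (auto intro: compact_imp_bounded compact_imp_closed)
  have sub: "A \<subseteq> B" if "A \<in> \<M>" "B \<in> \<M>" "hausdorff_dist A B = 0" for A B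
  proof
    fix x assume "x \<in> A"
    moreover have "\<forall>x\<in>A. infdist x B \<le> 0"
      using hausdorff_dist_le_iff[of A B 0] M[OF that(1)] M[OF that(2)] that(3) by simp
    ultimately have "infdist x B = 0" using infdist_nonneg[of x B] by force
    then show "x \<in> B" using in_closed_iff_infdist_zero M[OF that(2)] by blast
  qed
  show ?thesis
  proof
    fix A B :: "'a set"
    show "0 \<le> hausdorff_dist A B" by (rule hausdorff_dist_nonneg)
    show "hausdorff_dist A B = hausdorff_dist B A" by (rule hausdorff_dist_commute)
  next
    fix A B assume AB: "A \<in> \<M>" "B \<in> \<M>"
    have "hausdorff_dist A A = 0"
      using hausdorff_dist_le_iff[of A A 0] M[OF AB(1)] hausdorff_dist_nonneg[of A A] by force
    moreover have "A = B" if "hausdorff_dist A B = 0"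
      using sub[OF AB that] sub[OF AB(2,1)] that hausdorff_dist_commute[of A B] by auto
    ultimately show "hausdorff_dist A B = 0 \<longleftrightarrow> A = B" by blast
  next
    fix A B C assume "A \<in> \<M>" "B \<in> \<M>" "C \<in> \<M>"
    then show "hausdorff_dist A C \<le> hausdorff_dist A B + hausdorff_dist B C"
      by (intro hausdorff_dist_triangle M)
  qed
qed

lemma Metric_space_convex_ring: "Metric_space convex_ring hausdorff_dist"
  by (rule Metric_space_hausdorff) (auto simp: convex_ring_def)

lemma Metric_space_grassmannian: "Metric_space (grassmannian k) subspace_dist"
proof -
  let ?b = "\<lambda>\<xi>::'a set. \<xi> \<inter> cball 0 1"
  interpret H: Metric_space "?b ` grassmannian k" hausdorff_dist
  proof (rule Metric_space_hausdorff)
    fix A :: "'a set" assume "A \<in> ?b ` grassmannian k"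
    then obtain \<xi> where "subspace \<xi>" "A = ?b \<xi>" by (auto simp: grassmannian_def)
    then show "A \<noteq> {} \<and> compact A"
      using subspace_0[of \<xi>] closed_subspace[of \<xi>] by (auto intro: closed_Int_compact)
  qed
  have sub: "\<xi> \<subseteq> \<eta>" if "subspace \<xi>" "subspace \<eta>" "?b \<xi> = ?b \<eta>" for \<xi> \<eta> :: "'a set"
  proof
    fix x assume x: "x \<in> \<xi>"
    show "x \<in> \<eta>"
    proof (cases "x = 0")
      case False
      have "x /\<^sub>R norm x \<in> ?b \<xi>" using x False that(1) by (simp add: subspace_scale)
      then have "x /\<^sub>R norm x \<in> \<eta>" using that(3) by blast
      then have "norm x *\<^sub>R (x /\<^sub>R norm x) \<in> \<eta>" using that(2) by (rule subspace_scale[rotated])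
      then show ?thesis using False by simp
    qed (use subspace_0[OF that(2)] in simp)
  qed
  show ?thesis
    unfolding subspace_dist_def
  proof
    fix \<xi> \<eta> :: "'a set" assume "\<xi> \<in> grassmannian k" "\<eta> \<in> grassmannian k"
    then show "(hausdorff_dist (?b \<xi>) (?b \<eta>) = 0) = (\<xi> = \<eta>)"
      using sub[of \<xi> \<eta>] sub[of \<eta> \<xi>] by (auto simp: grassmannian_def H.zero)
  next
    fix \<xi> \<eta> \<zeta> :: "'a set"
    assume "\<xi> \<in> grassmannian k" "\<eta> \<in> grassmannian k" "\<zeta> \<in> grassmannian k"
    then show "hausdorff_dist (?b \<xi>) (?b \<zeta>) \<le> hausdorff_dist (?b \<xi>) (?b \<eta>) + hausdorff_dist (?b \<eta>) (?b \<zeta>)"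
      by (intro H.triangle) auto
  qed (auto simp: hausdorff_dist_nonneg hausdorff_dist_commute)
qed

section \<open>Cylinders\<close>

definition is_cylinder_decomp :: "'a::euclidean_space set \<Rightarrow> 'a set \<Rightarrow> 'a set \<Rightarrow> bool" where
  "is_cylinder_decomp Z K \<xi> \<longleftrightarrow>
     subspace \<xi> \<and> K \<in> convex_ring \<and> K \<subseteq> \<xi>\<^sup>\<bottom> \<and> Z = K + \<xi>"

definition cylinders :: "nat \<Rightarrow> 'a::euclidean_space set set" where
  "cylinders k = {Z. \<exists>\<xi>\<in>grassmannian k. \<exists>K. is_cylinder_decomp Z K \<xi>}"

lemma is_cylinder_decomp_unique:
  assumes "is_cylinder_decomp Z K \<xi>" "is_cylinder_decomp Z K' \<xi>'"
  shows "\<xi> = \<xi>'" and "K = K'"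
proof -
  have sub: "\<xi> \<subseteq> \<xi>'" if d: "is_cylinder_decomp Z K \<xi>" "is_cylinder_decomp Z K' \<xi>'"
    for K K' \<xi> \<xi>' :: "'a set"
  proof
    fix v assume v: "v \<in> \<xi>"
    have s: "subspace \<xi>" "subspace \<xi>'" and Z: "Z = K + \<xi>" "Z = K' + \<xi>'"
      and Kp: "K' \<subseteq> \<xi>'\<^sup>\<bottom>" and KR: "K \<in> convex_ring" "K' \<in> convex_ring"
      using d by (auto simp: is_cylinder_decomp_def)
    obtain k where k: "k \<in> K" using KR by (fastforce simp: convex_ring_def)
    obtain b where b: "\<forall>x\<in>K'. norm x \<le> b"
    proof -
      have "bounded K'" using KR by (auto simp: convex_ring_def compact_imp_bounded)
      then show ?thesis using that by (auto simp: bounded_iff)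
    qed
    have "v \<in> \<xi>'\<^sup>\<bottom>\<^sup>\<bottom>"
      unfolding orthogonal_comp_def
    proof (rule CollectI, rule ballI)
      fix w assume "w \<in> {x. \<forall>y\<in>\<xi>'. orthogonal y x}"
      then have w: "\<And>y. y \<in> \<xi>' \<Longrightarrow> w \<bullet> y = 0" by (auto simp: orthogonal_def inner_commute)
      have bnd: "w \<bullet> k + t * (w \<bullet> v) \<le> norm w * b" for t
      proof -
        have "k + t *\<^sub>R v \<in> Z" using k v s Z(1) by (auto simp: subspace_scale set_plus_intro)
        then obtain x y where xy: "x \<in> K'" "y \<in> \<xi>'" "k + t *\<^sub>R v = x + y"
          using Z(2) by (auto elim: set_plus_elim)
        have "w \<bullet> k + t * (w \<bullet> v) = w \<bullet> (k + t *\<^sub>R v)" by (simp add: inner_add_right)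
        also have "\<dots> = w \<bullet> x" unfolding xy(3) using w xy by (simp add: inner_add_right)
        also have "\<dots> \<le> norm w * norm x" by (rule norm_cauchy_schwarz)
        also have "\<dots> \<le> norm w * b" using b xy by (simp add: mult_left_mono)
        finally show ?thesis .
      qed
      have "w \<bullet> v = 0"
      proof (rule ccontr)
        assume "w \<bullet> v \<noteq> 0"
        then have "w \<bullet> k + ((norm w * b - w \<bullet> k + 1) / (w \<bullet> v)) * (w \<bullet> v) = norm w * b + 1"
          by simp
        then show False using bnd[of "(norm w * b - w \<bullet> k + 1) / (w \<bullet> v)"] by linarith
      qed
      then show "orthogonal w v" by (simp add: orthogonal_def)
    qed
    then show "v \<in> \<xi>'" using orthogonal_comp_self[OF s(2)] by simp
  qed
  show eq: "\<xi> = \<xi>'" using sub[OF assms] sub[OF assms(2,1)] by blast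
  have base: "K = Z \<inter> \<xi>\<^sup>\<bottom>" if "is_cylinder_decomp Z K \<xi>" for K
  proof -
    have s: "subspace \<xi>" and Z: "Z = K + \<xi>" and Kp: "K \<subseteq> \<xi>\<^sup>\<bottom>"
      using that by (auto simp: is_cylinder_decomp_def)
    have "K \<subseteq> Z"
      using set_plus_intro[of _ K 0 \<xi>] subspace_0[OF s] Z by auto
    moreover have "z \<in> K" if "z \<in> Z" "z \<in> \<xi>\<^sup>\<bottom>" for z
    proof -
      obtain x y where xy: "x \<in> K" "y \<in> \<xi>" "z = x + y" using \<open>z \<in> Z\<close> Z by (auto elim: set_plus_elim)
      have "x \<in> \<xi>\<^sup>\<bottom>" using xy Kp by auto
      then have "z - x \<in> \<xi>\<^sup>\<bottom>" by (intro subspace_diff subspace_orthogonal_comp that)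
      then have "orthogonal y y" using xy by (auto simp: orthogonal_comp_def)
      then show ?thesis using xy by (simp add: orthogonal_def)
    qed
    ultimately show ?thesis using Kp by blast
  qed
  show "K = K'" using base[OF assms(1)] base[of K'] assms(2) eq by simp
qed

definition direction :: "'a::euclidean_space set \<Rightarrow> 'a set" where
  "direction Z = (THE \<xi>. \<exists>K. is_cylinder_decomp Z K \<xi>)"

definition base :: "'a::euclidean_space set \<Rightarrow> 'a set" where
  "base Z = (THE K. \<exists>\<xi>. is_cylinder_decomp Z K \<xi>)"

lemma direction_base_eq:
  assumes "is_cylinder_decomp Z K \<xi>"
  shows "direction Z = \<xi>" and "base Z = K"
proof -
  show "direction Z = \<xi>"
    unfolding direction_def
    by (rule the_equality, rule exI, rule assms) (erule exE, erule is_cylinder_decomp_unique(1)[OF _ assms])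
  show "base Z = K"
    unfolding base_def
    by (rule the_equality, rule exI, rule assms) (erule exE, erule is_cylinder_decomp_unique(2)[OF _ assms])
qed

text \<open>The measurable structure on cylinders is that of pairs (base, direction space).\<close>

definition cylinder_space :: "nat \<Rightarrow> 'a::euclidean_space set measure" where
  "cylinder_space k =
     vimage_algebra (cylinders k) (\<lambda>Z. (base Z, direction Z))
       (convex_ring_borel \<Otimes>\<^sub>M grassmannian_borel k)"

text \<open>The circumsphere of \<open>K\<close> is the boundary of the smallest ball containing \<open>K\<close>.\<close>

definition is_circumcenter :: "'a::euclidean_space \<Rightarrow> 'a set \<Rightarrow> bool" where
  "is_circumcenter c K \<longleftrightarrow> (\<exists>R. K \<subseteq> cball c R \<and> (\<forall>c' R'. K \<subseteq> cball c' R' \<longrightarrow> R \<le> R'))"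

definition centered_cylinders :: "nat \<Rightarrow> 'a::euclidean_space set set" where
  "centered_cylinders k = {Z \<in> cylinders k. is_circumcenter 0 (base Z)}"

definition centered_cylinder_space :: "nat \<Rightarrow> 'a::euclidean_space set measure" where
  "centered_cylinder_space k = restrict_space (cylinder_space k) (centered_cylinders k)"

section \<open>Lebesgue measure on subspaces and intrinsic volumes\<close>

definition orthonormal_basis_of :: "'a::euclidean_space set \<Rightarrow> 'a set" where
  "orthonormal_basis_of W =
     (SOME B. pairwise orthogonal B \<and> (\<forall>b\<in>B. norm b = 1) \<and> span B = W)"

text \<open>Same construction as \<^term>\<open>lborel\<close> (see \<open>lborel_eq\<close>), with an orthonormal basis of \<open>W\<close>;
  by rotation invariance its choice is irrelevant. The \<open>dim W\<close>-dimensional Lebesgue measure on \<open>W\<close>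
  is viewed as a measure on the whole space that is concentrated on \<open>W\<close>.\<close>

definition lborel_subspace :: "'a::euclidean_space set \<Rightarrow> 'a measure" where
  "lborel_subspace W =
     distr (\<Pi>\<^sub>M b\<in>orthonormal_basis_of W. lborel) borel
       (\<lambda>f. \<Sum>b\<in>orthonormal_basis_of W. f b *\<^sub>R b)"

definition parallel_body :: "'a::euclidean_space set \<Rightarrow> 'a set \<Rightarrow> real \<Rightarrow> 'a set" where
  "parallel_body W K r = {x\<in>W. \<exists>y\<in>K. dist x y \<le> r}"

text \<open>The intrinsic volume of index \<open>j\<close> of a convex body \<open>K\<close> in the Euclidean space \<open>W\<close>: the intrinsic
  volumes are the coefficients in the Steiner formula. Indices above \<open>dim W\<close> do not occur in the
  formula and are set to 0 so that the description is unique.\<close>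

definition intrinsic_volume :: "'a::euclidean_space set \<Rightarrow> nat \<Rightarrow> 'a set \<Rightarrow> real" where
  "intrinsic_volume W j K =
     (THE V. (\<forall>i>dim W. V i = 0) \<and>
        (\<forall>r\<ge>0. measure (lborel_subspace W) (parallel_body W K r) =
           (\<Sum>i\<le>dim W. r ^ (dim W - i) * unit_ball_vol (real (dim W - i)) * V i))) j"

section \<open>Poisson cylinder processes\<close>

definition locally_finite :: "nat \<Rightarrow> 'a::euclidean_space set measure \<Rightarrow> bool" where
  "locally_finite k \<mu> \<longleftrightarrow>
     sets \<mu> = sets (cylinder_space k) \<and>
     (\<forall>C. compact C \<longrightarrow> emeasure \<mu> {Z \<in> cylinders k. Z \<inter> C \<noteq> {}} < \<infinity>)"

text \<open>Locally finite counting measures, i.e. locally finite sums of Dirac measures at cylinders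
  \<open>Z i\<close>, \<open>i \<in> I\<close>, repetitions being allowed.\<close>

definition point_measures :: "nat \<Rightarrow> 'a::euclidean_space set measure set" where
  "point_measures k =
     {\<mu>. locally_finite k \<mu> \<and>
        (\<exists>(I::nat set) Z. Z \<in> I \<rightarrow> cylinders k \<and> \<mu> = distr (count_space I) (cylinder_space k) Z)}"

text \<open>The \<open>\<sigma>\<close>-algebra generated by the evaluations, as for \<^term>\<open>subprob_algebra\<close>.\<close>

definition point_measure_space :: "nat \<Rightarrow> 'a::euclidean_space set measure measure" where
  "point_measure_space k =
     (SUP A\<in>sets (cylinder_space k). vimage_algebra (point_measures k) (\<lambda>\<mu>. emeasure \<mu> A) borel)"

definition poisson_cylinder_process ::
    "nat \<Rightarrow> 'w measure \<Rightarrow> ('w \<Rightarrow> 'a::euclidean_space set measure) \<Rightarrow> 'a set measure \<Rightarrow> bool" where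
  "poisson_cylinder_process k P \<Xi> \<Lambda> \<longleftrightarrow>
     prob_space P \<and> locally_finite k \<Lambda> \<and> \<Xi> \<in> P \<rightarrow>\<^sub>M point_measure_space k \<and>
     (\<forall>A\<in>sets (cylinder_space k).
        (emeasure \<Lambda> A < \<infinity> \<longrightarrow>
           (\<forall>n::nat. measure P {\<omega>\<in>space P. emeasure (\<Xi> \<omega>) A = of_nat n} =
              measure \<Lambda> A ^ n / fact n * exp (- measure \<Lambda> A))) \<and>
        (emeasure \<Lambda> A = \<infinity> \<longrightarrow> (AE \<omega> in P. emeasure (\<Xi> \<omega>) A = \<infinity>))) \<and>
     (\<forall>(I::nat set) A. finite I \<longrightarrow> A \<in> I \<rightarrow> sets (cylinder_space k) \<longrightarrow> disjoint_family_on A I \<longrightarrow>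
        prob_space.indep_vars P (\<lambda>_. borel) (\<lambda>i \<omega>. emeasure (\<Xi> \<omega>) (A i)) I)"

definition simple_process ::
    "nat \<Rightarrow> 'w measure \<Rightarrow> ('w \<Rightarrow> 'a::euclidean_space set measure) \<Rightarrow> bool" where
  "simple_process k P \<Xi> \<longleftrightarrow> (AE \<omega> in P. \<forall>Z\<in>cylinders k. emeasure (\<Xi> \<omega>) {Z} \<le> 1)"

definition stationary_process ::
    "nat \<Rightarrow> 'w measure \<Rightarrow> ('w \<Rightarrow> 'a::euclidean_space set measure) \<Rightarrow> bool" where
  "stationary_process k P \<Xi> \<longleftrightarrow>
     (\<forall>x. distr P (point_measure_space k) (\<lambda>\<omega>. distr (\<Xi> \<omega>) (cylinder_space k) ((`) ((+) x))) =
          distr P (point_measure_space k) \<Xi>)"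

definition intensity_and_shape ::
    "nat \<Rightarrow> 'a::euclidean_space set measure \<Rightarrow> real \<Rightarrow> 'a set measure \<Rightarrow> bool" where
  "intensity_and_shape k \<Lambda> c \<theta> \<longleftrightarrow>
     c \<ge> 0 \<and> prob_space \<theta> \<and> sets \<theta> = sets (centered_cylinder_space k) \<and>
     (\<forall>f \<in> cylinder_space k \<rightarrow>\<^sub>M (borel :: ennreal measure).
        (\<integral>\<^sup>+Z. f Z \<partial>\<Lambda>) =
        ennreal c * (\<integral>\<^sup>+Z. (\<integral>\<^sup>+x. f ((+) x ` Z) \<partial>lborel_subspace ((direction Z)\<^sup>\<bottom>)) \<partial>\<theta>))"

text \<open>The support of a counting measure is the set of its atoms.\<close>

definition union_set :: "nat \<Rightarrow> ('w \<Rightarrow> 'a::euclidean_space set measure) \<Rightarrow> 'w \<Rightarrow> 'a set" where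
  "union_set k \<Xi> \<omega> = \<Union>{Z \<in> cylinders k. emeasure (\<Xi> \<omega>) {Z} > 0}"

definition volume_fraction ::
    "nat \<Rightarrow> 'w measure \<Rightarrow> ('w \<Rightarrow> 'a::euclidean_space set measure) \<Rightarrow> real" where
  "volume_fraction k P \<Xi> = \<P>(\<omega> in P. 0 \<in> union_set k \<Xi> \<omega>)"

definition spherical_contact ::
    "nat \<Rightarrow> 'w measure \<Rightarrow> ('w \<Rightarrow> 'a::euclidean_space set measure) \<Rightarrow> real \<Rightarrow> real" where
  "spherical_contact k P \<Xi> r =
     \<P>(\<omega> in P. union_set k \<Xi> \<omega> \<inter> cball 0 r \<noteq> {} \<bar> 0 \<notin> union_set k \<Xi> \<omega>)"

end

theory Submission
  imports Defs
begin

text \<open>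
  The union set misses the ball of radius \<open>s\<close> about the origin exactly if the process has no cylinder
  in the set \<open>F\<^sub>s\<close> of cylinders hitting this ball, and that has probability \<open>exp (- \<Lambda> F\<^sub>s)\<close>
  (\<open>void_probability\<close>). Conditioning on the origin being uncovered therefore leaves
  \<open>1 - exp (- (\<Lambda> F\<^sub>r - \<Lambda> F\<^sub>0))\<close> (\<open>spherical_contact_eq\<close>). A cylinder \<open>K + \<xi>\<close> with \<open>K\<close> orthogonal to
  \<open>\<xi>\<close> hits the ball if and only if \<open>K\<close> does, so by the disintegration of the intensity measure
  \<open>\<Lambda> F\<^sub>s\<close> is the intensity times the mean volume of the parallel body at distance \<open>s\<close> of the reflected
  base, and reflection preserves volume (\<open>intensity_hitting_cylinders\<close>). Steiner's formula expands
  this volume in powers of \<open>s\<close>; its constant term is \<open>\<Lambda> F\<^sub>0\<close> and cancels.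

  Intrinsic volumes being defined as the coefficients in Steiner's formula, the main task is to prove
  that the volume of a parallel body of a convex body \<open>K\<close> is a polynomial in the distance
  (\<open>parallel_body_volume_poly\<close>). Let \<open>p\<close> be the nearest point map of \<open>K\<close> and \<open>G x = x - p x\<close>. The map
  \<open>x + s G x\<close> with \<open>-1 < s < 1\<close> keeps nearest points and multiplies distances from \<open>K\<close> by \<open>1 + s\<close>;
  it carries the parallel body at distance \<open>R\<close> onto the one at distance \<open>(1 + s) R\<close>. Now \<open>G\<close> is
  1-Lipschitz, and for every 1-Lipschitz \<open>G\<close> and every compact convex \<open>S\<close> the volume of the image of
  \<open>S\<close> under \<open>x + s G x\<close> is a polynomial in \<open>s\<close> (\<open>volume_perturbation_poly\<close>): for smooth \<open>G\<close> it is the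
  integral over \<open>S\<close> of \<open>det (1 + s DG)\<close>, which is positive and polynomial in \<open>s\<close>; a general \<open>G\<close> is the
  uniform limit of smooth 1-Lipschitz maps, the volumes converge, and limits of polynomials of bounded
  degree are polynomials. To stay in the whole space although \<open>K\<close> lies in a subspace \<open>W\<close>, parallel
  bodies in \<open>W\<close> are multiplied by the unit ball of \<open>W\<^sup>\<bottom>\<close> (\<open>emeasure_thickened_parallel_body\<close>).

  Finally, the expansion may be integrated term by term because each intrinsic volume is a fixed
  linear combination of parallel volumes (\<open>intrinsic_volume_interpolation\<close>), which depend measurably
  on the cylinder (\<open>measurable_base_parallel_volume\<close>) and are integrable as \<open>\<Lambda>\<close> is locally finite.
\<close>

section \<open>Coordinates with respect to an orthonormal basis\<close>

text \<open>The change of variables formula is applied in \<open>real ^ 'n\<close> with a finite well-ordered index type \<open>'n\<close>;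
  this type indexes the coordinates of an arbitrary Euclidean space.\<close>

typedef (overloaded) ('a::euclidean_space) dim_index = "{..<DIM('a)}"
  by (rule exI[of _ 0]) simp

instantiation dim_index :: (euclidean_space) wellorder
begin

definition less_eq_dim_index :: "'a dim_index \<Rightarrow> 'a dim_index \<Rightarrow> bool" where
  "i \<le> j \<longleftrightarrow> Rep_dim_index i \<le> Rep_dim_index j"

definition less_dim_index :: "'a dim_index \<Rightarrow> 'a dim_index \<Rightarrow> bool" where
  "i < j \<longleftrightarrow> Rep_dim_index i < Rep_dim_index j"

instance
proof
  fix P and i :: "'a dim_index"
  assume step: "\<And>i::'a dim_index. (\<And>j. j < i \<Longrightarrow> P j) \<Longrightarrow> P i"
  show "P i"
    by (induction i rule: measure_induct_rule[of Rep_dim_index])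
      (auto intro: step simp: less_dim_index_def)
qed (auto simp: less_eq_dim_index_def less_dim_index_def Rep_dim_index_inject)

end

lemma bij_betw_Rep_dim_index: "bij_betw Rep_dim_index (UNIV :: 'a::euclidean_space dim_index set) {..<DIM('a)}"
  unfolding bij_betw_def
  using type_definition.Rep_range[OF type_definition_dim_index] Rep_dim_index_inject
  by (auto intro: injI)

instance dim_index :: (euclidean_space) finite
  by standard (use bij_betw_finite[OF bij_betw_Rep_dim_index] in auto)

definition orthonormal :: "'a::euclidean_space set \<Rightarrow> bool" where
  "orthonormal B \<longleftrightarrow> pairwise orthogonal B \<and> (\<forall>b\<in>B. norm b = 1)"

lemma orthonormal_inner:
  assumes "orthonormal B" "b \<in> B" "c \<in> B"
  shows "b \<bullet> c = (if b = c then 1 else 0)"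
  using assms by (auto simp: orthonormal_def pairwise_def orthogonal_def dot_square_norm)

lemma orthonormal_independent: "orthonormal B \<Longrightarrow> independent B"
  unfolding orthonormal_def by (rule pairwise_orthogonal_independent) auto

lemma orthonormal_finite: "orthonormal B \<Longrightarrow> finite B"
  by (rule independent_bound_general[THEN conjunct1] , rule orthonormal_independent)

lemma orthonormal_card: "orthonormal B \<Longrightarrow> card B = dim (span B)"
  using dim_eq_card_independent[OF orthonormal_independent] dim_span by metis

lemma orthonormal_inner_sum:
  assumes "orthonormal B" "c \<in> B"
  shows "(\<Sum>b\<in>B. f b *\<^sub>R b) \<bullet> c = f c"
proof -
  have "(\<Sum>b\<in>B. f b *\<^sub>R b) \<bullet> c = (\<Sum>b\<in>B. if b = c then f b else 0)"
    unfolding inner_sum_left using assms by (intro sum.cong) (auto simp: orthonormal_inner)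
  then show ?thesis using assms orthonormal_finite[OF assms(1)] by simp
qed

lemma orthonormal_norm_sum:
  assumes "orthonormal B"
  shows "(norm (\<Sum>b\<in>B. f b *\<^sub>R b))\<^sup>2 = (\<Sum>b\<in>B. (f b)\<^sup>2)"
  unfolding power2_norm_eq_inner inner_sum_right[of _ _ B]
  using orthonormal_inner_sum[OF assms] by (simp add: power2_eq_square)

lemma orthonormal_expansion:
  assumes "orthonormal B" "x \<in> span B"
  shows "x = (\<Sum>b\<in>B. (x \<bullet> b) *\<^sub>R b)"
proof -
  obtain f where x: "x = (\<Sum>b\<in>B. f b *\<^sub>R b)"
    using assms(2) span_finite[OF orthonormal_finite[OF assms(1)]] by auto
  then show ?thesis
    using orthonormal_inner_sum[OF assms(1)] by auto
qed

text \<open>For an orthonormal set that does not span the whole space, this is the Lebesgue measure of its span.\<close>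

definition orthonormal_lborel :: "'a::euclidean_space set \<Rightarrow> 'a measure" where
  "orthonormal_lborel B = distr (\<Pi>\<^sub>M b\<in>B. lborel) borel (\<lambda>f. \<Sum>b\<in>B. f b *\<^sub>R b)"

lemma sum_scaleR_measurable [measurable]:
  "(\<lambda>f. \<Sum>b\<in>B. f b *\<^sub>R b) \<in> (\<Pi>\<^sub>M b\<in>B. lborel) \<rightarrow>\<^sub>M (borel :: 'a::euclidean_space measure)"
  by measurable

text \<open>The coordinate map of \<open>B\<close> turns the measure into one with the Lebesgue values on boxes.\<close>

lemma orthonormal_coordinates:
  fixes B :: "'a::euclidean_space set"
  assumes B: "orthonormal B" "span B = UNIV"
  obtains e :: "'a \<Rightarrow> real ^ 'a dim_index" and g where "linear e" "linear g"
    "\<And>x. norm (e x) = norm x" "\<And>x. g (e x) = x" "\<And>v. e (g v) = v"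
    "distr (orthonormal_lborel B) borel e = lborel"
proof -
  have cB: "card B = DIM('a)" using orthonormal_card[OF B(1)] B(2) by simp
  then obtain h where "bij_betw h {..<DIM('a)} B"
    using ex_bij_betw_nat_finite[OF orthonormal_finite[OF B(1)]] by (auto simp: atLeast0LessThan)
  then obtain \<beta> where \<beta>: "bij_betw \<beta> (UNIV :: 'a dim_index set) B"
    using bij_betw_trans[OF bij_betw_Rep_dim_index] by blast
  have \<beta>B: "\<beta> i \<in> B" for i using \<beta> by (auto simp: bij_betw_def)
  define e :: "'a \<Rightarrow> real ^ 'a dim_index" where "e x = (\<chi> i. x \<bullet> \<beta> i)" for x
  have lin: "linear e"
    by (auto intro!: linearI simp: e_def vec_eq_iff inner_add_left)
  have norm_e: "norm (e x) = norm x" for x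
  proof -
    have "(norm (e x))\<^sup>2 = (\<Sum>i\<in>UNIV. (x \<bullet> \<beta> i)\<^sup>2)"
      by (simp add: norm_vec_def L2_set_def e_def sum_nonneg)
    also have "\<dots> = (\<Sum>b\<in>B. (x \<bullet> b)\<^sup>2)"
      by (rule sum.reindex_bij_betw[OF \<beta>])
    also have "\<dots> = (norm x)\<^sup>2"
      using orthonormal_norm_sum[OF B(1), of "\<lambda>b. x \<bullet> b"] orthonormal_expansion[OF B(1), of x] B(2)
      by simp
    finally show ?thesis by simp
  qed
  have surj: "surj e"
  proof (rule surjI)
    fix v :: "real ^ 'a dim_index"
    show "e (\<Sum>b\<in>B. (v $ the_inv_into UNIV \<beta> b) *\<^sub>R b) = v"
      using \<beta> by (simp add: e_def vec_eq_iff orthonormal_inner_sum[OF B(1) \<beta>B] the_inv_into_f_f bij_betw_def)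
  qed
  have inj: "inj e"
    using linear_injective_0[OF lin] norm_e by (metis norm_eq_zero)
  have "lborel = distr (orthonormal_lborel B) borel e"
  proof (rule lborel_eqI)
    interpret product_sigma_finite "\<lambda>_::'a. lborel :: real measure" ..
    fix l u :: "real ^ 'a dim_index"
    assume le: "\<And>b. b \<in> Basis \<Longrightarrow> l \<bullet> b \<le> u \<bullet> b"
    have le': "l $ i \<le> u $ i" for i
      using le[of "axis i 1"] by (simp add: cart_eq_inner_axis)
    let ?i = "the_inv_into UNIV \<beta>"
    have i\<beta>: "?i (\<beta> i) = i" for i using \<beta> by (simp add: the_inv_into_f_f bij_betw_def)
    have [measurable]: "e \<in> borel_measurable borel"
      by (intro borel_measurable_continuous_onI linear_continuous_on) (simp add: lin linear_conv_bounded_linear[symmetric])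
    have "e (\<Sum>b\<in>B. f b *\<^sub>R b) \<in> box l u \<longleftrightarrow> (\<forall>b\<in>B. f b \<in> {l $ ?i b<..<u $ ?i b})" for f
    proof -
      have "e (\<Sum>b\<in>B. f b *\<^sub>R b) \<in> box l u \<longleftrightarrow> (\<forall>i. f (\<beta> i) \<in> {l $ i<..<u $ i})"
        by (simp add: mem_box_cart e_def orthonormal_inner_sum[OF B(1) \<beta>B])
      also have "\<dots> \<longleftrightarrow> (\<forall>b\<in>\<beta> ` UNIV. f b \<in> {l $ ?i b<..<u $ ?i b})"
        by (simp add: i\<beta>)
      also have "\<beta> ` UNIV = B" using \<beta> by (simp add: bij_betw_def)
      finally show ?thesis .
    qed
    then have "(\<lambda>f. \<Sum>b\<in>B. f b *\<^sub>R b) -` e -` box l u \<inter> space (\<Pi>\<^sub>M b\<in>B. lborel) =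
        (\<Pi>\<^sub>E b\<in>B. {l $ ?i b<..<u $ ?i b})"
      by (auto simp: space_PiM PiE_def Pi_def)
    then have "emeasure (distr (orthonormal_lborel B) borel e) (box l u) =
        emeasure (\<Pi>\<^sub>M b\<in>B. lborel) (\<Pi>\<^sub>E b\<in>B. {l $ ?i b<..<u $ ?i b})"
      unfolding orthonormal_lborel_def
      by (simp add: emeasure_distr  measurable_sets_borel[OF \<open>e \<in> borel_measurable borel\<close>])
    also have "\<dots> = (\<Prod>b\<in>B. ennreal (u $ ?i b - l $ ?i b))"
      using orthonormal_finite[OF B(1)] le' by (subst emeasure_PiM) auto
    also have "\<dots> = (\<Prod>i\<in>UNIV. ennreal (u $ i - l $ i))"
      by (subst prod.reindex_bij_betw[OF \<beta>, symmetric]) (simp add: i\<beta>)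
    also have "\<dots> = ennreal (\<Prod>i\<in>UNIV. (u - l) $ i)"
      using le' by (simp add: prod_ennreal)
    also have "(\<Prod>i\<in>UNIV. (u - l) $ i) = (\<Prod>b\<in>Basis. (u - l) \<bullet> b)"
    proof -
      have "bij_betw (\<lambda>i. axis i (1::real)) UNIV (Basis :: (real ^ 'a dim_index) set)"
        by (auto simp: bij_betw_def Basis_vec_def inj_on_def axis_eq_axis)
      from prod.reindex_bij_betw[OF this, of "\<lambda>b. (u - l) \<bullet> b"] show ?thesis
        by (simp add: cart_eq_inner_axis)
    qed
    finally show "emeasure (distr (orthonormal_lborel B) borel e) (box l u) = (\<Prod>b\<in>Basis. (u - l) \<bullet> b)" .
  qed simp
  then have image: "distr (orthonormal_lborel B) borel e = lborel" ..
  obtain g where g: "linear g" "g \<circ> e = id"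
    using linear_injective_left_inverse[OF lin inj] by blast
  have ge: "g (e x) = x" for x using g(2) by (metis comp_apply id_apply)
  have eg: "e (g v) = v" for v using surjD[OF surj, of v] ge by auto
  show thesis by (rule that[OF lin g(1) norm_e ge eg image])
qed

lemma distr_lborel_orthogonal:
  fixes T :: "real ^ 'n::{finite,wellorder} \<Rightarrow> real ^ 'n::_"
  assumes T: "orthogonal_transformation T"
  shows "distr lborel borel T = lborel"
proof -
  have [measurable]: "T \<in> borel_measurable borel"
    using orthogonal_transformation_linear[OF T]
    by (intro borel_measurable_continuous_onI linear_continuous_on) (simp add: linear_conv_bounded_linear[symmetric])
  have "lborel = distr lborel borel T"
  proof (rule lborel_eqI)
    fix l u :: "real ^ 'n::_" assume le: "\<And>b. b \<in> Basis \<Longrightarrow> l \<bullet> b \<le> u \<bullet> b"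
    have inv: "orthogonal_transformation (inv T)" by (rule orthogonal_transformation_inv[OF T])
    have eq: "T -` box l u = inv T ` box l u"
      using orthogonal_transformation_bij[OF T] by (metis bij_vimage_eq_inv_image)
    have B: "T -` box l u \<in> sets borel" using measurable_sets[of T borel borel "box l u"] by simp
    have "measure lborel (T -` box l u) = measure lebesgue (T -` box l u)"
      using B by (simp add: measure_completion)
    also have "\<dots> = measure lebesgue (box l u)"
      unfolding eq by (rule measure_orthogonal_image[OF inv]) simp
    also have "\<dots> = measure lborel (box l u)" by (simp add: measure_completion)
    finally have m: "measure lborel (T -` box l u) = measure lborel (box l u)" .
    have "bounded (T -` box l u)"
      unfolding eq using orthogonal_transformation_linear[OF inv]
      by (intro bounded_linear_image) (auto simp: linear_conv_bounded_linear)
    then have "emeasure lborel (T -` box l u) \<noteq> \<infinity>" using emeasure_bounded_finite by force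
    then have "emeasure lborel (T -` box l u) = emeasure lborel (box l u)"
      using m emeasure_lborel_box_finite[of l u] by (simp add: emeasure_eq_ennreal_measure top.not_eq_extremum)
    then show "emeasure (distr lborel borel T) (box l u) = (\<Prod>b\<in>Basis. (u - l) \<bullet> b)"
      using le by (simp add: emeasure_distr emeasure_lborel_box_eq)
  qed simp
  then show ?thesis by simp
qed

lemma linear_borel_measurable:
  "linear f \<Longrightarrow> (f :: 'a::euclidean_space \<Rightarrow> 'b::euclidean_space) \<in> borel_measurable borel"
  by (intro borel_measurable_continuous_onI linear_continuous_on) (simp add: linear_conv_bounded_linear[symmetric])

lemma orthonormal_Basis: "orthonormal (Basis :: 'a::euclidean_space set)"
  by (auto simp: orthonormal_def pairwise_def orthogonal_def inner_Basis)

text \<open>Rotation invariance of Lebesgue measure: the coordinate maps of \<open>B\<close> and of the standard basis differ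
  by an orthogonal transformation.\<close>

lemma orthonormal_lborel_eq_lborel:
  fixes B :: "'a::euclidean_space set"
  assumes B: "orthonormal B" "span B = UNIV"
  shows "orthonormal_lborel B = lborel"
proof -
  obtain e :: "'a \<Rightarrow> real ^ 'a dim_index" and g where e: "linear e" "linear g"
    "\<And>x. norm (e x) = norm x" "\<And>x. g (e x) = x" "\<And>v. e (g v) = v"
    "distr (orthonormal_lborel B) borel e = lborel"
    by (rule orthonormal_coordinates[OF B]) (rule that)
  obtain e' :: "'a \<Rightarrow> real ^ 'a dim_index" and g' where e': "linear e'" "linear g'"
    "\<And>x. norm (e' x) = norm x" "\<And>x. g' (e' x) = x" "\<And>v. e' (g' v) = v"
    "distr (orthonormal_lborel Basis) borel e' = lborel"
    by (rule orthonormal_coordinates[OF orthonormal_Basis span_Basis]) (rule that)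
  have lb: "orthonormal_lborel (Basis :: 'a set) = lborel"
    unfolding orthonormal_lborel_def by (rule lborel_eq[symmetric])
  note [measurable] = linear_borel_measurable[OF e(1)] linear_borel_measurable[OF e(2)]
    linear_borel_measurable[OF e'(1)] linear_borel_measurable[OF e'(2)]
  have [measurable_cong]: "sets (orthonormal_lborel B) = sets borel"
    by (simp add: orthonormal_lborel_def)
  have "orthogonal_transformation (\<lambda>v. e' (g v))"
    unfolding orthogonal_transformation
  proof
    show "linear (\<lambda>v. e' (g v))" using linear_compose[OF e(2) e'(1)] by (simp add: comp_def)
    have "norm (g v) = norm v" for v using e(3)[of "g v"] by (simp add: e(5))
    then show "\<forall>v. norm (e' (g v)) = norm v" by (simp add: e'(3))
  qed
  then have T: "distr lborel borel (\<lambda>v. e' (g v)) = (lborel :: (real ^ 'a dim_index) measure)"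
    by (rule distr_lborel_orthogonal)
  have "distr (orthonormal_lborel B) borel e' = distr (distr (orthonormal_lborel B) borel e) borel (\<lambda>v. e' (g v))"
    by (simp add: distr_distr comp_def e(4))
  also have "\<dots> = distr lborel borel e'" unfolding e(6) T e'(6)[unfolded lb] ..
  finally have eq: "distr (orthonormal_lborel B) borel e' = distr lborel borel e'" .
  have "orthonormal_lborel B = distr (distr (orthonormal_lborel B) borel e') borel g'"
    by (simp add: distr_distr comp_def e'(4) distr_id2 orthonormal_lborel_def)
  also have "\<dots> = distr lborel borel (\<lambda>x. x)" unfolding eq
    by (simp add: distr_distr comp_def e'(4))
  also have "\<dots> = lborel" by (simp add: distr_id2)
  finally show ?thesis .
qed

section \<open>Limits and integrals of polynomials of bounded degree\<close>

text \<open>Lagrange interpolation. The weights depend on the nodes only and not on the polynomial, so being a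
  polynomial of degree at most \<open>n\<close> is a linear condition involving finitely many points at a time. It
  therefore survives pointwise limits and integration over a parameter.\<close>

lemma poly_interpolation_weights:
  fixes X :: "real set"
  assumes "finite X" "n < card X"
  obtains L where "\<And>x. degree (L x) < card X"
    "\<And>p s. degree p \<le> n \<Longrightarrow> poly p s = (\<Sum>x\<in>X. poly p x * poly (L x) s)"
proof
  define L where "L x = (if x \<in> X then (\<Prod>y\<in>X - {x}. [:- y / (x - y), 1 / (x - y):]) else 0)" for x
  show deg: "degree (L x) < card X" for x
  proof (cases "x \<in> X")
    case True
    have "L x = (\<Prod>y\<in>X - {x}. [:- y / (x - y), 1 / (x - y):])" using True by (simp add: L_def)
    also have "degree \<dots> \<le> (\<Sum>y\<in>X - {x}. degree [:- y / (x - y), 1 / (x - y):])"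
      using degree_prod_sum_le[of "X - {x}" "\<lambda>y. [:- y / (x - y), 1 / (x - y):]"] assms(1) by (simp add: comp_def)
    also have "\<dots> \<le> (\<Sum>y\<in>X - {x}. 1)" by (intro sum_mono) auto
    also have "\<dots> = card X - 1" using True by (simp add: card_Diff_singleton)
    also have "\<dots> < card X" using assms by linarith
    finally show ?thesis .
  qed (use assms in \<open>simp add: L_def\<close>)
  have L: "poly (L x) z = (if x = z then 1 else 0)" if "x \<in> X" "z \<in> X" for x z
  proof (cases "x = z")
    case True
    have "poly (L x) z = (\<Prod>y\<in>X - {x}. poly [:- y / (x - y), 1 / (x - y):] x)"
      using that True by (simp add: L_def poly_prod del: poly_pCons)
    also have "\<dots> = 1" by (intro prod.neutral) (auto simp: divide_simps)
    finally show ?thesis using True by simp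
  next
    case False
    have "(\<Prod>y\<in>X - {x}. poly [:- y / (x - y), 1 / (x - y):] z) = 0"
      using that False assms(1) by (intro prod_zero) (auto intro!: bexI[of _ z])
    then show ?thesis using that False by (simp add: L_def poly_prod)
  qed
  fix p :: "real poly" and s assume p: "degree p \<le> n"
  have "p = (\<Sum>x\<in>X. smult (poly p x) (L x))"
  proof (rule poly_eqI_degree[of X])
    fix z assume z: "z \<in> X"
    have "poly (\<Sum>x\<in>X. smult (poly p x) (L x)) z = (\<Sum>x\<in>X. if x = z then poly p x else 0)"
      unfolding poly_sum using L z by (intro sum.cong) auto
    then show "poly p z = poly (\<Sum>x\<in>X. smult (poly p x) (L x)) z" using z assms by simp
  next
    show "degree p < card X" using p assms by linarith
    show "degree (\<Sum>x\<in>X. smult (poly p x) (L x)) < card X"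
      using assms deg by (intro degree_sum_less) (auto intro: le_less_trans[OF degree_smult_le])
  qed
  then have "poly p s = poly (\<Sum>x\<in>X. smult (poly p x) (L x)) s" by simp
  then show "poly p s = (\<Sum>x\<in>X. poly p x * poly (L x) s)" by (simp add: poly_sum)
qed

lemma poly_interpolation_on:
  fixes S :: "real set"
  assumes "infinite S"
  obtains X L where "finite X" "X \<subseteq> S" "\<And>x. degree (L x) \<le> n"
    "\<And>p s. degree p \<le> n \<Longrightarrow> poly p s = (\<Sum>x\<in>X. poly p x * poly (L x) s)"
proof -
  obtain X where X: "X \<subseteq> S" "finite X" "card X = Suc n"
    using infinite_arbitrarily_large[OF assms] by blast
  have "n < card X" using X(3) by simp
  then obtain L where L: "\<And>x. degree (L x) < card X"
      "\<And>p s. degree p \<le> n \<Longrightarrow> poly p s = (\<Sum>x\<in>X. poly p x * poly (L x) s)"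
    using poly_interpolation_weights[OF X(2)] by blast
  have "degree (L x) \<le> n" for x using L(1)[of x] X(3) by simp
  then show thesis by (rule that[OF X(2,1) _ L(2)])
qed

lemma tendsto_poly_bounded_degree:
  fixes S :: "real set"
  assumes "infinite S" and p: "\<And>m s. s \<in> S \<Longrightarrow> f m s = poly (p m) s" "\<And>m. degree (p m) \<le> n"
    and lim: "\<And>s. s \<in> S \<Longrightarrow> (\<lambda>m::nat. f m s) \<longlonglongrightarrow> g s"
  shows "\<exists>q. degree q \<le> n \<and> (\<forall>s\<in>S. g s = poly q s)"
proof -
  obtain X L where X: "finite X" "X \<subseteq> S" and L: "\<And>x. degree (L x) \<le> n"
    "\<And>p s. degree p \<le> n \<Longrightarrow> poly p s = (\<Sum>x\<in>X. poly p x * poly (L x) s)"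
    using poly_interpolation_on[OF assms(1), of n] by blast
  have "g s = poly (\<Sum>x\<in>X. smult (g x) (L x)) s" if "s \<in> S" for s
  proof (rule LIMSEQ_unique[OF lim[OF that]])
    have eq: "f m s = (\<Sum>x\<in>X. f m x * poly (L x) s)" for m
    proof -
      have "f m s = (\<Sum>x\<in>X. poly (p m) x * poly (L x) s)"
        unfolding p(1)[OF that] by (rule L(2)[OF p(2)])
      also have "\<dots> = (\<Sum>x\<in>X. f m x * poly (L x) s)"
        using p(1) X(2) by (intro sum.cong) auto
      finally show ?thesis .
    qed
    have "(\<lambda>m. \<Sum>x\<in>X. f m x * poly (L x) s) \<longlonglongrightarrow> (\<Sum>x\<in>X. g x * poly (L x) s)"
      using X by (intro tendsto_intros lim) auto
    then show "(\<lambda>m. f m s) \<longlonglongrightarrow> poly (\<Sum>x\<in>X. smult (g x) (L x)) s"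
      by (simp add: poly_sum eq[symmetric])
  qed
  moreover have "degree (\<Sum>x\<in>X. smult (g x) (L x)) \<le> n"
    using X L(1) by (intro degree_sum_le) (auto intro: order_trans[OF degree_smult_le])
  ultimately show ?thesis by blast
qed

lemma integral_poly_bounded_degree:
  fixes S :: "real set" and f :: "'b \<Rightarrow> real \<Rightarrow> real"
  assumes "infinite S" and p: "\<And>x s. x \<in> space M \<Longrightarrow> s \<in> S \<Longrightarrow> f x s = poly (p x) s"
      "\<And>x. x \<in> space M \<Longrightarrow> degree (p x) \<le> n"
    and int: "\<And>s. s \<in> S \<Longrightarrow> integrable M (\<lambda>x. f x s)"
  shows "\<exists>q. degree q \<le> n \<and> (\<forall>s\<in>S. (\<integral>x. f x s \<partial>M) = poly q s)"
proof -
  obtain X L where X: "finite X" "X \<subseteq> S" and L: "\<And>x. degree (L x) \<le> n"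
    "\<And>p s. degree p \<le> n \<Longrightarrow> poly p s = (\<Sum>x\<in>X. poly p x * poly (L x) s)"
    using poly_interpolation_on[OF assms(1), of n] by blast
  have "(\<integral>x. f x s \<partial>M) = poly (\<Sum>t\<in>X. smult (\<integral>x. f x t \<partial>M) (L t)) s" if "s \<in> S" for s
  proof -
    have "(\<integral>x. f x s \<partial>M) = (\<integral>x. (\<Sum>t\<in>X. f x t * poly (L t) s) \<partial>M)"
    proof (rule Bochner_Integration.integral_cong[OF refl])
      fix x assume x: "x \<in> space M"
      have "f x s = (\<Sum>t\<in>X. poly (p x) t * poly (L t) s)"
        unfolding p(1)[OF x that] by (rule L(2)[OF p(2)[OF x]])
      also have "\<dots> = (\<Sum>t\<in>X. f x t * poly (L t) s)"
        using p(1)[OF x] X(2) by (intro sum.cong) auto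
      finally show "f x s = (\<Sum>t\<in>X. f x t * poly (L t) s)" .
    qed
    also have "\<dots> = (\<Sum>t\<in>X. (\<integral>x. f x t \<partial>M) * poly (L t) s)"
      using int X by (subst Bochner_Integration.integral_sum) (auto simp: subset_iff)
    finally show ?thesis by (simp add: poly_sum)
  qed
  moreover have "degree (\<Sum>t\<in>X. smult (\<integral>x. f x t \<partial>M) (L t)) \<le> n"
    using X L(1) by (intro degree_sum_le) (auto intro: order_trans[OF degree_smult_le])
  ultimately show ?thesis by blast
qed

section \<open>Smoothing of Lipschitz maps\<close>

text \<open>Composed with \<open>\<epsilon>\<^sup>2 - u \<bullet> u\<close> this gives a continuously differentiable kernel supported in a ball.\<close>

lemma has_real_derivative_pos_part_squared:
  "((\<lambda>t::real. (max 0 t)\<^sup>2) has_real_derivative 2 * max 0 t) (at t)"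
proof -
  consider "t < 0" | "t = 0" | "t > 0" by linarith
  then show ?thesis
  proof cases
    case 1
    have "((\<lambda>t::real. 0) has_real_derivative 2 * max 0 t) (at t)" using 1 by simp
    then show ?thesis
      by (rule DERIV_cong_ev[THEN iffD1, rotated 3, OF _ refl _ refl])
        (use 1 in \<open>auto intro!: eventually_mono[OF eventually_nhds_in_open[of "{..<0}"]]\<close>)
  next
    case 2
    have "(\<lambda>h::real. (max 0 h)\<^sup>2 / h) \<midarrow>0\<rightarrow> 0"
    proof (rule Lim_null_comparison)
      show "\<forall>\<^sub>F h in at 0. norm ((max 0 h)\<^sup>2 / h) \<le> \<bar>h\<bar>" for h :: real
        by (rule always_eventually) (auto simp: max_def power2_eq_square)
      show "(\<lambda>h::real. \<bar>h\<bar>) \<midarrow>0\<rightarrow> 0" by (intro tendsto_rabs_zero tendsto_ident_at)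
    qed
    then show ?thesis using 2 by (simp add: DERIV_def)
  next
    case 3
    have "((\<lambda>t::real. t\<^sup>2) has_real_derivative 2 * max 0 t) (at t)"
      using 3 by (auto intro!: derivative_eq_intros)
    then show ?thesis
      by (rule DERIV_cong_ev[THEN iffD1, rotated 3, OF _ refl _ refl])
        (use 3 in \<open>auto intro!: eventually_mono[OF eventually_nhds_in_open[of "{0<..}"]]\<close>)
  qed
qed

lemma lborel_integral_translate:
  fixes f :: "'a::euclidean_space \<Rightarrow> 'b::{banach, second_countable_topology}"
  assumes "f \<in> borel_measurable borel"
  shows "(\<integral>u. f (c + u) \<partial>lborel) = (\<integral>u. f u \<partial>lborel)"
proof -
  have "(\<integral>u. f u \<partial>lborel) = (\<integral>u. f u \<partial>(distr lborel borel ((+) c)))" by (simp add: lborel_distr_plus)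
  also have "\<dots> = (\<integral>u. f (c + u) \<partial>lborel)" using assms by (subst integral_distr) auto
  finally show ?thesis ..
qed

lemma integrable_continuous_compact_support:
  fixes f :: "'a::euclidean_space \<Rightarrow> 'b::euclidean_space"
  assumes "continuous_on UNIV f" "compact Q" "\<And>x. x \<notin> Q \<Longrightarrow> f x = 0"
  shows "integrable lborel f"
proof -
  have "integrable lborel (\<lambda>x. indicator Q x *\<^sub>R f x)"
    using assms by (intro borel_integrable_compact) (auto intro: continuous_on_subset)
  also have "(\<lambda>x. indicator Q x *\<^sub>R f x) = f" using assms(3) by (auto simp: indicator_def)
  finally show ?thesis .
qed

text \<open>\<open>H x\<close> is the average of \<open>G (x + u)\<close> over the ball of radius \<open>\<epsilon>\<close> with respect to a density. Averaging keeps
  the Lipschitz constant and moves values by at most \<open>\<epsilon>\<close>. After the substitution \<open>y = x + u\<close> the variable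
  \<open>x\<close> occurs in the density only, which makes \<open>H\<close> differentiable.\<close>

lemma lipschitz_smooth_approximation:
  fixes G :: "'a::euclidean_space \<Rightarrow> 'b::euclidean_space"
  assumes G: "1-lipschitz_on UNIV G" and "\<epsilon> > 0"
  obtains H H' where "1-lipschitz_on UNIV H" "\<And>x. norm (H x - G x) \<le> \<epsilon>"
    "\<And>x. x \<in> ball 0 R \<Longrightarrow> (H has_derivative blinfun_apply (H' x)) (at x)" "continuous_on (ball 0 R) H'"
proof -
  define w :: "'a \<Rightarrow> real" where "w u = (max 0 (\<epsilon>\<^sup>2 - u \<bullet> u))\<^sup>2" for u
  have w0: "w u \<ge> 0" for u by (simp add: w_def)
  have ws: "w u = 0" if "u \<notin> cball 0 \<epsilon>" for u
  proof -
    have "\<epsilon>\<^sup>2 \<le> (norm u)\<^sup>2" using that \<open>\<epsilon> > 0\<close> by (intro power_mono) auto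
    then show ?thesis by (simp add: w_def power2_norm_eq_inner max_def)
  qed
  have wc: "continuous_on UNIV w" unfolding w_def by (intro continuous_intros)
  have Gc: "continuous_on UNIV G" using G by (rule lipschitz_on_continuous_on)
  have iw: "integrable lborel w"
    by (rule integrable_continuous_compact_support[OF wc compact_cball[of 0 \<epsilon>] ws])
  define I where "I = (\<integral>u. w u \<partial>lborel)"
  have "I > 0"
  proof -
    have "I \<noteq> 0"
    proof
      assume "I = 0"
      then have "AE u in lborel. w u = 0"
        unfolding I_def using integral_nonneg_eq_0_iff_AE[OF iw] w0 by simp
      moreover have "w u \<noteq> 0" if "u \<in> ball 0 \<epsilon>" for u
      proof -
        have "(norm u)\<^sup>2 < \<epsilon>\<^sup>2" using that by (intro power_strict_mono) auto
        then show ?thesis by (simp add: w_def power2_norm_eq_inner max_def)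
      qed
      then have "AE u in lborel. w u = 0 \<longrightarrow> u \<notin> ball 0 \<epsilon>" by (intro AE_I2) auto
      ultimately have "AE u::'a in lborel. u \<notin> ball 0 \<epsilon>" by (rule AE_mp)
      moreover have "{u \<in> space lborel. \<not> u \<notin> ball (0::'a) \<epsilon>} = ball 0 \<epsilon>" by auto
      ultimately have "emeasure lborel (ball (0::'a) \<epsilon>) = 0"
        using AE_iff_measurable[of "ball (0::'a) \<epsilon>" lborel "\<lambda>u. u \<notin> ball 0 \<epsilon>"] by simp
      then show False
        using \<open>\<epsilon> > 0\<close> unit_ball_vol_pos[of "DIM('a)"] by (simp add: emeasure_ball)
    qed
    moreover have "I \<ge> 0" unfolding I_def by (simp add: w0)
    ultimately show ?thesis by simp
  qed
  define H where "H x = (1 / I) *\<^sub>R (\<integral>u. w u *\<^sub>R G (x + u) \<partial>lborel)" for x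
  have iwG: "integrable lborel (\<lambda>u. w u *\<^sub>R G (x + u))" for x
    by (rule integrable_continuous_compact_support[OF _ compact_cball[of 0 \<epsilon>]])
      (auto simp: ws intro!: continuous_intros wc continuous_on_compose2[OF Gc])
  have mean: "norm ((1 / I) *\<^sub>R (\<integral>u. w u *\<^sub>R D u \<partial>lborel)) \<le> c"
    if "integrable lborel (\<lambda>u. w u *\<^sub>R D u)" "\<And>u. u \<in> cball 0 \<epsilon> \<Longrightarrow> norm (D u) \<le> c" for D :: "'a \<Rightarrow> 'b" and c
  proof -
    have "norm (\<integral>u. w u *\<^sub>R D u \<partial>lborel) \<le> (\<integral>u. w u * c \<partial>lborel)"
    proof (rule Bochner_Integration.integral_norm_bound_integral[OF that(1)])
      show "integrable lborel (\<lambda>u. w u * c)" using iw by simp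
      show "norm (w u *\<^sub>R D u) \<le> w u * c" for u
        by (cases "u \<in> cball 0 \<epsilon>") (use that(2) w0 ws in \<open>auto intro: mult_left_mono\<close>)
    qed
    also have "\<dots> = I * c" by (simp add: I_def)
    finally show ?thesis using \<open>I > 0\<close> by (simp add: field_simps)
  qed
  have const: "(1 / I) *\<^sub>R (\<integral>u. w u *\<^sub>R a \<partial>lborel) = a" "integrable lborel (\<lambda>u. w u *\<^sub>R a)" for a :: 'b
    using \<open>I > 0\<close> iw by (auto simp: I_def[symmetric])
  have lipH: "1-lipschitz_on UNIV H"
  proof (rule lipschitz_onI)
    fix x y :: 'a
    have "H x - H y = (1 / I) *\<^sub>R (\<integral>u. w u *\<^sub>R (G (x + u) - G (y + u)) \<partial>lborel)"
      unfolding H_def scaleR_diff_right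
      by (simp add: Bochner_Integration.integral_diff[OF iwG iwG] scaleR_diff_right)
    also have "norm \<dots> \<le> norm (x - y)"
    proof (rule mean)
      show "integrable lborel (\<lambda>u. w u *\<^sub>R (G (x + u) - G (y + u)))"
        unfolding scaleR_diff_right by (intro Bochner_Integration.integrable_diff iwG)
      show "norm (G (x + u) - G (y + u)) \<le> norm (x - y)" for u
        using lipschitz_onD[OF G, of "x + u" "y + u"] by (simp add: dist_norm)
    qed
    finally show "dist (H x) (H y) \<le> 1 * dist x y" by (simp add: dist_norm)
  qed simp
  have approx: "norm (H x - G x) \<le> \<epsilon>" for x
  proof -
    have "H x - G x = H x - (1 / I) *\<^sub>R (\<integral>u. w u *\<^sub>R G x \<partial>lborel)" by (simp only: const)
    also have "\<dots> = (1 / I) *\<^sub>R (\<integral>u. w u *\<^sub>R (G (x + u) - G x) \<partial>lborel)"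
      unfolding H_def scaleR_diff_right[of "w _"] Bochner_Integration.integral_diff[OF iwG const(2)]
      by (simp only: scaleR_diff_right)
    also have "norm \<dots> \<le> \<epsilon>"
    proof (rule mean)
      show "integrable lborel (\<lambda>u. w u *\<^sub>R (G (x + u) - G x))"
        unfolding scaleR_diff_right by (intro Bochner_Integration.integrable_diff iwG const)
      show "norm (G (x + u) - G x) \<le> \<epsilon>" if "u \<in> cball 0 \<epsilon>" for u
        using lipschitz_onD[OF G, of "x + u" x] that by (simp add: dist_norm)
    qed
    finally show ?thesis .
  qed
  \<comment> \<open>All kernels centred in \<open>ball 0 R\<close> are supported in this box, so one integral over a fixed domain can be differentiated.\<close>
  define a b :: 'a where "a = - (R + \<epsilon>) *\<^sub>R One" and "b = (R + \<epsilon>) *\<^sub>R One"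
  have Q: "y \<in> cbox a b" if "x \<in> ball 0 R" "y - x \<in> cball 0 \<epsilon>" for x y
  proof -
    have "norm y \<le> R + \<epsilon>" using that norm_triangle_ineq[of x "y - x"] by simp
    then have "\<bar>y \<bullet> i\<bar> \<le> R + \<epsilon>" if "i \<in> Basis" for i
      using Basis_le_norm[OF that, of y] by linarith
    then show ?thesis by (force simp: a_def b_def mem_box abs_le_iff)
  qed
  have H_box: "H x = (1 / I) *\<^sub>R integral (cbox a b) (\<lambda>y. w (y - x) *\<^sub>R G y)" if x: "x \<in> ball 0 R" for x
  proof -
    have c: "continuous_on UNIV (\<lambda>y. w (y - x) *\<^sub>R G y)"
      by (auto intro!: continuous_intros Gc continuous_on_compose2[OF wc])
    have z: "w (y - x) *\<^sub>R G y = 0" if "y \<notin> cbox a b" for y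
      using Q[OF x, of y] ws[of "y - x"] that by auto
    have "(\<integral>u. w u *\<^sub>R G (x + u) \<partial>lborel) = (\<integral>y. w (y - x) *\<^sub>R G y \<partial>lborel)"
      using lborel_integral_translate[OF borel_measurable_continuous_onI[OF c], of x] by simp
    also have "\<dots> = integral UNIV (\<lambda>y. w (y - x) *\<^sub>R G y)"
      by (intro integral_lborel[symmetric] integrable_continuous_compact_support[OF c compact_cbox z])
    also have "\<dots> = integral (cbox a b) (\<lambda>y. w (y - x) *\<^sub>R G y)"
      using z by (subst Henstock_Kurzweil_Integration.integral_restrict_UNIV[symmetric])
        (auto intro!: arg_cong[of _ _ "integral UNIV"])
    finally show ?thesis by (simp add: H_def)
  qed
  define w' where "w' x y = blinfun_scaleR_left (G y) o\<^sub>L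
     ((4 * max 0 (\<epsilon>\<^sup>2 - (y - x) \<bullet> (y - x))) *\<^sub>R blinfun_inner_right (y - x))" for x y
  define H' where "H' x = (1 / I) *\<^sub>R integral (cbox a b) (w' x)" for x
  have w'_deriv: "((\<lambda>x. w (y - x) *\<^sub>R G y) has_derivative blinfun_apply (w' x y)) (at x within U)" for x y U
  proof -
    have "((\<lambda>x. \<epsilon>\<^sup>2 - (y - x) \<bullet> (y - x)) has_derivative (\<lambda>h. 2 * ((y - x) \<bullet> h))) (at x within U)"
      by (auto intro!: derivative_eq_intros simp: inner_commute)
    from has_derivative_compose[OF this
        has_real_derivative_pos_part_squared[unfolded has_field_derivative_def]]
    have "((\<lambda>x. w (y - x)) has_derivative
        (\<lambda>h. 4 * max 0 (\<epsilon>\<^sup>2 - (y - x) \<bullet> (y - x)) * ((y - x) \<bullet> h))) (at x within U)"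
      by (simp add: w_def mult_ac)
    from has_derivative_scaleR_left[OF this, of "G y"]
    moreover have "blinfun_apply (w' x y) = (\<lambda>h. (4 * max 0 (\<epsilon>\<^sup>2 - (y - x) \<bullet> (y - x)) * ((y - x) \<bullet> h)) *\<^sub>R G y)"
      by (simp add: w'_def blinfun.scaleR_left fun_eq_iff)
    ultimately show ?thesis by (simp only:)
  qed
  have w'_cont: "continuous_on (UNIV \<times> cbox a b) (\<lambda>(x, y). w' x y)"
    unfolding w'_def case_prod_beta
    by (intro bounded_bilinear.continuous_on[OF bounded_bilinear_blinfun_compose] continuous_intros
      bounded_linear.continuous_on[OF bounded_linear_blinfun_scaleR_left]
      bounded_linear.continuous_on[OF bounded_linear_blinfun_inner_right]
      continuous_on_compose2[OF Gc]) auto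
  have "(H has_derivative blinfun_apply (H' x)) (at x)" if x: "x \<in> ball 0 R" for x
  proof -
    have "((\<lambda>x. integral (cbox a b) (\<lambda>y. w (y - x) *\<^sub>R G y)) has_derivative integral (cbox a b) (w' x)) (at x within ball 0 R)"
    proof (rule leibniz_rule[OF w'_deriv _ _ x convex_ball])
      show "(\<lambda>y. w (y - z) *\<^sub>R G y) integrable_on cbox a b" for z
        by (intro integrable_continuous) (auto intro!: continuous_intros continuous_on_subset[OF Gc] continuous_on_compose2[OF wc])
      show "continuous_on (ball 0 R \<times> cbox a b) (\<lambda>(x, y). w' x y)"
        by (rule continuous_on_subset[OF w'_cont]) auto
    qed
    then have "((\<lambda>x. (1 / I) *\<^sub>R integral (cbox a b) (\<lambda>y. w (y - x) *\<^sub>R G y)) has_derivative blinfun_apply (H' x)) (at x within ball 0 R)"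
      unfolding H'_def blinfun.scaleR_left by (rule has_derivative_scaleR_right)
    then have "(H has_derivative blinfun_apply (H' x)) (at x within ball 0 R)"
      by (rule has_derivative_transform[OF x, rotated]) (simp add: H_box)
    then show ?thesis using at_within_open[OF x] by simp
  qed
  moreover have "continuous_on (ball 0 R) H'"
    unfolding H'_def
    by (intro continuous_intros integral_continuous_on_param continuous_on_subset[OF w'_cont]) auto
  ultimately show thesis by (rule that[OF lipH approx])
qed

section \<open>Volumes under Lipschitz perturbations of the identity\<close>

lemma norm_le_fraction_imp_zero:
  fixes v :: "'a::real_normed_vector"
  assumes "norm v \<le> c * norm v" "c < 1"
  shows "v = 0"
proof (rule ccontr)
  assume "v \<noteq> 0"
  then have "c * norm v < 1 * norm v" using assms(2) by (intro mult_strict_right_mono) auto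
  then show False using assms(1) by simp
qed

lemma lipschitz_derivative_norm_le:
  fixes f :: "'a::real_normed_vector \<Rightarrow> 'b::real_normed_vector"
  assumes lip: "1-lipschitz_on UNIV f" and der: "(f has_derivative f') (at x)"
  shows "norm (f' h) \<le> norm h"
proof (cases "h = 0")
  case True
  then show ?thesis using linear_0[OF has_derivative_linear[OF der]] by simp
next
  case False
  interpret f': bounded_linear f' using has_derivative_bounded_linear[OF der] .
  have "norm (f' h) / norm h \<le> 1"
  proof (rule field_le_epsilon)
    fix e :: real assume "e > 0"
    then obtain d where d: "d > 0" "\<And>y. norm (y - x) < d \<Longrightarrow> norm (f y - f x - f' (y - x)) \<le> e * norm (y - x)"
      using der unfolding has_derivative_at_alt by meson
    define t where "t = d / (2 * norm h)"
    have t: "t > 0" using d(1) False by (simp add: t_def)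
    have "norm ((x + t *\<^sub>R h) - x) < d" using d(1) False by (simp add: t_def)
    from d(2)[OF this] have 1: "norm (f (x + t *\<^sub>R h) - f x - f' (t *\<^sub>R h)) \<le> e * norm (t *\<^sub>R h)" by simp
    have 2: "norm (f (x + t *\<^sub>R h) - f x) \<le> norm (t *\<^sub>R h)"
      using lipschitz_onD[OF lip, of "x + t *\<^sub>R h" x] by (simp add: dist_norm)
    have "norm (f' (t *\<^sub>R h)) \<le> (1 + e) * norm (t *\<^sub>R h)"
      using 1 2 norm_triangle_ineq4[of "f (x + t *\<^sub>R h) - f x" "f (x + t *\<^sub>R h) - f x - f' (t *\<^sub>R h)"]
      by (simp add: algebra_simps)
    then have "norm (f' h) \<le> (1 + e) * norm h" using t by (simp add: f'.scaleR mult.left_commute)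
    then show "norm (f' h) / norm h \<le> 1 + e" using False by (simp add: field_simps)
  qed
  then show ?thesis using False by (simp add: field_simps)
qed

lemma det_perturbation_poly:
  fixes A :: "real ^ 'n ^ 'n"
  shows "\<exists>p. degree p \<le> CARD('n) \<and> (\<forall>s. det (mat 1 + s *\<^sub>R A) = poly p s)"
proof -
  define p where "p = (\<Sum>\<pi> | \<pi> permutes (UNIV :: 'n set).
      smult (of_int (sign \<pi>)) (\<Prod>i\<in>UNIV. [:if i = \<pi> i then 1 else 0, A $ i $ \<pi> i:]))"
  have "degree p \<le> CARD('n)"
    unfolding p_def
  proof (rule degree_sum_le)
    show "finite {\<pi>. \<pi> permutes (UNIV :: 'n set)}" by (rule finite_permutations) simp
    fix \<pi> :: "'n \<Rightarrow> 'n"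
    have "degree (\<Prod>i\<in>UNIV. [:if i = \<pi> i then 1 else 0, A $ i $ \<pi> i:]) \<le>
        (\<Sum>i\<in>(UNIV :: 'n set). degree [:if i = \<pi> i then 1 else 0, A $ i $ \<pi> i:])"
      using degree_prod_sum_le[of "UNIV :: 'n set" "\<lambda>i. [:if i = \<pi> i then 1 else 0, A $ i $ \<pi> i:]"]
      by (simp add: comp_def)
    also have "\<dots> \<le> (\<Sum>i\<in>(UNIV :: 'n set). 1)" by (intro sum_mono) simp
    finally show "degree (smult (of_int (sign \<pi>)) (\<Prod>i\<in>UNIV. [:if i = \<pi> i then 1 else 0, A $ i $ \<pi> i:])) \<le> CARD('n)"
      by (intro order_trans[OF degree_smult_le]) simp
  qed
  moreover have "det (mat 1 + s *\<^sub>R A) = poly p s" for s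
  proof -
    have *: "(\<Prod>i\<in>UNIV. (mat 1 + s *\<^sub>R A) $ i $ \<pi> i) = poly (\<Prod>i\<in>UNIV. [:if i = \<pi> i then 1 else 0, A $ i $ \<pi> i:]) s" for \<pi>
      unfolding poly_prod by (intro prod.cong) (auto simp: mat_def)
    then show ?thesis
      unfolding det_def p_def poly_sum poly_smult by (simp only: *)
  qed
  ultimately show ?thesis by blast
qed

text \<open>The derivative \<open>M x\<close> of \<open>H\<close> has norm at most 1, so \<open>1 + s M x\<close> is invertible for all \<open>\<bar>s\<bar> < 1\<close> and its
  determinant keeps the sign that it has at \<open>s = 0\<close>. The absolute value in the change of variables formula
  can thus be dropped, and the integrand is a polynomial in \<open>s\<close>.\<close>

lemma volume_smooth_perturbation_poly:
  fixes H :: "real ^ 'n::{finite,wellorder} \<Rightarrow> real ^ 'n::_"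
  assumes lip: "1-lipschitz_on UNIV H"
    and der: "\<And>x. x \<in> U \<Longrightarrow> (H has_derivative blinfun_apply (H' x)) (at x)"
    and cont: "continuous_on U H'" and S: "compact S" "S \<subseteq> U"
  shows "\<exists>p. degree p \<le> CARD('n) \<and> (\<forall>s\<in>{-1<..<1}. measure lborel ((\<lambda>x. x + s *\<^sub>R H x) ` S) = poly p s)"
proof -
  define M where "M x = matrix (blinfun_apply (H' x))" for x
  have mat: "matrix (\<lambda>h. h + s *\<^sub>R blinfun_apply (H' x) h) = mat 1 + s *\<^sub>R M x" for s x
    by (simp add: M_def matrix_def mat_def vec_eq_iff axis_def)
  have nz: "det (mat 1 + s *\<^sub>R M x) \<noteq> 0" if s: "\<bar>s\<bar> < 1" and x: "x \<in> U" for s x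
  proof -
    have lin: "linear (\<lambda>h. h + s *\<^sub>R blinfun_apply (H' x) h)"
      by (intro linear_compose_add linear_compose_scale_right linear_ident)
        (simp add: linear_conv_bounded_linear blinfun.bounded_linear_right)
    have "h = 0" if "h + s *\<^sub>R blinfun_apply (H' x) h = 0" for h
    proof -
      have "h = - (s *\<^sub>R blinfun_apply (H' x) h)" using that by (simp add: eq_neg_iff_add_eq_0)
      then have "norm h = norm (- (s *\<^sub>R blinfun_apply (H' x) h))" by (rule arg_cong)
      also have "\<dots> = \<bar>s\<bar> * norm (blinfun_apply (H' x) h)" by simp
      also have "\<dots> \<le> \<bar>s\<bar> * norm h"
        using lipschitz_derivative_norm_le[OF lip der[OF x]] by (intro mult_left_mono) auto
      finally show ?thesis using s by (rule norm_le_fraction_imp_zero)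
    qed
    then have "inj (\<lambda>h. h + s *\<^sub>R blinfun_apply (H' x) h)"
      using linear_injective_0[OF lin] by blast
    then show ?thesis using det_nz_iff_inj[OF lin] unfolding mat by blast
  qed
  have pos: "det (mat 1 + s *\<^sub>R M x) > 0" if s: "\<bar>s\<bar> < 1" and x: "x \<in> U" for s x
  proof -
    have "connected ((\<lambda>s. det (mat 1 + s *\<^sub>R M x)) ` {-1<..<1})"
    proof (intro connected_continuous_image)
      obtain p where "det (mat 1 + s *\<^sub>R M x) = poly p s" for s
        using det_perturbation_poly[of "M x"] by blast
      then show "continuous_on {-1<..<1} (\<lambda>s. det (mat 1 + s *\<^sub>R M x))"
        by (simp only:) (intro continuous_intros)
    qed simp
    then have conn: "is_interval ((\<lambda>s. det (mat 1 + s *\<^sub>R M x)) ` {-1<..<1})"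
      by (simp add: is_interval_connected_1)
    have "det (mat 1 + 0 *\<^sub>R M x) = 1" by simp
    then have "1 \<in> (\<lambda>s. det (mat 1 + s *\<^sub>R M x)) ` {-1<..<1}"
      by (intro image_eqI[of _ _ 0]) auto
    moreover have "det (mat 1 + s *\<^sub>R M x) \<in> (\<lambda>s. det (mat 1 + s *\<^sub>R M x)) ` {-1<..<1}"
      using s by (intro imageI) auto
    moreover have "0 \<notin> (\<lambda>s. det (mat 1 + s *\<^sub>R M x)) ` {-1<..<1}" using nz[OF _ x] by force
    ultimately show ?thesis
      using conn[unfolded is_interval_1, rule_format, of "det (mat 1 + s *\<^sub>R M x)" 1 0]
      by (cases "det (mat 1 + s *\<^sub>R M x) \<le> 0") auto
  qed
  have SL: "S \<in> sets lebesgue" using S by (simp add: compact_imp_closed)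
  have integrable: "integrable (lebesgue_on S) (\<lambda>x. det (mat 1 + s *\<^sub>R M x))" for s
  proof -
    have "continuous_on S (\<lambda>x. det (mat 1 + s *\<^sub>R M x))"
    proof -
      have "continuous_on S (\<lambda>x. M x $ i $ j)" for i j
        unfolding M_def matrix_def vec_lambda_beta
        by (intro continuous_intros continuous_on_subset[OF cont S(2)])
      then have "continuous_on S (\<lambda>x. \<Sum>\<pi> | \<pi> permutes UNIV. of_int (sign \<pi>) *
          (\<Prod>i\<in>UNIV. mat 1 $ i $ \<pi> i + s * M x $ i $ \<pi> i))"
        by (intro continuous_on_sum continuous_on_mult continuous_on_prod continuous_on_add continuous_on_const)
      then show ?thesis
        unfolding det_def by (simp only: vector_add_component vector_scaleR_component real_scaleR_def)
    qed
    then have i: "integrable lborel (\<lambda>x. indicator S x *\<^sub>R det (mat 1 + s *\<^sub>R M x))"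
      by (rule borel_integrable_compact[OF S(1)])
    then have "integrable lebesgue (\<lambda>x. indicator S x *\<^sub>R det (mat 1 + s *\<^sub>R M x))"
      by (subst integrable_completion) (auto dest: borel_measurable_integrable)
    then show ?thesis using SL by (subst integrable_restrict_space) auto
  qed
  have vol: "measure lborel ((\<lambda>x. x + s *\<^sub>R H x) ` S) = (\<integral>x. det (mat 1 + s *\<^sub>R M x) \<partial>lebesgue_on S)"
    if s: "s \<in> {-1<..<1}" for s
  proof -
    have s': "\<bar>s\<bar> < 1" using s by auto
    have derF: "((\<lambda>x. x + s *\<^sub>R H x) has_derivative (\<lambda>h. h + s *\<^sub>R blinfun_apply (H' x) h)) (at x within S)" if "x \<in> S" for x
      using has_derivative_at_withinI[OF der[of x]] that S(2)
      by (intro has_derivative_add has_derivative_ident has_derivative_scaleR_right) blast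
    have inj: "inj_on (\<lambda>x. x + s *\<^sub>R H x) S"
    proof (rule inj_onI)
      fix x y assume "x + s *\<^sub>R H x = y + s *\<^sub>R H y"
      then have "x - y = s *\<^sub>R (H y - H x)" by (simp add: algebra_simps)
      then have "norm (x - y) = \<bar>s\<bar> * norm (H y - H x)" by simp
      also have "\<dots> \<le> \<bar>s\<bar> * norm (x - y)"
        using lipschitz_onD[OF lip, of y x] by (intro mult_left_mono) (auto simp: dist_norm norm_minus_commute)
      finally have "x - y = 0" using s' by (rule norm_le_fraction_imp_zero)
      then show "x = y" by simp
    qed
    have abs: "\<bar>det (mat 1 + s *\<^sub>R M x)\<bar> = det (mat 1 + s *\<^sub>R M x)" if "x \<in> S" for x
      using pos[OF s', of x] that S(2) by auto
    have HK: "(\<lambda>x. det (mat 1 + s *\<^sub>R M x)) integrable_on S"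
      by (rule integrable_on_lebesgue_on[OF integrable SL])
    then have "(\<lambda>x. \<bar>det (mat 1 + s *\<^sub>R M x)\<bar>) integrable_on S"
      by (rule integrable_eq) (simp only: abs)
    then have "measure lebesgue ((\<lambda>x. x + s *\<^sub>R H x) ` S) = integral S (\<lambda>x. \<bar>det (mat 1 + s *\<^sub>R M x)\<bar>)"
      using measure_differentiable_image_eq[OF SL derF inj, unfolded mat] by blast
    also have "\<dots> = integral S (\<lambda>x. det (mat 1 + s *\<^sub>R M x))"
      using abs by (intro Henstock_Kurzweil_Integration.integral_cong) auto
    also have "\<dots> = (\<integral>x. det (mat 1 + s *\<^sub>R M x) \<partial>lebesgue_on S)"
      using lebesgue_integral_eq_integral[OF integrable SL] by simp
    finally have "measure lebesgue ((\<lambda>x. x + s *\<^sub>R H x) ` S) = \<dots>" .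
    moreover have "compact ((\<lambda>x. x + s *\<^sub>R H x) ` S)"
      using lipschitz_on_continuous_on[OF lip] S(1)
      by (intro compact_continuous_image continuous_intros) (auto intro: continuous_on_subset)
    ultimately show ?thesis by (simp add: measure_completion compact_imp_closed)
  qed
  have "\<forall>x. \<exists>p. degree p \<le> CARD('n) \<and> (\<forall>s. det (mat 1 + s *\<^sub>R M x) = poly p s)"
    using det_perturbation_poly by blast
  then obtain p where p: "\<And>x. degree (p x) \<le> CARD('n)" "\<And>x s. det (mat 1 + s *\<^sub>R M x) = poly (p x) s"
    unfolding choice_iff by blast
  have "\<exists>q. degree q \<le> CARD('n) \<and>
      (\<forall>s\<in>{-1<..<1}. (\<integral>x. det (mat 1 + s *\<^sub>R M x) \<partial>lebesgue_on S) = poly q s)"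
    by (rule integral_poly_bounded_degree[OF _ p(2,1) integrable]) simp
  then obtain q where q: "degree q \<le> CARD('n)"
      "\<And>s. s \<in> {-1<..<1} \<Longrightarrow> (\<integral>x. det (mat 1 + s *\<^sub>R M x) \<partial>lebesgue_on S) = poly q s" by blast
  show ?thesis by (intro exI[of _ q] conjI ballI q(1)) (simp only: vol q(2))
qed

text \<open>The perturbed images lie in shrinking neighbourhoods of the limit image. Conversely, by Banach's fixed
  point theorem every \<open>y\<close> has a preimage under \<open>x + s H m x\<close>, close to the one under \<open>x + s G x\<close>, so the
  perturbed image contains the limit image of all points of \<open>S\<close> that are not too close to the boundary.
  The image of the boundary is a null set, the map being Lipschitz.\<close>

lemma volume_perturbation_tendsto:
  fixes G :: "'a::euclidean_space \<Rightarrow> 'a"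
  assumes G: "1-lipschitz_on UNIV G" and H: "\<And>m::nat. 1-lipschitz_on UNIV (H m)"
    and approx: "\<And>m x. norm (H m x - G x) \<le> inverse (Suc m)"
    and S: "compact S" "negligible (frontier S)" and s: "\<bar>s\<bar> < 1"
  shows "(\<lambda>m. measure lborel ((\<lambda>x. x + s *\<^sub>R H m x) ` S)) \<longlonglongrightarrow> measure lborel ((\<lambda>x. x + s *\<^sub>R G x) ` S)"
proof (cases "S = {}")
  case False
  define F where "F x = x + s *\<^sub>R G x" for x
  define F' where "F' m x = x + s *\<^sub>R H m x" for m x
  define \<delta> where "\<delta> m = inverse (real (Suc m))" for m
  have \<delta>: "\<delta> m > 0" for m by (simp add: \<delta>_def)
  have \<delta>0: "\<delta> \<longlonglongrightarrow> 0" unfolding \<delta>_def by (rule LIMSEQ_inverse_real_of_nat)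
  have \<delta>dec: "\<delta> n \<le> \<delta> m" if "m \<le> n" for m n unfolding \<delta>_def using that by (intro le_imp_inverse_le) auto
  have contF: "continuous_on A F" for A
    unfolding F_def using lipschitz_on_continuous_on[OF G]
    by (intro continuous_intros) (auto intro: continuous_on_subset)
  have contF': "continuous_on A (F' m)" for A m
    unfolding F'_def using lipschitz_on_continuous_on[OF H[of m]]
    by (intro continuous_intros) (auto intro: continuous_on_subset)
  have close: "norm (F' m x - F x) \<le> \<delta> m" for m x
  proof -
    have "norm (F' m x - F x) = \<bar>s\<bar> * norm (H m x - G x)"
      by (simp add: F_def F'_def scaleR_diff_right[symmetric])
    also have "\<dots> \<le> 1 * \<delta> m" using s approx[of m x] by (intro mult_mono) (auto simp: \<delta>_def)
    finally show ?thesis by simp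
  qed
  define T where "T = F ` S"
  have T: "compact T" "T \<noteq> {}" unfolding T_def using S False by (auto intro: compact_continuous_image contF)
  have cS': "compact (F' m ` S)" for m using S by (auto intro: compact_continuous_image contF')
  \<comment> \<open>As the perturbed map differs from \<open>F\<close> by at most \<open>\<delta> m\<close>, its image stays in \<open>U m\<close>.\<close>
  define U where "U m = {y. infdist y T \<le> \<delta> m}" for m
  have U: "compact (U m)" for m
    unfolding U_def by (rule compact_infdist_le[OF T(2,1) \<delta>])
  have sub_U: "F' m ` S \<subseteq> U m" for m
  proof
    fix y assume "y \<in> F' m ` S"
    then obtain x where x: "x \<in> S" "y = F' m x" by auto
    have "infdist y T \<le> dist y (F x)" using x by (intro infdist_le) (auto simp: T_def)
    also have "\<dots> \<le> \<delta> m" using close[of m x] x by (simp add: dist_norm)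
    finally show "y \<in> U m" by (simp add: U_def)
  qed
  have "(\<lambda>m. measure lborel (U m)) \<longlonglongrightarrow> measure lborel (\<Inter>m. U m)"
  proof (rule Lim_measure_decseq)
    show "range U \<subseteq> sets lborel" using U by (auto simp: compact_imp_closed)
    show "decseq U" unfolding decseq_def U_def using \<delta>dec by (fastforce intro: order_trans)
    show "emeasure lborel (U i) \<noteq> \<infinity>" for i
      using emeasure_compact_finite[OF U[of i]] by simp
  qed
  also have "(\<Inter>m. U m) = T"
  proof -
    have "x \<in> T" if x: "\<And>m. infdist x T \<le> \<delta> m" for x
    proof -
      have "infdist x T \<le> 0" by (rule LIMSEQ_le_const[OF \<delta>0]) (use x in auto)
      then have "infdist x T = 0" using infdist_nonneg[of x T] by simp
      then show ?thesis using in_closed_iff_infdist_zero[of T] T by (simp add: compact_imp_closed)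
    qed
    moreover have "infdist x T \<le> \<delta> m" if "x \<in> T" for x m
      using that \<delta>[of m] by simp
    ultimately show ?thesis unfolding U_def by (intro equalityI subsetI INT_I CollectI) blast+
  qed
  finally have upper: "(\<lambda>m. measure lborel (U m)) \<longlonglongrightarrow> measure lborel T" .
  \<comment> \<open>A solution \<open>z\<close> of \<open>z + s H m z = x + s G x\<close> satisfies \<open>norm (z - x) \<le> \<delta> m + \<bar>s\<bar> norm (z - x)\<close>, hence \<open>norm (z - x) \<le> c m\<close>.\<close>
  define c where "c m = \<delta> m / (1 - \<bar>s\<bar>)" for m
  define A where "A m = (\<Inter>u\<in>cball 0 (c m). {x. x + u \<in> S})" for m
  have c: "c m > 0" for m using \<delta> s by (simp add: c_def)
  have A_S: "A m \<subseteq> S" for m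
  proof
    fix x assume "x \<in> A m"
    moreover have "0 \<in> cball 0 (c m)" using c[of m] by simp
    ultimately have "x + 0 \<in> S" unfolding A_def by blast
    then show "x \<in> S" by simp
  qed
  have "closed (A m)" for m
    unfolding A_def
    by (intro closed_INT ballI continuous_closed_vimage[of S "\<lambda>x. x + _", unfolded vimage_def] compact_imp_closed S)
      (auto intro!: continuous_intros)
  then have cA: "compact (A m)" for m
    using compact_Int_closed[OF S(1), of "A m"] A_S[of m] by (simp add: Int_absorb1)
  have lower_sub: "F ` A m \<subseteq> F' m ` S" for m
  proof
    fix y assume "y \<in> F ` A m"
    then obtain x where x: "x \<in> A m" "y = F x" by auto
    have "\<exists>!z. y - s *\<^sub>R H m z = z"
    proof (rule banach_fix_type[of "\<bar>s\<bar>"])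
      show "\<forall>z z'. dist (y - s *\<^sub>R H m z) (y - s *\<^sub>R H m z') \<le> \<bar>s\<bar> * dist z z'"
      proof (intro allI)
        fix z z'
        have "dist (y - s *\<^sub>R H m z) (y - s *\<^sub>R H m z') = \<bar>s\<bar> * norm (H m z' - H m z)"
          by (simp add: dist_norm scaleR_diff_right[symmetric])
        also have "\<dots> \<le> \<bar>s\<bar> * dist z z'"
          using lipschitz_onD[OF H[of m], of z' z] by (intro mult_left_mono) (auto simp: dist_norm norm_minus_commute)
        finally show "dist (y - s *\<^sub>R H m z) (y - s *\<^sub>R H m z') \<le> \<bar>s\<bar> * dist z z'" .
      qed
    qed (use s in auto)
    then obtain z where z: "y - s *\<^sub>R H m z = z" by blast
    then have yz: "y = F' m z" by (simp add: F'_def algebra_simps)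
    have "z - x = s *\<^sub>R (G x - H m z)" using yz x(2) by (simp add: F_def F'_def algebra_simps)
    then have "norm (z - x) = \<bar>s\<bar> * norm ((G x - H m x) + (H m x - H m z))" by simp
    also have "\<dots> \<le> \<bar>s\<bar> * (norm (G x - H m x) + norm (H m x - H m z))"
      by (intro mult_left_mono norm_triangle_ineq) auto
    also have "\<dots> \<le> \<bar>s\<bar> * (\<delta> m + norm (z - x))"
      using approx[of m x] lipschitz_onD[OF H[of m], of x z]
      by (intro mult_left_mono add_mono) (auto simp: \<delta>_def dist_norm norm_minus_commute)
    also have "\<dots> = \<bar>s\<bar> * \<delta> m + \<bar>s\<bar> * norm (z - x)" by (simp add: algebra_simps)
    also have "\<dots> \<le> \<delta> m + \<bar>s\<bar> * norm (z - x)"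
      using s \<delta>[of m] by (intro add_mono mult_left_le_one_le) auto
    finally have "norm (z - x) * (1 - \<bar>s\<bar>) \<le> \<delta> m" by (simp add: algebra_simps)
    then have "norm (z - x) \<le> c m" using s by (simp add: c_def pos_le_divide_eq)
    then have "z - x \<in> cball 0 (c m)" by simp
    then have "x + (z - x) \<in> S" using x(1) unfolding A_def by blast
    then show "y \<in> F' m ` S" using yz by auto
  qed
  define N where "N = F ` frontier S"
  have "compact (frontier S)" using S(1) by (rule compact_frontier)
  then have N: "compact N" unfolding N_def by (intro compact_continuous_image contF)
  have "negligible N"
    unfolding N_def
  proof (rule negligible_locally_Lipschitz_image[OF order_refl S(2)])
    fix x assume "x \<in> frontier S"
    have "norm (F y - F x) \<le> 2 * norm (y - x)" for y
    proof -
      have "F y - F x = (y - x) + s *\<^sub>R (G y - G x)" by (simp add: F_def algebra_simps)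
      also have "norm \<dots> \<le> norm (y - x) + norm (s *\<^sub>R (G y - G x))" by (rule norm_triangle_ineq)
      also have "norm (s *\<^sub>R (G y - G x)) \<le> 1 * norm (y - x)"
        unfolding norm_scaleR using s lipschitz_onD[OF G, of y x] by (intro mult_mono) (auto simp: dist_norm)
      finally show ?thesis by simp
    qed
    then show "\<exists>T B. open T \<and> x \<in> T \<and> (\<forall>y\<in>frontier S \<inter> T. norm (F y - F x) \<le> B * norm (y - x))"
      by (intro exI[of _ UNIV] exI[of _ 2]) auto
  qed
  then have N0: "N \<in> null_sets lborel"
    using N by (simp add: negligible_iff_null_sets null_sets_completion_iff compact_imp_closed)
  have cFA: "compact (F ` A m)" for m by (intro compact_continuous_image contF cA)
  have mono: "incseq (\<lambda>m. F ` A m)"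
  proof (intro incseq_SucI image_mono)
    fix m
    have "c (Suc m) \<le> c m" using \<delta>dec[of m "Suc m"] s by (simp add: c_def divide_right_mono)
    then show "A m \<subseteq> A (Suc m)" unfolding A_def by (intro INT_anti_mono) auto
  qed
  have "(\<lambda>m. measure lborel (F ` A m)) \<longlonglongrightarrow> measure lborel (\<Union>m. F ` A m)"
  proof (rule Lim_measure_incseq[OF _ mono])
    show "range (\<lambda>m. F ` A m) \<subseteq> sets lborel" using cFA by (auto simp: compact_imp_closed)
    have "emeasure lborel (\<Union>m. F ` A m) \<le> emeasure lborel T"
      using A_S T by (intro emeasure_mono) (auto simp: T_def compact_imp_closed)
    then show "emeasure lborel (\<Union>m. F ` A m) \<noteq> \<infinity>"
      using emeasure_compact_finite[OF T(1)] by (auto simp: top_unique)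
  qed
  also have "measure lborel (\<Union>m. F ` A m) = measure lborel ((\<Union>m. F ` A m) \<union> N)"
    using N0 cFA by (intro measure_Un_null_set[symmetric]) (auto simp: compact_imp_closed)
  also have "(\<Union>m. F ` A m) \<union> N = T"
  proof (intro equalityI subsetI)
    fix y assume "y \<in> (\<Union>m. F ` A m) \<union> N"
    then show "y \<in> T" using A_S frontier_subset_closed[OF compact_imp_closed[OF S(1)]] by (auto simp: T_def N_def)
  next
    fix y assume "y \<in> T"
    then obtain x where x: "x \<in> S" "y = F x" by (auto simp: T_def)
    show "y \<in> (\<Union>m. F ` A m) \<union> N"
    proof (cases "x \<in> interior S")
      case True
      then obtain e where e: "e > 0" "ball x e \<subseteq> S" using mem_interior by blast
      have "c \<longlonglongrightarrow> 0" unfolding c_def using tendsto_divide[OF \<delta>0 tendsto_const, of "1 - \<bar>s\<bar>"] s by simp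
      then obtain m where m: "c m < e" using e(1)
        by (metis (no_types, lifting) eventually_sequentially order_refl order_tendstoD(2))
      have "x \<in> A m"
        unfolding A_def
      proof (intro INT_I CollectI)
        fix u :: 'a assume "u \<in> cball 0 (c m)"
        then have "x + u \<in> ball x e" using m by (simp add: dist_norm)
        then show "x + u \<in> S" using e(2) by blast
      qed
      then show ?thesis using x by auto
    next
      case False
      then have "x \<in> frontier S" using x closure_subset by (auto simp: frontier_def)
      then show ?thesis using x by (auto simp: N_def)
    qed
  qed
  finally have lower: "(\<lambda>m. measure lborel (F ` A m)) \<longlonglongrightarrow> measure lborel T" .
  have "(\<lambda>m. measure lborel (F' m ` S)) \<longlonglongrightarrow> measure lborel T"
  proof (rule tendsto_sandwich[OF _ _ lower upper]; rule always_eventually; rule allI)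
    show "measure lborel (F ` A m) \<le> measure lborel (F' m ` S)" for m
      using fmeasurable_compact[OF cS'[of m]] fmeasurable_compact[OF cFA[of m]]
      by (intro measure_mono_fmeasurable lower_sub fmeasurableD)
    show "measure lborel (F' m ` S) \<le> measure lborel (U m)" for m
      using fmeasurable_compact[OF cS'[of m]] fmeasurable_compact[OF U[of m]]
      by (intro measure_mono_fmeasurable sub_U fmeasurableD)
  qed
  then show ?thesis unfolding T_def F_def F'_def .
qed simp

lemma volume_perturbation_poly_cart:
  fixes G :: "real ^ 'n::{finite,wellorder} \<Rightarrow> real ^ 'n::_"
  assumes G: "1-lipschitz_on UNIV G" and S: "compact S" "negligible (frontier S)"
  shows "\<exists>p. degree p \<le> CARD('n) \<and> (\<forall>s\<in>{-1<..<1}. measure lborel ((\<lambda>x. x + s *\<^sub>R G x) ` S) = poly p s)"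
proof -
  obtain R where R: "S \<subseteq> ball 0 R"
    using bounded_subset_ballD[OF compact_imp_bounded[OF S(1)], of 0] by blast
  have "\<forall>m. \<exists>H p. 1-lipschitz_on UNIV H \<and> (\<forall>x. norm (H x - G x) \<le> inverse (Suc m)) \<and> degree p \<le> CARD('n) \<and>
      (\<forall>s\<in>{-1<..<1}. measure lborel ((\<lambda>x. x + s *\<^sub>R H x) ` S) = poly p s)"
  proof
    fix m
    have "inverse (real (Suc m)) > 0" by simp
    then obtain H H' where H: "1-lipschitz_on UNIV H" "\<And>x. norm (H x - G x) \<le> inverse (Suc m)"
      "\<And>x. x \<in> ball 0 R \<Longrightarrow> (H has_derivative blinfun_apply (H' x)) (at x)" "continuous_on (ball 0 R) H'"
      by (rule lipschitz_smooth_approximation[OF G, where R = R]) (rule that)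
    obtain p where p: "degree p \<le> CARD('n)"
        "\<forall>s\<in>{-1<..<1}. measure lborel ((\<lambda>x. x + s *\<^sub>R H x) ` S) = poly p s"
      using volume_smooth_perturbation_poly[OF H(1,3,4) S(1) R] by blast
    show "\<exists>H p. 1-lipschitz_on UNIV H \<and> (\<forall>x. norm (H x - G x) \<le> inverse (Suc m)) \<and> degree p \<le> CARD('n) \<and>
      (\<forall>s\<in>{-1<..<1}. measure lborel ((\<lambda>x. x + s *\<^sub>R H x) ` S) = poly p s)"
      by (intro exI[of _ H] exI[of _ p] conjI allI H(1,2) p)
  qed
  then obtain H p where H: "\<And>m. 1-lipschitz_on UNIV (H m)" "\<And>m x. norm (H m x - G x) \<le> inverse (Suc m)"
      and p: "\<And>m. degree (p m) \<le> CARD('n)"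
      "\<And>m s. s \<in> {-1<..<1} \<Longrightarrow> measure lborel ((\<lambda>x. x + s *\<^sub>R H m x) ` S) = poly (p m) s"
    unfolding choice_iff by blast
  show ?thesis
  proof (rule tendsto_poly_bounded_degree[OF _ p(2,1)])
    show "(\<lambda>m. measure lborel ((\<lambda>x. x + s *\<^sub>R H m x) ` S)) \<longlonglongrightarrow> measure lborel ((\<lambda>x. x + s *\<^sub>R G x) ` S)"
      if "s \<in> {-1<..<1}" for s
      using that by (intro volume_perturbation_tendsto[OF G H S]) auto
  qed simp
qed

lemmas lborel_coordinates =
  orthonormal_coordinates[OF orthonormal_Basis span_Basis,
    unfolded orthonormal_lborel_eq_lborel[OF orthonormal_Basis span_Basis]]

text \<open>A linear isometry preserving Lebesgue measure carries the claim over from coordinate space.\<close>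

theorem volume_perturbation_poly:
  fixes G :: "'a::euclidean_space \<Rightarrow> 'a"
  assumes G: "1-lipschitz_on UNIV G" and S: "compact S" "convex S"
  shows "\<exists>p. \<forall>s\<in>{-1<..<1}. measure lborel ((\<lambda>x. x + s *\<^sub>R G x) ` S) = poly p s"
proof -
  obtain e :: "'a \<Rightarrow> real ^ 'a dim_index" and g where e: "linear e" "linear g"
      "\<And>x. norm (e x) = norm x" "\<And>x. g (e x) = x" "\<And>v. e (g v) = v" "distr lborel borel e = lborel"
    by (rule lborel_coordinates) blast
  have be: "bounded_linear e" "bounded_linear g" using e(1,2) by (auto simp: linear_conv_bounded_linear)
  have norm_g: "norm (g v) = norm v" for v using e(3)[of "g v"] by (simp add: e(5))
  define G' where "G' v = e (G (g v))" for v
  have "1-lipschitz_on UNIV G'"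
  proof (rule lipschitz_onI)
    fix v w
    have "dist (G' v) (G' w) = norm (G (g v) - G (g w))"
      unfolding G'_def dist_norm by (metis e(1,3) linear_diff)
    also have "\<dots> \<le> norm (g v - g w)" using lipschitz_onD[OF G, of "g v" "g w"] by (simp add: dist_norm)
    also have "\<dots> = dist v w" unfolding dist_norm by (metis e(2) norm_g linear_diff)
    finally show "dist (G' v) (G' w) \<le> 1 * dist v w" by simp
  qed simp
  moreover have "compact (e ` S)" using S(1) be by (intro compact_continuous_image linear_continuous_on)
  moreover have "negligible (frontier (e ` S))"
    by (intro negligible_convex_frontier convex_linear_image e S)
  ultimately obtain p where p: "\<And>s. s \<in> {-1<..<1} \<Longrightarrow> measure lborel ((\<lambda>v. v + s *\<^sub>R G' v) ` e ` S) = poly p s"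
    using volume_perturbation_poly_cart[of G' "e ` S"] by blast
  have "measure lborel ((\<lambda>x. x + s *\<^sub>R G x) ` S) = poly p s" if s: "s \<in> {-1<..<1}" for s
  proof -
    define A where "A = (\<lambda>x. x + s *\<^sub>R G x) ` S"
    have "compact A"
      unfolding A_def using lipschitz_on_continuous_on[OF G] S
      by (intro compact_continuous_image continuous_intros) (auto intro: continuous_on_subset)
    then have cA: "compact (e ` A)" using be by (intro compact_continuous_image linear_continuous_on)
    have "(\<lambda>v. v + s *\<^sub>R G' v) ` e ` S = e ` A"
      unfolding A_def image_image G'_def
      by (intro image_cong refl) (simp add: e(4) linear_add[OF e(1)] linear_scale[OF e(1)])
    then have "poly p s = measure lborel (e ` A)" using p[OF s] by simp
    also have "\<dots> = measure (distr lborel borel e) (e ` A)" by (simp add: e(6))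
    also have "\<dots> = measure lborel (e -` e ` A)"
      using cA linear_borel_measurable[OF e(1)] by (subst measure_distr) (auto simp: compact_imp_closed)
    also have "e -` e ` A = A" by (metis e(4) inj_on_inverseI inj_vimage_image_eq)
    finally show ?thesis by (simp add: A_def)
  qed
  then show ?thesis by blast
qed

section \<open>Parallel bodies in a subspace\<close>

text \<open>Writing \<open>a - b\<close> as the sum of the difference of the residuals and the difference of the nearest points,
  the two summands have non-negative inner product by the variational inequality.\<close>

lemma closest_point_residual_lipschitz:
  fixes K :: "'a::euclidean_space set"
  assumes "convex K" "closed K" "K \<noteq> {}"
  shows "norm ((a - closest_point K a) - (b - closest_point K b)) \<le> norm (a - b)"
proof -
  let ?p = "closest_point K a" and ?q = "closest_point K b"
  have pq: "?p \<in> K" "?q \<in> K" using closest_point_in_set[OF assms(2,3)] by auto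
  have 1: "(a - ?p) \<bullet> (?q - ?p) \<le> 0" by (rule closest_point_dot[OF assms(1,2) pq(2)])
  have 2: "(b - ?q) \<bullet> (?p - ?q) \<le> 0" by (rule closest_point_dot[OF assms(1,2) pq(1)])
  have "(norm (a - b))\<^sup>2 = (norm ((a - ?p) - (b - ?q)))\<^sup>2 + (norm (?p - ?q))\<^sup>2
      - 2 * ((a - ?p) \<bullet> (?q - ?p)) - 2 * ((b - ?q) \<bullet> (?p - ?q))"
    unfolding power2_norm_eq_inner by (simp add: inner_commute algebra_simps)
  then have "(norm ((a - ?p) - (b - ?q)))\<^sup>2 \<le> (norm (a - b))\<^sup>2"
    using 1 2 zero_le_power2[of "norm (?p - ?q)"] by linarith
  then show ?thesis by simp
qed

lemma closest_point_eqI: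
  fixes K :: "'a::euclidean_space set"
  assumes "convex K" "closed K" "p \<in> K" "\<And>z. z \<in> K \<Longrightarrow> (a - p) \<bullet> (z - p) \<le> 0"
  shows "closest_point K a = p"
proof (rule closest_point_unique[OF assms(1-3), symmetric], intro ballI)
  fix z assume "z \<in> K"
  have "(norm (a - z))\<^sup>2 = (norm (a - p))\<^sup>2 + (norm (z - p))\<^sup>2 - 2 * ((a - p) \<bullet> (z - p))"
    unfolding power2_norm_eq_inner by (simp add: inner_commute algebra_simps)
  then have "(norm (a - p))\<^sup>2 \<le> (norm (a - z))\<^sup>2"
    using assms(4)[OF \<open>z \<in> K\<close>] zero_le_power2[of "norm (z - p)"] by linarith
  then show "dist a p \<le> dist a z" by (simp add: dist_norm)
qed

lemma closest_point_subspace_sum: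
  fixes W :: "'a::euclidean_space set"
  assumes "subspace W" "a \<in> W" "y \<in> W\<^sup>\<bottom>"
  shows "closest_point W (a + y) = a"
proof (rule closest_point_eqI)
  show "((a + y) - a) \<bullet> (z - a) \<le> 0" if "z \<in> W" for z
    using assms subspace_diff[OF assms(1) that assms(2)]
    by (auto simp: orthogonal_comp_def orthogonal_def inner_commute)
qed (use assms in \<open>auto simp: subspace_imp_convex closed_subspace\<close>)

lemma orthogonal_sum_in_iff:
  fixes W :: "'a::euclidean_space set"
  assumes "subspace W" "A \<subseteq> W" "E \<subseteq> W\<^sup>\<bottom>" "u \<in> W" "v \<in> W\<^sup>\<bottom>"
  shows "u + v \<in> A + E \<longleftrightarrow> u \<in> A \<and> v \<in> E"
proof
  assume "u + v \<in> A + E"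
  then obtain a y where ay: "a \<in> A" "y \<in> E" "u + v = a + y" by (auto elim: set_plus_elim)
  have "u = closest_point W (u + v)" using closest_point_subspace_sum assms by metis
  also have "\<dots> = a" using closest_point_subspace_sum[of W a y] assms ay by auto
  finally show "u \<in> A \<and> v \<in> E" using ay by simp
qed (auto intro: set_plus_intro)

lemma orthonormal_basis_of:
  assumes "subspace W"
  shows "orthonormal (orthonormal_basis_of W)" "span (orthonormal_basis_of W) = W"
proof -
  obtain B where "pairwise orthogonal B" "\<And>x. x \<in> B \<Longrightarrow> norm x = 1" "span B = W"
    using orthonormal_basis_subspace[OF assms] by metis
  then have "\<exists>B. pairwise orthogonal B \<and> (\<forall>b\<in>B. norm b = 1) \<and> span B = W" by blast
  from someI_ex[OF this] show "orthonormal (orthonormal_basis_of W)" "span (orthonormal_basis_of W) = W"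
    unfolding orthonormal_basis_of_def orthonormal_def by auto
qed

lemma lborel_subspace_eq: "lborel_subspace W = orthonormal_lborel (orthonormal_basis_of W)"
  unfolding lborel_subspace_def orthonormal_lborel_def ..

lemma sets_orthonormal_lborel [simp, measurable_cong]: "sets (orthonormal_lborel B) = sets borel"
  by (simp add: orthonormal_lborel_def)

lemma sets_lborel_subspace [simp, measurable_cong]: "sets (lborel_subspace W) = sets borel"
  by (simp add: lborel_subspace_def)

lemma space_lborel_subspace [simp]: "space (lborel_subspace W) = UNIV"
  by (simp add: lborel_subspace_def)

lemma orthonormal_lborel_cball:
  fixes B :: "'a::euclidean_space set"
  assumes "orthonormal B" "r > 0"
  shows "emeasure (orthonormal_lborel B) (cball 0 r) = ennreal (unit_ball_vol (real (card B)) * r ^ card B)"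
proof -
  have "norm (\<Sum>b\<in>B. f b *\<^sub>R b) = sqrt (\<Sum>b\<in>B. (f b)\<^sup>2)" for f
    using orthonormal_norm_sum[OF assms(1), of f] by (metis norm_ge_zero real_sqrt_unique)
  then have "(\<lambda>f. \<Sum>b\<in>B. f b *\<^sub>R b) -` cball 0 r \<inter> space (\<Pi>\<^sub>M b\<in>B. lborel) =
      {f. sqrt (\<Sum>b\<in>B. (f b)\<^sup>2) \<le> r} \<inter> space (\<Pi>\<^sub>M b\<in>B. lborel)"
    by auto
  then have "emeasure (orthonormal_lborel B) (cball 0 r) =
      emeasure (\<Pi>\<^sub>M b\<in>B. lborel) ({f. sqrt (\<Sum>b\<in>B. (f b)\<^sup>2) \<le> r} \<inter> space (\<Pi>\<^sub>M b\<in>B. lborel))"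
    unfolding orthonormal_lborel_def by (subst emeasure_distr) auto
  then show ?thesis
    using emeasure_cball_aux[OF orthonormal_finite[OF assms(1)] assms(2)] by simp
qed

text \<open>Orthonormal bases of \<open>W\<close> and of \<open>W\<^sup>\<bottom>\<close> form one of the whole space, with respect to which Lebesgue
  measure is the product of the two Lebesgue measures.\<close>

lemma lborel_orthogonal_sum:
  fixes W :: "'a::euclidean_space set"
  assumes W: "subspace W" and A: "A \<in> sets borel" "A \<subseteq> W" and E: "E \<in> sets borel" "E \<subseteq> W\<^sup>\<bottom>"
    and AE: "A + E \<in> sets borel"
  shows "emeasure lborel (A + E) = emeasure (lborel_subspace W) A * emeasure (lborel_subspace (W\<^sup>\<bottom>)) E"
proof -
  interpret product_sigma_finite "\<lambda>_::'a. lborel :: real measure" ..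
  define B D where "B = orthonormal_basis_of W" and "D = orthonormal_basis_of (W\<^sup>\<bottom>)"
  have B: "orthonormal B" "span B = W" and D: "orthonormal D" "span D = W\<^sup>\<bottom>"
    unfolding B_def D_def by (simp_all add: orthonormal_basis_of W subspace_orthogonal_comp)
  have fin: "finite B" "finite D" using B D orthonormal_finite by auto
  have orth: "b \<bullet> c = 0" if "b \<in> W" "c \<in> W\<^sup>\<bottom>" for b c
    using that by (auto simp: orthogonal_comp_def orthogonal_def)
  have BW: "B \<subseteq> W" "D \<subseteq> W\<^sup>\<bottom>" using B D span_superset by blast+
  have disj: "B \<inter> D = {}"
  proof -
    have "b \<bullet> b = 0" if "b \<in> B" "b \<in> D" for b using orth[of b b] that BW by auto
    moreover have "norm b = 1" if "b \<in> B" for b using B(1) that by (auto simp: orthonormal_def)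
    ultimately show ?thesis by (metis disjoint_iff inner_eq_zero_iff norm_zero zero_neq_one)
  qed
  have C: "orthonormal (B \<union> D)"
    using B(1) D(1) BW orth unfolding orthonormal_def pairwise_def orthogonal_def
    by (metis (no_types, lifting) Un_iff inner_commute subset_iff)
  have "span (B \<union> D) = UNIV"
  proof -
    have "W + W\<^sup>\<bottom> \<subseteq> span (B \<union> D)"
      unfolding span_Un B(2) D(2) by (auto elim!: set_plus_elim)
    then show ?thesis using subspace_sum_orthogonal_comp[OF W] by auto
  qed
  then have lb: "lborel = orthonormal_lborel (B \<union> D)"
    using orthonormal_lborel_eq_lborel[OF C] by simp
  let ?S = "\<lambda>X (f :: 'a \<Rightarrow> real). \<Sum>b\<in>X. f b *\<^sub>R b"
  have WS: "?S B f \<in> W" "?S D f \<in> W\<^sup>\<bottom>" for f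
    using BW W subspace_orthogonal_comp[of W] by (auto intro!: subspace_sum subspace_scale)
  have S_merge: "?S (B \<union> D) (merge B D (f, g)) = ?S B f + ?S D g" for f g
  proof -
    have "?S (B \<union> D) (merge B D (f, g)) = ?S B (merge B D (f, g)) + ?S D (merge B D (f, g))"
      by (rule sum.union_disjoint[OF fin disj])
    also have "?S B (merge B D (f, g)) = ?S B f" by (intro sum.cong) (auto simp: merge_def)
    also have "?S D (merge B D (f, g)) = ?S D g" using disj by (intro sum.cong) (auto simp: merge_def)
    finally show ?thesis .
  qed
  have "emeasure lborel (A + E) = emeasure (\<Pi>\<^sub>M b\<in>B \<union> D. lborel) (?S (B \<union> D) -` (A + E) \<inter> space (\<Pi>\<^sub>M b\<in>B \<union> D. lborel))"
    using AE unfolding lb orthonormal_lborel_def by (subst emeasure_distr) auto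
  also have "\<dots> = emeasure ((\<Pi>\<^sub>M b\<in>B. lborel) \<Otimes>\<^sub>M (\<Pi>\<^sub>M b\<in>D. lborel))
      (merge B D -` (?S (B \<union> D) -` (A + E) \<inter> space (\<Pi>\<^sub>M b\<in>B \<union> D. lborel)) \<inter> space ((\<Pi>\<^sub>M b\<in>B. lborel) \<Otimes>\<^sub>M (\<Pi>\<^sub>M b\<in>D. lborel)))"
    using AE by (subst distr_merge[OF disj fin, symmetric], subst emeasure_distr)
      (auto intro!: measurable_sets[OF sum_scaleR_measurable])
  also have "merge B D -` (?S (B \<union> D) -` (A + E) \<inter> space (\<Pi>\<^sub>M b\<in>B \<union> D. lborel)) \<inter> space ((\<Pi>\<^sub>M b\<in>B. lborel) \<Otimes>\<^sub>M (\<Pi>\<^sub>M b\<in>D. lborel)) =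
      (?S B -` A \<inter> space (\<Pi>\<^sub>M b\<in>B. lborel)) \<times> (?S D -` E \<inter> space (\<Pi>\<^sub>M b\<in>D. lborel))"
  proof (rule set_eqI)
    fix fg :: "('a \<Rightarrow> real) \<times> ('a \<Rightarrow> real)"
    obtain f g where fg: "fg = (f, g)" by (cases fg)
    have "merge B D (f, g) \<in> space (\<Pi>\<^sub>M b\<in>B \<union> D. lborel)"
      if "(f, g) \<in> space ((\<Pi>\<^sub>M b\<in>B. lborel) \<Otimes>\<^sub>M (\<Pi>\<^sub>M b\<in>D. lborel :: real measure))"
      by (rule measurable_space[OF measurable_merge that])
    then show "fg \<in> merge B D -` (?S (B \<union> D) -` (A + E) \<inter> space (\<Pi>\<^sub>M b\<in>B \<union> D. lborel)) \<inter> space ((\<Pi>\<^sub>M b\<in>B. lborel) \<Otimes>\<^sub>M (\<Pi>\<^sub>M b\<in>D. lborel)) \<longleftrightarrow>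
        fg \<in> (?S B -` A \<inter> space (\<Pi>\<^sub>M b\<in>B. lborel)) \<times> (?S D -` E \<inter> space (\<Pi>\<^sub>M b\<in>D. lborel))"
      unfolding fg using orthogonal_sum_in_iff[OF W A(2) E(2) WS, of f g]
      by (simp add: S_merge space_pair_measure) blast
  qed
  also have "emeasure ((\<Pi>\<^sub>M b\<in>B. lborel) \<Otimes>\<^sub>M (\<Pi>\<^sub>M b\<in>D. lborel)) \<dots> =
      emeasure (\<Pi>\<^sub>M b\<in>B. lborel) (?S B -` A \<inter> space (\<Pi>\<^sub>M b\<in>B. lborel)) *
      emeasure (\<Pi>\<^sub>M b\<in>D. lborel) (?S D -` E \<inter> space (\<Pi>\<^sub>M b\<in>D. lborel))"
  proof -
    interpret D: sigma_finite_measure "\<Pi>\<^sub>M b\<in>D. (lborel :: real measure)"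
      by (rule sigma_finite) (rule fin)
    show ?thesis
      using A(1) E(1) by (intro D.emeasure_pair_measure_Times) (auto intro: measurable_sets[OF sum_scaleR_measurable])
  qed
  also have "\<dots> = emeasure (lborel_subspace W) A * emeasure (lborel_subspace (W\<^sup>\<bottom>)) E"
    using A(1) E(1) unfolding lborel_subspace_def B_def[symmetric] D_def[symmetric]
    by (simp add: emeasure_distr)
  finally show ?thesis .
qed

lemma parallel_body_eq: "parallel_body W K r = W \<inter> (K + cball 0 r)"
proof -
  have "x \<in> K + cball 0 r" if "y \<in> K" "dist x y \<le> r" for x y
    using set_plus_intro[of y K "x - y" "cball 0 r"] that by (simp add: dist_norm norm_minus_commute)
  moreover have "\<exists>y\<in>K. dist x y \<le> r" if "x \<in> K + cball 0 r" for x
    using that by (elim set_plus_elim) (auto simp: dist_norm intro!: bexI)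
  ultimately show ?thesis unfolding parallel_body_def by blast
qed

lemma compact_set_plus:
  fixes A B :: "'a::real_normed_vector set"
  assumes "compact A" "compact B"
  shows "compact (A + B)"
proof -
  have "A + B = {x + y |x y. x \<in> A \<and> y \<in> B}" by (auto simp: set_plus_def)
  then show ?thesis using compact_sums[OF assms] by simp
qed

lemma compact_parallel_body: "subspace W \<Longrightarrow> compact K \<Longrightarrow> compact (parallel_body W K r)"
  unfolding parallel_body_eq by (intro closed_Int_compact closed_subspace compact_set_plus compact_cball)

lemma convex_parallel_body: "subspace W \<Longrightarrow> convex K \<Longrightarrow> convex (parallel_body W K r)"
  unfolding parallel_body_eq using subspace_imp_convex by (intro convex_Int convex_set_plus) auto

text \<open>A product of full dimension: its Lebesgue volume determines that of the parallel body and involves no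
  choice of a basis of \<open>W\<close>.\<close>

definition thickened_parallel_body :: "'a::euclidean_space set \<Rightarrow> 'a set \<Rightarrow> real \<Rightarrow> 'a set" where
  "thickened_parallel_body W K r = parallel_body W K r + (W\<^sup>\<bottom> \<inter> cball 0 1)"

lemma compact_thickened_parallel_body:
  assumes "subspace W" "compact K"
  shows "compact (thickened_parallel_body W K r)"
  unfolding thickened_parallel_body_def
  by (intro compact_set_plus compact_parallel_body assms closed_Int_compact closed_subspace
      subspace_orthogonal_comp compact_cball)

lemma convex_thickened_parallel_body:
  assumes "subspace W" "convex K"
  shows "convex (thickened_parallel_body W K r)"
  unfolding thickened_parallel_body_def
  using subspace_imp_convex[OF subspace_orthogonal_comp]
  by (intro convex_set_plus convex_parallel_body assms convex_Int) auto

text \<open>The component \<open>a\<close> in \<open>W\<close> moves on the ray from its nearest point \<open>p\<close> through \<open>a\<close>, and \<open>p\<close> is the nearest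
  point of all points of this ray. Hence the distance from \<open>K\<close> is multiplied by \<open>1 + s\<close>, and moving
  back along the ray gives preimages. The component in \<open>W\<^sup>\<bottom>\<close> does not move.\<close>

lemma thickened_parallel_body_scaling:
  fixes W K :: "'a::euclidean_space set"
  assumes W: "subspace W" and K: "compact K" "convex K" "K \<noteq> {}" "K \<subseteq> W" and s: "s > -1"
  defines "G \<equiv> \<lambda>x. closest_point W x - closest_point K (closest_point W x)"
  shows "(\<lambda>x. x + s *\<^sub>R G x) ` thickened_parallel_body W K R = thickened_parallel_body W K ((1 + s) * R)"
proof -
  have cl: "closed K" using K(1) by (rule compact_imp_closed)
  have G: "G (a + y) = a - closest_point K a" if "a \<in> W" "y \<in> W\<^sup>\<bottom>" for a y
    unfolding G_def closest_point_subspace_sum[OF W that] ..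
  have near: "dist a (closest_point K a) \<le> r" if "a \<in> parallel_body W K r" for a r
    using that closest_point_le[OF cl] by (fastforce simp: parallel_body_def intro: order_trans)
  have inK: "closest_point K a \<in> K" for a by (rule closest_point_in_set[OF cl K(3)])
  show ?thesis
  proof (intro equalityI subsetI)
    fix x' assume "x' \<in> (\<lambda>x. x + s *\<^sub>R G x) ` thickened_parallel_body W K R"
    then obtain a y where ay: "a \<in> parallel_body W K R" "y \<in> W\<^sup>\<bottom> \<inter> cball 0 1" "x' = (a + y) + s *\<^sub>R G (a + y)"
      unfolding thickened_parallel_body_def by (auto elim!: set_plus_elim)
    have aW: "a \<in> W" using ay(1) by (simp add: parallel_body_def)
    define p where "p = closest_point K a"
    have p: "p \<in> K" "p \<in> W" "dist a p \<le> R" using inK near[OF ay(1)] K(4) by (auto simp: p_def)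
    have x': "x' = (p + (1 + s) *\<^sub>R (a - p)) + y"
      using ay G[OF aW, of y] by (simp add: p_def algebra_simps)
    have "dist (p + (1 + s) *\<^sub>R (a - p)) p \<le> (1 + s) * R"
      using p(3) s by (simp add: dist_norm mult_left_mono)
    moreover have "p + (1 + s) *\<^sub>R (a - p) \<in> W"
      using W aW p(2) by (intro subspace_add subspace_scale subspace_diff)
    ultimately have "p + (1 + s) *\<^sub>R (a - p) \<in> parallel_body W K ((1 + s) * R)"
      using p(1) unfolding parallel_body_def by blast
    then show "x' \<in> thickened_parallel_body W K ((1 + s) * R)"
      unfolding x' thickened_parallel_body_def using ay(2) by (rule set_plus_intro)
  next
    fix x' assume "x' \<in> thickened_parallel_body W K ((1 + s) * R)"
    then obtain a' y where ay: "a' \<in> parallel_body W K ((1 + s) * R)" "y \<in> W\<^sup>\<bottom> \<inter> cball 0 1" "x' = a' + y"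
      unfolding thickened_parallel_body_def by (auto elim!: set_plus_elim)
    have aW: "a' \<in> W" using ay(1) by (simp add: parallel_body_def)
    define p where "p = closest_point K a'"
    have p: "p \<in> K" "p \<in> W" "dist a' p \<le> (1 + s) * R" using inK near[OF ay(1)] K(4) by (auto simp: p_def)
    define a where "a = p + (1 / (1 + s)) *\<^sub>R (a' - p)"
    have a: "a \<in> W" unfolding a_def using W aW p(2) by (intro subspace_add subspace_scale subspace_diff)
    have "closest_point K a = p"
    proof (rule closest_point_eqI[OF K(2) cl p(1)])
      fix z assume "z \<in> K"
      have "(a' - p) \<bullet> (z - p) \<le> 0" unfolding p_def by (rule closest_point_dot[OF K(2) cl \<open>z \<in> K\<close>])
      then show "(a - p) \<bullet> (z - p) \<le> 0" using s by (simp add: a_def divide_le_0_iff)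
    qed
    then have Ga: "G (a + y) = a - p" using G[OF a, of y] ay(2) by auto
    have "norm (a' - p) / (1 + s) \<le> R"
      using p(3) s by (simp add: dist_norm pos_divide_le_eq mult.commute)
    then have "dist a p \<le> R" using s by (simp add: a_def dist_norm)
    then have "a \<in> parallel_body W K R" using a p(1) unfolding parallel_body_def by blast
    then have "a + y \<in> thickened_parallel_body W K R"
      unfolding thickened_parallel_body_def using ay(2) by (rule set_plus_intro)
    moreover have "x' = (a + y) + s *\<^sub>R G (a + y)"
    proof -
      have "(a + y) + s *\<^sub>R G (a + y) = p + (1 + s) *\<^sub>R (a - p) + y" unfolding Ga by (simp add: algebra_simps)
      also have "(1 + s) *\<^sub>R (a - p) = a' - p" using s by (simp add: a_def)
      finally show ?thesis using ay(3) by simp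
    qed
    ultimately show "x' \<in> (\<lambda>x. x + s *\<^sub>R G x) ` thickened_parallel_body W K R" by blast
  qed
qed

lemma thickened_parallel_body_volume_poly_local:
  fixes W K :: "'a::euclidean_space set"
  assumes W: "subspace W" and K: "compact K" "convex K" "K \<noteq> {}" "K \<subseteq> W" and R: "R > 0"
  shows "\<exists>q. \<forall>\<rho>\<in>{0<..<2 * R}. measure lborel (thickened_parallel_body W K \<rho>) = poly q \<rho>"
proof -
  define G where "G x = closest_point W x - closest_point K (closest_point W x)" for x
  have W': "convex W" "closed W" "W \<noteq> {}"
    using W subspace_imp_convex closed_subspace subspace_0 by auto
  have "1-lipschitz_on UNIV G"
  proof (rule lipschitz_onI)
    fix x y :: 'a
    have "norm (G x - G y) \<le> norm (closest_point W x - closest_point W y)"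
      unfolding G_def by (rule closest_point_residual_lipschitz[OF K(2) compact_imp_closed[OF K(1)] K(3)])
    also have "\<dots> \<le> dist x y" using closest_point_lipschitz[OF W', of x y] by (simp add: dist_norm)
    finally show "dist (G x) (G y) \<le> 1 * dist x y" by (simp add: dist_norm)
  qed simp
  from volume_perturbation_poly[OF this compact_thickened_parallel_body[OF W K(1)] convex_thickened_parallel_body[OF W K(2)]]
  obtain p where p: "\<And>s. s \<in> {-1<..<1} \<Longrightarrow>
      measure lborel ((\<lambda>x. x + s *\<^sub>R G x) ` thickened_parallel_body W K R) = poly p s" by blast
  have "measure lborel (thickened_parallel_body W K \<rho>) = poly (pcompose p [:-1, 1 / R:]) \<rho>" if "\<rho> \<in> {0<..<2 * R}" for \<rho>
  proof -
    define s where "s = \<rho> / R - 1"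
    have s: "s \<in> {-1<..<1}" "(1 + s) * R = \<rho>" using that R by (auto simp: s_def field_simps)
    have "measure lborel (thickened_parallel_body W K ((1 + s) * R)) = poly p s"
      using p[OF s(1)] thickened_parallel_body_scaling[OF W K, of s R] s(1) by (simp add: G_def)
    then show ?thesis using s(2) by (simp add: poly_pcompose s_def)
  qed
  then show ?thesis by blast
qed

lemma poly_eq_on_infinite:
  fixes p q :: "real poly"
  assumes "infinite A" "\<And>x. x \<in> A \<Longrightarrow> poly p x = poly q x"
  shows "p = q"
proof (rule ccontr)
  assume "p \<noteq> q"
  then have "finite {x. poly (p - q) x = 0}" by (intro poly_roots_finite) simp
  moreover have "A \<subseteq> {x. poly (p - q) x = 0}" using assms(2) by auto
  ultimately show False using assms(1) finite_subset by blast
qed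

text \<open>Scaling the parallel body at distance \<open>R\<close> reaches distances below \<open>2 R\<close> only, but the polynomials for
  different \<open>R\<close> agree close to 0.\<close>

lemma thickened_parallel_body_volume_poly:
  fixes W K :: "'a::euclidean_space set"
  assumes W: "subspace W" and K: "compact K" "convex K" "K \<noteq> {}" "K \<subseteq> W"
  shows "\<exists>q. \<forall>\<rho>>0. measure lborel (thickened_parallel_body W K \<rho>) = poly q \<rho>"
proof -
  have "\<forall>R. \<exists>q. R > 0 \<longrightarrow> (\<forall>\<rho>\<in>{0<..<2 * R}. measure lborel (thickened_parallel_body W K \<rho>) = poly q \<rho>)"
    using thickened_parallel_body_volume_poly_local[OF assms] by blast
  then obtain q where q: "\<And>R \<rho>. R > 0 \<Longrightarrow> \<rho> \<in> {0<..<2 * R} \<Longrightarrow> measure lborel (thickened_parallel_body W K \<rho>) = poly (q R) \<rho>"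
    unfolding choice_iff by blast
  have "measure lborel (thickened_parallel_body W K \<rho>) = poly (q 1) \<rho>" if "\<rho> > 0" for \<rho>
  proof -
    \<comment> \<open>Both distances below 2 and the distance \<open>\<rho>\<close> are in the range of the polynomial for \<open>max 1 \<rho>\<close>.\<close>
    have "q (max 1 \<rho>) = q 1"
    proof (rule poly_eq_on_infinite[of "{0<..<2}"])
      fix x :: real assume "x \<in> {0<..<2}"
      then show "poly (q (max 1 \<rho>)) x = poly (q 1) x"
        using q[of 1 x] q[of "max 1 \<rho>" x] max.cobounded1[of 1 \<rho>] by simp
    qed simp
    then show ?thesis using q[of "max 1 \<rho>" \<rho>] that by simp
  qed
  then show ?thesis by blast
qed

section \<open>Intrinsic volumes\<close>

lemma subspace_dim_orthogonal_comp:
  fixes W :: "'a::euclidean_space set"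
  assumes "subspace W"
  shows "dim W + dim (W\<^sup>\<bottom>) = DIM('a)"
  using dim_subspace_orthogonal_to_vectors[OF assms subspace_UNIV] by (simp add: orthogonal_comp_def add.commute)

lemma lborel_subspace_cball:
  fixes W :: "'a::euclidean_space set"
  assumes "subspace W" "r > 0"
  shows "emeasure (lborel_subspace W) (cball 0 r) = ennreal (unit_ball_vol (real (dim W)) * r ^ dim W)"
  using orthonormal_lborel_cball[OF orthonormal_basis_of(1)[OF assms(1)] assms(2)]
    orthonormal_card[OF orthonormal_basis_of(1)[OF assms(1)]]
  by (simp add: lborel_subspace_eq orthonormal_basis_of(2)[OF assms(1)])

lemma AE_lborel_subspace:
  assumes W: "subspace W"
  shows "AE x in lborel_subspace W. x \<in> W"
proof -
  have "(\<Sum>b\<in>orthonormal_basis_of W. f b *\<^sub>R b) \<in> W" for f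
  proof -
    have "(\<Sum>b\<in>orthonormal_basis_of W. f b *\<^sub>R b) \<in> span (orthonormal_basis_of W)"
      by (intro span_sum span_scale span_base)
    then show ?thesis using orthonormal_basis_of(2)[OF W] by simp
  qed
  then show ?thesis
    unfolding lborel_subspace_def
    using closed_subspace[OF W] by (subst AE_distr_iff) (auto simp: pred_def)
qed

lemma emeasure_thickened_parallel_body:
  fixes W :: "'a::euclidean_space set"
  assumes W: "subspace W" and K: "compact K"
  shows "emeasure lborel (thickened_parallel_body W K r) =
    emeasure (lborel_subspace W) (parallel_body W K r) * ennreal (unit_ball_vol (real (dim (W\<^sup>\<bottom>))))"
proof -
  have o: "subspace (W\<^sup>\<bottom>)" by (rule subspace_orthogonal_comp)
  have "emeasure (lborel_subspace (W\<^sup>\<bottom>)) (W\<^sup>\<bottom> \<inter> cball 0 1) = emeasure (lborel_subspace (W\<^sup>\<bottom>)) (cball 0 1)"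
    using AE_lborel_subspace[OF o] closed_subspace[OF o] by (intro emeasure_eq_AE) auto
  also have "\<dots> = ennreal (unit_ball_vol (real (dim (W\<^sup>\<bottom>))))"
    using lborel_subspace_cball[OF o, of 1] by simp
  moreover have "emeasure lborel (thickened_parallel_body W K r) =
      emeasure (lborel_subspace W) (parallel_body W K r) * emeasure (lborel_subspace (W\<^sup>\<bottom>)) (W\<^sup>\<bottom> \<inter> cball 0 1)"
    unfolding thickened_parallel_body_def
  proof (rule lborel_orthogonal_sum[OF W])
    show "parallel_body W K r \<in> sets borel" using compact_parallel_body[OF W K] by (simp add: compact_imp_closed)
    show "W\<^sup>\<bottom> \<inter> cball 0 1 \<in> sets borel" using closed_subspace[OF o] by auto
    show "parallel_body W K r + (W\<^sup>\<bottom> \<inter> cball 0 1) \<in> sets borel"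
      using compact_thickened_parallel_body[OF W K, of r] by (simp add: compact_imp_closed thickened_parallel_body_def)
  qed (auto simp: parallel_body_def)
  ultimately show ?thesis by simp
qed

lemma unit_ball_vol_nonzero: "unit_ball_vol (real m) \<noteq> 0"
  by (metis less_irrefl of_nat_0_le_iff unit_ball_vol_pos)

lemma parallel_body_mono: "r \<le> s \<Longrightarrow> parallel_body W K r \<subseteq> parallel_body W K s"
  unfolding parallel_body_def using order_trans by blast

lemma emeasure_parallel_body_finite:
  fixes W :: "'a::euclidean_space set"
  assumes W: "subspace W" and K: "compact K"
  shows "emeasure (lborel_subspace W) (parallel_body W K r) < \<infinity>"
proof (rule ccontr)
  assume "\<not> ?thesis"
  then have "emeasure (lborel_subspace W) (parallel_body W K r) = \<top>" by (simp add: not_less top_unique)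
  then have "emeasure lborel (thickened_parallel_body W K r) = \<top>"
    using unit_ball_vol_nonzero by (simp add: emeasure_thickened_parallel_body[OF assms] ennreal_top_mult)
  then show False using emeasure_compact_finite[OF compact_thickened_parallel_body[OF W K, of r]] by simp
qed

lemma parallel_body_infdist:
  assumes "compact K" "K \<noteq> {}"
  shows "parallel_body W K r = {x \<in> W. infdist x K \<le> r}"
proof -
  have "(\<exists>y\<in>K. dist x y \<le> r) \<longleftrightarrow> infdist x K \<le> r" for x
    using infdist_attains_inf[OF compact_imp_closed[OF assms(1)] assms(2), of x] infdist_le2[of _ K x r] by metis
  then show ?thesis by (simp add: parallel_body_def)
qed

lemma parallel_body_sets: "subspace W \<Longrightarrow> compact K \<Longrightarrow> parallel_body W K r \<in> sets borel"
  using compact_parallel_body[of W K r] by (simp add: compact_imp_closed)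

text \<open>Right-continuity in the distance extends the polynomial to distance 0, and later reduces statements on
  all distances to rational ones.\<close>

lemma parallel_volume_tendsto:
  fixes W :: "'a::euclidean_space set"
  assumes W: "subspace W" and K: "compact K" "K \<noteq> {}"
  shows "(\<lambda>m. measure (lborel_subspace W) (parallel_body W K (\<rho> + inverse (real (Suc m)))))
    \<longlonglongrightarrow> measure (lborel_subspace W) (parallel_body W K \<rho>)"
proof -
  define \<delta> where "\<delta> m = \<rho> + inverse (real (Suc m))" for m
  have \<delta>\<rho>: "\<delta> m \<ge> \<rho>" for m by (simp add: \<delta>_def)
  have "\<delta> \<longlonglongrightarrow> \<rho> + 0" unfolding \<delta>_def by (intro tendsto_intros LIMSEQ_inverse_real_of_nat)
  then have \<delta>0: "\<delta> \<longlonglongrightarrow> \<rho>" by simp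
  have \<delta>_mono: "\<delta> n \<le> \<delta> m" if "m \<le> n" for m n
    unfolding \<delta>_def using that by (intro add_left_mono le_imp_inverse_le) auto
  have "(\<lambda>m. measure (lborel_subspace W) (parallel_body W K (\<delta> m)))
      \<longlonglongrightarrow> measure (lborel_subspace W) (\<Inter>m. parallel_body W K (\<delta> m))"
  proof (rule Lim_measure_decseq)
    show "range (\<lambda>m. parallel_body W K (\<delta> m)) \<subseteq> sets (lborel_subspace W)"
      using parallel_body_sets[OF W K(1)] by auto
    show "decseq (\<lambda>m. parallel_body W K (\<delta> m))"
      unfolding decseq_def by (intro allI impI parallel_body_mono \<delta>_mono)
    show "emeasure (lborel_subspace W) (parallel_body W K (\<delta> i)) \<noteq> \<infinity>" for i
      using emeasure_parallel_body_finite[OF W K(1), of "\<delta> i"] by simp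
  qed
  also have "(\<Inter>m. parallel_body W K (\<delta> m)) = parallel_body W K \<rho>"
  proof (intro equalityI subsetI)
    fix x assume x: "x \<in> (\<Inter>m. parallel_body W K (\<delta> m))"
    have "infdist x K \<le> \<delta> m" for m
    proof -
      obtain y where "y \<in> K" "dist x y \<le> \<delta> m" using x unfolding parallel_body_def by blast
      then show ?thesis by (rule infdist_le2)
    qed
    then have "infdist x K \<le> \<rho>" by (intro LIMSEQ_le_const[OF \<delta>0] exI[of _ 0]) simp
    then show "x \<in> parallel_body W K \<rho>" using x by (simp add: parallel_body_infdist[OF K])
  next
    fix x assume "x \<in> parallel_body W K \<rho>"
    then show "x \<in> (\<Inter>m. parallel_body W K (\<delta> m))" using parallel_body_mono[OF \<delta>\<rho>] by blast
  qed
  finally show ?thesis by (simp only: \<delta>_def)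
qed

text \<open>The parallel body is contained in a ball of \<open>W\<close> of radius \<open>b + \<rho>\<close>. This growth forces the degree of the
  polynomial down from the dimension of the whole space to that of \<open>W\<close>.\<close>

lemma parallel_body_volume_poly:
  fixes W K :: "'a::euclidean_space set"
  assumes W: "subspace W" and K: "compact K" "convex K" "K \<noteq> {}" "K \<subseteq> W"
  shows "\<exists>q. degree q \<le> dim W \<and> (\<forall>\<rho>\<ge>0. measure (lborel_subspace W) (parallel_body W K \<rho>) = poly q \<rho>)"
proof -
  define \<kappa> where "\<kappa> = unit_ball_vol (real (dim (W\<^sup>\<bottom>)))"
  have \<kappa>: "\<kappa> > 0" unfolding \<kappa>_def by (rule unit_ball_vol_pos) simp
  define f where "f \<rho> = measure (lborel_subspace W) (parallel_body W K \<rho>)" for \<rho>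
  have f_vol: "measure lborel (thickened_parallel_body W K \<rho>) = f \<rho> * \<kappa>" for \<rho>
    using \<kappa> unfolding measure_def f_def emeasure_thickened_parallel_body[OF W K(1)] \<kappa>_def
    by (simp add: enn2real_mult)
  obtain q0 where q0: "\<And>\<rho>. \<rho> > 0 \<Longrightarrow> measure lborel (thickened_parallel_body W K \<rho>) = poly q0 \<rho>"
    using thickened_parallel_body_volume_poly[OF assms] by blast
  define q where "q = smult (1 / \<kappa>) q0"
  have q_pos: "f \<rho> = poly q \<rho>" if "\<rho> > 0" for \<rho>
    using q0[OF that] f_vol[of \<rho>] \<kappa> by (simp add: q_def field_simps)
  have q_zero: "f 0 = poly q 0"
  proof (rule LIMSEQ_unique)
    show "(\<lambda>m. f (0 + inverse (real (Suc m)))) \<longlonglongrightarrow> f 0"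
      unfolding f_def by (rule parallel_volume_tendsto[OF W K(1,3)])
    have "(\<lambda>m. poly q (0 + inverse (real (Suc m)))) \<longlonglongrightarrow> poly q (0 + 0)"
      by (intro tendsto_intros LIMSEQ_inverse_real_of_nat)
    moreover have "f (0 + inverse (real (Suc m))) = poly q (0 + inverse (real (Suc m)))" for m
      by (rule q_pos) simp
    ultimately show "(\<lambda>m. f (0 + inverse (real (Suc m)))) \<longlonglongrightarrow> poly q 0"
      by (simp only: add_0_left)
  qed
  obtain b where b: "b > 0" "\<forall>x\<in>K. norm x \<le> b"
    using compact_imp_bounded[OF K(1)] bounded_pos by blast
  define \<kappa>W where "\<kappa>W = unit_ball_vol (real (dim W))"
  have growth: "poly q \<rho> \<le> \<kappa>W * (b + \<rho>) ^ dim W" if "\<rho> > 0" for \<rho>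
  proof -
    have sub: "parallel_body W K \<rho> \<subseteq> cball 0 (b + \<rho>)"
    proof
      fix x assume "x \<in> parallel_body W K \<rho>"
      then obtain y where "y \<in> K" "dist x y \<le> \<rho>" by (auto simp: parallel_body_def)
      then have "norm y \<le> b" "norm (x - y) \<le> \<rho>" using b(2) by (auto simp: dist_norm)
      then have "norm x \<le> b + \<rho>" using norm_triangle_ineq[of y "x - y"] by simp
      then show "x \<in> cball 0 (b + \<rho>)" by simp
    qed
    have "emeasure (lborel_subspace W) (parallel_body W K \<rho>) \<le> emeasure (lborel_subspace W) (cball 0 (b + \<rho>))"
      using sub by (intro emeasure_mono) auto
    also have "\<dots> = ennreal (\<kappa>W * (b + \<rho>) ^ dim W)"
      unfolding \<kappa>W_def using b(1) that by (intro lborel_subspace_cball W) simp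
    finally have "f \<rho> \<le> \<kappa>W * (b + \<rho>) ^ dim W"
      unfolding f_def measure_def using b(1) that by (intro enn2real_leI) (auto simp: \<kappa>W_def)
    then show ?thesis using q_pos[OF that] by simp
  qed
  have "degree q \<le> dim W"
  proof (rule ccontr)
    assume deg: "\<not> degree q \<le> dim W"
    then have "lead_coeff q \<noteq> 0" by auto
    have nonneg: "poly q \<rho> \<ge> 0" if "\<rho> > 0" for \<rho> unfolding q_pos[OF that, symmetric] f_def by (rule measure_nonneg)
    have lc: "lead_coeff q > 0"
    proof (rule ccontr)
      assume "\<not> lead_coeff q > 0"
      then have "lead_coeff (- q) > 0" using \<open>lead_coeff q \<noteq> 0\<close> by (simp only: lead_coeff_minus)
      then have "\<exists>n. \<forall>x\<ge>n. lead_coeff (- q) \<le> poly (- q) x" by (rule poly_pinfty_gt_lc)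
      then obtain n where "\<forall>x\<ge>n. lead_coeff (- q) \<le> poly (- q) x" ..
      then have "poly (- q) (max n 1) \<ge> lead_coeff (- q)" by simp
      then have "poly q (max n 1) < 0" using \<open>lead_coeff (- q) > 0\<close> by (simp add: lead_coeff_minus)
      then show False using nonneg[of "max n 1"] by (simp add: less_max_iff_disj)
    qed
    \<comment> \<open>If the degree were larger, \<open>q - p\<close> would be eventually positive, contradicting the growth bound \<open>p\<close>.\<close>
    define p where "p = smult \<kappa>W ([:b, 1:] ^ dim W)"
    have p: "degree p \<le> dim W"
      unfolding p_def by (rule order_trans[OF degree_smult_le]) (simp add: degree_linear_power)
    have poly_p: "poly p x = \<kappa>W * (b + x) ^ dim W" for x by (simp add: p_def)
    have dq: "degree (q - p) = degree q" "lead_coeff (q - p) = lead_coeff q"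
    proof -
      have lt: "degree p < degree q" using deg p by linarith
      then show 1: "degree (q - p) = degree q" using degree_add_eq_left[of "- p" q] by simp
      show "lead_coeff (q - p) = lead_coeff q" unfolding 1 using lt by (simp add: coeff_eq_0)
    qed
    have "\<exists>n. \<forall>x\<ge>n. lead_coeff (q - p) \<le> poly (q - p) x"
      by (rule poly_pinfty_gt_lc) (use dq lc in simp)
    then obtain n where "\<forall>x\<ge>n. lead_coeff (q - p) \<le> poly (q - p) x" ..
    then have "poly (q - p) (max n 1) \<ge> lead_coeff q" unfolding dq(2) by simp
    then show False using growth[of "max n 1"] lc poly_p[of "max n 1"] by (simp add: less_max_iff_disj)
  qed
  moreover have "f \<rho> = poly q \<rho>" if "\<rho> \<ge> 0" for \<rho> using q_pos[of \<rho>] q_zero that by (cases "\<rho> = 0") auto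
  ultimately show ?thesis unfolding f_def by blast
qed

lemma poly_as_sum:
  fixes p :: "real poly"
  assumes "degree p \<le> n"
  shows "poly p x = (\<Sum>i\<le>n. coeff p i * x ^ i)"
  unfolding poly_altdef using assms
  by (intro sum.mono_neutral_left) (auto simp: coeff_eq_0)

text \<open>The Steiner coefficients are unique because polynomials that agree on the half-line coincide.\<close>

lemma intrinsic_volume_eq_coeff:
  fixes W K :: "'a::euclidean_space set"
  assumes q: "degree q \<le> dim W" "\<And>\<rho>. \<rho> \<ge> 0 \<Longrightarrow> measure (lborel_subspace W) (parallel_body W K \<rho>) = poly q \<rho>"
    and j: "j \<le> dim W"
  shows "intrinsic_volume W j K = coeff q (dim W - j) / unit_ball_vol (real (dim W - j))"
proof -
  let ?n = "dim W"
  define V where "V i = (if i \<le> ?n then coeff q (?n - i) / unit_ball_vol (real (?n - i)) else 0)" for i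
  note nz = unit_ball_vol_nonzero
  have V: "(\<Sum>i\<le>?n. r ^ (?n - i) * unit_ball_vol (real (?n - i)) * V i) = poly q r" for r
  proof -
    have "(\<Sum>i\<le>?n. r ^ (?n - i) * unit_ball_vol (real (?n - i)) * V i) = (\<Sum>i\<le>?n. coeff q (?n - i) * r ^ (?n - i))"
      using nz by (intro sum.cong) (auto simp: V_def simp del: of_nat_diff)
    also have "\<dots> = (\<Sum>i\<le>?n. coeff q i * r ^ i)"
      using sum.nat_diff_reindex[of "\<lambda>i. coeff q i * r ^ i" "Suc ?n"] by (simp add: lessThan_Suc_atMost)
    also have "\<dots> = poly q r" using poly_as_sum[OF q(1)] by simp
    finally show ?thesis .
  qed
  have "(THE V. (\<forall>i>?n. V i = 0) \<and> (\<forall>r\<ge>0. measure (lborel_subspace W) (parallel_body W K r) =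
           (\<Sum>i\<le>?n. r ^ (?n - i) * unit_ball_vol (real (?n - i)) * V i))) = V"
  proof (rule the_equality)
    show "(\<forall>i>?n. V i = 0) \<and> (\<forall>r\<ge>0. measure (lborel_subspace W) (parallel_body W K r) =
           (\<Sum>i\<le>?n. r ^ (?n - i) * unit_ball_vol (real (?n - i)) * V i))"
      unfolding V using q(2) by (simp add: V_def)
  next
    fix V' assume V': "(\<forall>i>?n. V' i = 0) \<and> (\<forall>r\<ge>0. measure (lborel_subspace W) (parallel_body W K r) =
           (\<Sum>i\<le>?n. r ^ (?n - i) * unit_ball_vol (real (?n - i)) * V' i))"
    define q' where "q' = (\<Sum>i\<le>?n. monom (unit_ball_vol (real (?n - i)) * V' i) (?n - i))"
    have "q' = q"
    proof (rule poly_eq_on_infinite[of "{0..}"])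
      fix r :: real assume "r \<in> {0..}"
      then show "poly q' r = poly q r"
        using V' q(2)[of r] by (simp add: q'_def poly_sum poly_monom mult_ac)
    qed (simp add: infinite_Ici)
    show "V' = V"
    proof
      fix i
      show "V' i = V i"
      proof (cases "i \<le> ?n")
        case True
        have "coeff q' (?n - i) = (\<Sum>l\<le>?n. if l = i then unit_ball_vol (real (?n - i)) * V' i else 0)"
          unfolding q'_def coeff_sum using True by (intro sum.cong) auto
        also have "\<dots> = unit_ball_vol (real (?n - i)) * V' i" using True by simp
        finally show ?thesis using True nz \<open>q' = q\<close> by (simp add: V_def del: of_nat_diff)
      qed (use V' in \<open>simp add: V_def\<close>)
    qed
  qed
  then show ?thesis unfolding intrinsic_volume_def using j by (simp add: V_def)
qed

theorem steiner_formula: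
  fixes W K :: "'a::euclidean_space set"
  assumes "subspace W" "compact K" "convex K" "K \<noteq> {}" "K \<subseteq> W" "r \<ge> 0"
  shows "measure (lborel_subspace W) (parallel_body W K r) =
    (\<Sum>i\<le>dim W. unit_ball_vol (real i) * r ^ i * intrinsic_volume W (dim W - i) K)"
proof -
  obtain q where q: "degree q \<le> dim W" "\<forall>\<rho>\<ge>0. measure (lborel_subspace W) (parallel_body W K \<rho>) = poly q \<rho>"
    using parallel_body_volume_poly[OF assms(1-5)] by (elim exE conjE)
  note nz = unit_ball_vol_nonzero
  have "measure (lborel_subspace W) (parallel_body W K r) = (\<Sum>i\<le>dim W. coeff q i * r ^ i)"
    using q(2) assms(6) poly_as_sum[OF q(1), of r] by simp
  also have "\<dots> = (\<Sum>i\<le>dim W. unit_ball_vol (real i) * r ^ i * intrinsic_volume W (dim W - i) K)"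
    using nz by (intro sum.cong) (auto simp: intrinsic_volume_eq_coeff[OF q(1) q(2)[rule_format]])
  finally show ?thesis .
qed

text \<open>The nodes \<open>X\<close> and the weights \<open>w\<close> do not depend on \<open>W\<close> and \<open>K\<close>, so integrability of parallel volumes is
  inherited by intrinsic volumes.\<close>

lemma intrinsic_volume_interpolation:
  assumes "j \<le> n"
  obtains X w where "finite X" "X \<subseteq> {0..}"
    "\<And>(W :: 'a::euclidean_space set) K. subspace W \<Longrightarrow> dim W = n \<Longrightarrow> compact K \<Longrightarrow> convex K \<Longrightarrow> K \<noteq> {} \<Longrightarrow> K \<subseteq> W \<Longrightarrow>
      intrinsic_volume W j K = (\<Sum>t\<in>X. w t * measure (lborel_subspace W) (parallel_body W K t))"
proof -
  obtain X :: "real set" and L where X: "finite X" "X \<subseteq> {0..}" and L: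
    "\<And>p s. degree p \<le> n \<Longrightarrow> poly p s = (\<Sum>t\<in>X. poly p t * poly (L t) s)"
    by (rule poly_interpolation_on[OF infinite_Ici[of "0::real"], where n = n]) (rule that)
  define w where "w t = coeff (L t) (n - j) / unit_ball_vol (real (n - j))" for t
  have "intrinsic_volume W j K = (\<Sum>t\<in>X. w t * measure (lborel_subspace W) (parallel_body W K t))"
    if W: "subspace W" "dim W = n" and K: "compact K" "convex K" "K \<noteq> {}" "K \<subseteq> W" for W K :: "'a set"
  proof -
    obtain q where q: "degree q \<le> dim W" "\<forall>\<rho>\<ge>0. measure (lborel_subspace W) (parallel_body W K \<rho>) = poly q \<rho>"
      using parallel_body_volume_poly[OF W(1) K] by (elim exE conjE)
    have "poly q s = poly (\<Sum>t\<in>X. smult (poly q t) (L t)) s" for s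
      unfolding poly_sum poly_smult using q(1) W(2) by (intro L) simp
    then have "q = (\<Sum>t\<in>X. smult (poly q t) (L t))" by (intro poly_ext)
    then have "coeff q (n - j) = coeff (\<Sum>t\<in>X. smult (poly q t) (L t)) (n - j)" by (rule arg_cong)
    also have "\<dots> = (\<Sum>t\<in>X. poly q t * coeff (L t) (n - j))" by (simp add: coeff_sum)
    finally have "coeff q (n - j) = \<dots>" .
    then have "intrinsic_volume W j K = (\<Sum>t\<in>X. poly q t * coeff (L t) (n - j)) / unit_ball_vol (real (n - j))"
      using intrinsic_volume_eq_coeff[OF q(1) q(2)[rule_format], of j] assms W(2) by simp
    also have "\<dots> = (\<Sum>t\<in>X. w t * poly q t)" by (simp add: sum_divide_distrib w_def mult_ac)
    also have "\<dots> = (\<Sum>t\<in>X. w t * measure (lborel_subspace W) (parallel_body W K t))"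
      using q(2) X(2) by (intro sum.cong) auto
    finally show ?thesis .
  qed
  then show thesis by (rule that[OF X, of w])
qed

text \<open>Null sets of the shape distribution may have non-measurable subsets. Measurability of the intrinsic
  volumes therefore concerns non-convex bases as well, whose parallel volume may fail to be a polynomial.
  In that case the definite description in the definition has a value not depending on \<open>K\<close>.\<close>

lemma intrinsic_volume_undefined:
  fixes W K :: "'a::euclidean_space set"
  assumes "\<nexists>q. degree q \<le> dim W \<and> (\<forall>\<rho>\<ge>0. measure (lborel_subspace W) (parallel_body W K \<rho>) = poly q \<rho>)"
  shows "intrinsic_volume W j K = (THE V. False) j"
proof -
  let ?n = "dim W"
  have no_expansion: "\<not> (\<forall>r\<ge>0. measure (lborel_subspace W) (parallel_body W K r) =
           (\<Sum>i\<le>?n. r ^ (?n - i) * unit_ball_vol (real (?n - i)) * V i))" for V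
  proof
    assume V: "\<forall>r\<ge>0. measure (lborel_subspace W) (parallel_body W K r) =
           (\<Sum>i\<le>?n. r ^ (?n - i) * unit_ball_vol (real (?n - i)) * V i)"
    define q where "q = (\<Sum>i\<le>?n. monom (unit_ball_vol (real (?n - i)) * V i) (?n - i))"
    have "degree q \<le> ?n"
      unfolding q_def by (intro degree_sum_le) (auto intro: order_trans[OF degree_monom_le])
    moreover have "\<forall>\<rho>\<ge>0. measure (lborel_subspace W) (parallel_body W K \<rho>) = poly q \<rho>"
      using V by (simp add: q_def poly_sum poly_monom mult_ac)
    ultimately show False using assms by blast
  qed
  show ?thesis unfolding intrinsic_volume_def by (simp only: no_expansion simp_thms)
qed

section \<open>Measurable dependence on the cylinder\<close>

lemma lipschitz_measurable_metric_borel: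
  assumes "Metric_space M d" and f: "\<And>x y. x \<in> M \<Longrightarrow> y \<in> M \<Longrightarrow> f x \<le> f y + c * d x y" and c: "c \<ge> 0"
  shows "f \<in> borel_measurable (sigma M {U. openin (Metric_space.mtopology M d) U})"
proof -
  interpret Metric_space M d by fact
  have sub: "{U. openin mtopology U} \<subseteq> Pow M" using openin_subset[of mtopology] by auto
  show ?thesis
  proof (rule borel_measurableI_less)
    fix a :: real
    have "openin mtopology {x \<in> M. f x < a}"
      unfolding openin_mtopology
    proof (intro conjI allI impI)
      fix x assume "x \<in> {x \<in> M. f x < a}"
      then have x: "x \<in> M" "f x < a" by auto
      define e where "e = (a - f x) / (c + 1)"
      have e: "e > 0" using x c by (simp add: e_def)
      have "f y < a" if "y \<in> M" "d x y < e" for y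
      proof -
        have "f y \<le> f x + c * d x y" using f[OF that(1) x(1)] commute[of y x] by simp
        also have "\<dots> \<le> f x + c * e" using that(2) c by (simp add: mult_left_mono)
        also have "\<dots> < f x + (c + 1) * e" using e by (simp add: algebra_simps)
        also have "\<dots> = a" using c by (simp add: e_def)
        finally show ?thesis .
      qed
      then show "\<exists>r>0. mball x r \<subseteq> {x \<in> M. f x < a}" using e by (intro exI[of _ e]) (auto simp: mball_def)
    qed auto
    then show "{x \<in> space (sigma M {U. openin mtopology U}). f x < a} \<in> sets (sigma M {U. openin mtopology U})"
      using sub by (simp add: space_measure_of sets_measure_of sigma_sets.Basic)
  qed
qed

lemma infdist_hausdorff_lipschitz:
  fixes K K' :: "'a::metric_space set"
  assumes "K \<noteq> {}" "K' \<noteq> {}" "bounded K" "bounded K'"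
  shows "infdist q K \<le> infdist q K' + hausdorff_dist K K'"
proof (rule field_le_epsilon)
  fix e :: real assume "e > 0"
  have "\<exists>y\<in>K'. dist q y < infdist q K' + e"
  proof (rule ccontr)
    assume "\<not> ?thesis"
    then have "infdist q K' + e \<le> (INF y\<in>K'. dist q y)" by (intro cINF_greatest assms(2)) force
    then show False using \<open>e > 0\<close> infdist_notempty[OF assms(2), of q] by simp
  qed
  then obtain y where y: "y \<in> K'" "dist q y < infdist q K' + e" by blast
  have "infdist y K \<le> hausdorff_dist K K'"
    using hausdorff_dist_le_iff[OF assms, of "hausdorff_dist K K'"] y(1) by simp
  then show "infdist q K \<le> infdist q K' + hausdorff_dist K K' + e"
    using infdist_triangle[of q K y] y(2) by simp
qed

text \<open>The nearest point of \<open>q\<close> in \<open>\<xi>\<close> is no longer than \<open>q\<close>; scaled to norm 1 it is within the distance of the unit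
  balls from \<open>\<eta>\<close>.\<close>

lemma infdist_subspace_lipschitz:
  fixes \<xi> \<eta> :: "'a::euclidean_space set"
  assumes \<xi>: "subspace \<xi>" and \<eta>: "subspace \<eta>"
  shows "infdist q \<eta> \<le> infdist q \<xi> + norm q * subspace_dist \<xi> \<eta>"
proof -
  define \<delta> where "\<delta> = subspace_dist \<xi> \<eta>"
  have \<delta>: "\<delta> \<ge> 0" unfolding \<delta>_def subspace_dist_def by (rule hausdorff_dist_nonneg)
  have zero: "0 \<in> \<xi>" "0 \<in> \<eta>" using \<xi> \<eta> subspace_0 by auto
  obtain p where p: "p \<in> \<xi>" "infdist q \<xi> = dist q p"
    using infdist_attains_inf[OF closed_subspace[OF \<xi>], of q] zero by blast
  have near: "infdist p \<eta> \<le> norm p * \<delta>"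
  proof (cases "p = 0")
    case True
    then show ?thesis using zero by simp
  next
    case False
    define u where "u = p /\<^sub>R norm p"
    have u: "u \<in> \<xi> \<inter> cball 0 1" using p(1) False by (simp add: u_def subspace_scale[OF \<xi>])
    have ne: "\<xi> \<inter> cball 0 1 \<noteq> {}" "\<eta> \<inter> cball 0 1 \<noteq> {}" using zero by auto
    have bd: "bounded (\<xi> \<inter> cball 0 1)" "bounded (\<eta> \<inter> cball 0 1)" by (auto intro: bounded_Int)
    have "infdist u (\<eta> \<inter> cball 0 1) \<le> \<delta>"
      using hausdorff_dist_le_iff[OF ne bd, of \<delta>] u by (simp add: \<delta>_def subspace_dist_def)
    then have "infdist u \<eta> \<le> \<delta>" using infdist_mono[OF _ ne(2), of \<eta> u] by simp
    moreover obtain v where v: "v \<in> \<eta>" "infdist u \<eta> = dist u v"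
      using infdist_attains_inf[OF closed_subspace[OF \<eta>], of u] zero by blast
    ultimately have uv: "dist u v \<le> \<delta>" by simp
    have "infdist p \<eta> \<le> dist p (norm p *\<^sub>R v)"
      using v(1) by (intro infdist_le subspace_scale[OF \<eta>])
    also have "\<dots> = norm (norm p *\<^sub>R (u - v))" using False by (simp add: dist_norm u_def scaleR_diff_right)
    also have "\<dots> = norm p * dist u v" by (simp add: dist_norm)
    also have "\<dots> \<le> norm p * \<delta>" using uv by (intro mult_left_mono) auto
    finally show ?thesis .
  qed
  have "norm p \<le> norm q"
  proof -
    have "p = closest_point \<xi> q"
    proof (rule closest_point_unique[OF subspace_imp_convex[OF \<xi>] closed_subspace[OF \<xi>] p(1)])
      show "\<forall>z\<in>\<xi>. dist q p \<le> dist q z" using infdist_le[of _ \<xi> q] p(2) by auto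
    qed
    moreover have "closest_point \<xi> 0 = 0" using zero by (simp add: closest_point_self)
    ultimately show ?thesis
      using closest_point_lipschitz[OF subspace_imp_convex[OF \<xi>] closed_subspace[OF \<xi>], of q 0] zero by auto
  qed
  then have "infdist p \<eta> \<le> norm q * \<delta>" using near \<delta> by (meson mult_right_mono order_trans)
  then show ?thesis using infdist_triangle[of q \<eta> p] p(2) by (simp add: \<delta>_def)
qed

text \<open>By the Lipschitz condition, \<open>f m x\<close> is the infimum of \<open>f m q + dist x q\<close> over a countable dense set of \<open>q\<close>.\<close>

lemma lipschitz_jointly_measurable:
  fixes f :: "'m \<Rightarrow> 'a::euclidean_space \<Rightarrow> real"
  assumes meas: "\<And>q. (\<lambda>m. f m q) \<in> borel_measurable M"
    and lip: "\<And>m x y. m \<in> space M \<Longrightarrow> f m x \<le> f m y + dist x y"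
  shows "(\<lambda>p. f (fst p) (snd p)) \<in> borel_measurable (M \<Otimes>\<^sub>M borel)"
proof -
  obtain D :: "'a set" where D: "countable D" "\<And>X. open X \<Longrightarrow> X \<noteq> {} \<Longrightarrow> \<exists>d\<in>D. d \<in> X"
    by (rule countable_dense_setE) blast
  have eq: "f m x = (INF q\<in>D. f m q + dist x q)" if m: "m \<in> space M" for m x
  proof (rule antisym)
    have "D \<noteq> {}" using D(2)[of UNIV] by auto
    then show "f m x \<le> (INF q\<in>D. f m q + dist x q)" by (intro cINF_greatest lip m)
    have bdd: "bdd_below ((\<lambda>q. f m q + dist x q) ` D)" using lip[OF m] by (intro bdd_belowI2[where m = "f m x"])
    show "(INF q\<in>D. f m q + dist x q) \<le> f m x"
    proof (rule field_le_epsilon)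
      fix e :: real assume "e > 0"
      then have "ball x (e / 2) \<noteq> {}" by simp
      then obtain q where q: "q \<in> D" "q \<in> ball x (e / 2)" using D(2)[OF open_ball] by blast
      have "(INF q\<in>D. f m q + dist x q) \<le> f m q + dist x q" by (rule cINF_lower[OF bdd q(1)])
      also have "\<dots> \<le> f m x + e" using lip[OF m, of q x] q(2) by (simp add: dist_commute)
      finally show "(INF q\<in>D. f m q + dist x q) \<le> f m x + e" .
    qed
  qed
  have "(\<lambda>p. INF q\<in>D. f (fst p) q + dist (snd p) q) \<in> borel_measurable (M \<Otimes>\<^sub>M borel)"
  proof (rule borel_measurable_cINF_real[OF D(1)])
    fix q
    show "(\<lambda>p. f (fst p) q + dist (snd p) q) \<in> borel_measurable (M \<Otimes>\<^sub>M borel)"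
      by (intro borel_measurable_add measurable_compose[OF measurable_fst meas] borel_measurable_dist) auto
  qed
  then show ?thesis
    by (rule measurable_cong[THEN iffD1, rotated]) (auto simp: space_pair_measure eq)
qed

lemma convex_ringD:
  assumes "K \<in> convex_ring"
  shows "compact K" "K \<noteq> {}" "bounded K"
  using assms by (auto simp: convex_ring_def compact_imp_bounded)

lemma cylinder_decomp:
  assumes "Z \<in> cylinders k"
  shows "direction Z \<in> grassmannian k" "is_cylinder_decomp Z (base Z) (direction Z)"
proof -
  obtain \<xi> K where d: "\<xi> \<in> grassmannian k" "is_cylinder_decomp Z K \<xi>" using assms by (auto simp: cylinders_def)
  show "direction Z \<in> grassmannian k" "is_cylinder_decomp Z (base Z) (direction Z)"
    using direction_base_eq[OF d(2)] d by auto
qed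

lemma cylinderD:
  assumes "Z \<in> cylinders k"
  shows "subspace (direction Z)" "dim (direction Z) = k" "base Z \<in> convex_ring" "compact (base Z)"
    "base Z \<noteq> {}" "base Z \<subseteq> (direction Z)\<^sup>\<bottom>" "Z = base Z + direction Z"
  using cylinder_decomp[OF assms] convex_ringD[of "base Z"]
  by (auto simp: grassmannian_def is_cylinder_decomp_def)

lemma space_convex_ring_borel [simp]: "space convex_ring_borel = convex_ring"
proof -
  interpret Metric_space convex_ring hausdorff_dist by (rule Metric_space_convex_ring)
  show ?thesis unfolding convex_ring_borel_def using openin_subset[of mtopology] by (intro space_measure_of) auto
qed

lemma space_grassmannian_borel [simp]: "space (grassmannian_borel k) = grassmannian k"
proof -
  interpret Metric_space "grassmannian k" subspace_dist by (rule Metric_space_grassmannian)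
  show ?thesis unfolding grassmannian_borel_def using openin_subset[of mtopology] by (intro space_measure_of) auto
qed

lemma space_cylinder_space [simp]: "space (cylinder_space k) = cylinders k"
  by (simp add: cylinder_space_def)

lemma measurable_base_direction:
  "(\<lambda>Z. (base Z, direction Z)) \<in> cylinder_space k \<rightarrow>\<^sub>M convex_ring_borel \<Otimes>\<^sub>M grassmannian_borel k"
  unfolding cylinder_space_def
  by (rule measurable_vimage_algebra1) (auto simp: space_pair_measure cylinderD cylinder_decomp)

lemma measurable_base: "base \<in> cylinder_space k \<rightarrow>\<^sub>M convex_ring_borel"
  using measurable_compose[OF measurable_base_direction measurable_fst] by simp

lemma measurable_direction: "direction \<in> cylinder_space k \<rightarrow>\<^sub>M grassmannian_borel k"
  using measurable_compose[OF measurable_base_direction measurable_snd] by simp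

lemma measurable_infdist_convex_ring: "(\<lambda>K. infdist q K) \<in> borel_measurable convex_ring_borel"
  unfolding convex_ring_borel_def
  by (rule lipschitz_measurable_metric_borel[OF Metric_space_convex_ring, where c = 1])
    (auto intro!: infdist_hausdorff_lipschitz dest: convex_ringD)

lemma measurable_infdist_grassmannian: "(\<lambda>\<xi>. infdist q \<xi>) \<in> borel_measurable (grassmannian_borel k)"
  unfolding grassmannian_borel_def
proof (rule lipschitz_measurable_metric_borel[OF Metric_space_grassmannian, where c = "norm q"])
  fix \<xi> \<eta> :: "'a set" assume "\<xi> \<in> grassmannian k" "\<eta> \<in> grassmannian k"
  then show "infdist q \<xi> \<le> infdist q \<eta> + norm q * subspace_dist \<xi> \<eta>"
    using infdist_subspace_lipschitz[of \<eta> \<xi> q]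
    by (simp add: grassmannian_def subspace_dist_def hausdorff_dist_commute)
qed simp

lemma measurable_infdist_base:
  "(\<lambda>p. infdist (snd p) (base (fst p))) \<in> borel_measurable (cylinder_space k \<Otimes>\<^sub>M borel)"
  by (rule lipschitz_jointly_measurable[OF measurable_compose[OF measurable_base measurable_infdist_convex_ring]])
    (rule infdist_triangle)

lemma measurable_infdist_direction:
  "(\<lambda>p. infdist (snd p) (direction (fst p))) \<in> borel_measurable (cylinder_space k \<Otimes>\<^sub>M borel)"
  by (rule lipschitz_jointly_measurable[OF measurable_compose[OF measurable_direction measurable_infdist_grassmannian]])
    (rule infdist_triangle)

text \<open>The basis of \<open>\<xi>\<^sup>\<bottom>\<close> in the definition of its Lebesgue measure is an arbitrary choice that need not depend
  measurably on \<open>\<xi>\<close>. By Pythagoras the conditions on the two components of \<open>x\<close> can be expressed by the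
  distances from \<open>K\<close> and \<open>\<xi>\<close>, which do.\<close>

lemma thickened_parallel_body_eq:
  fixes \<xi> K :: "'a::euclidean_space set"
  assumes \<xi>: "subspace \<xi>" and K: "compact K" "K \<noteq> {}" "K \<subseteq> \<xi>\<^sup>\<bottom>" and r: "r \<ge> 0"
  shows "thickened_parallel_body (\<xi>\<^sup>\<bottom>) K r = {x. (infdist x K)\<^sup>2 + (infdist x \<xi>)\<^sup>2 \<le> r\<^sup>2 + (norm x)\<^sup>2 \<and>
    (norm x)\<^sup>2 \<le> 1 + (infdist x \<xi>)\<^sup>2}"
proof -
  have W: "subspace (\<xi>\<^sup>\<bottom>)" by (rule subspace_orthogonal_comp)
  have WW: "\<xi>\<^sup>\<bottom>\<^sup>\<bottom> = \<xi>" by (rule orthogonal_comp_self[OF \<xi>])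
  have pyth: "(norm (a + y))\<^sup>2 = (norm a)\<^sup>2 + (norm y)\<^sup>2" if "a \<in> \<xi>\<^sup>\<bottom>" "y \<in> \<xi>" for a y
  proof -
    have "a \<bullet> y = 0" using that by (auto simp: orthogonal_comp_def orthogonal_def inner_commute)
    then show ?thesis unfolding power2_norm_eq_inner by (simp add: inner_commute algebra_simps)
  qed
  have in_iff: "a + y \<in> thickened_parallel_body (\<xi>\<^sup>\<bottom>) K r \<longleftrightarrow>
      (infdist (a + y) K)\<^sup>2 + (infdist (a + y) \<xi>)\<^sup>2 \<le> r\<^sup>2 + (norm (a + y))\<^sup>2 \<and>
      (norm (a + y))\<^sup>2 \<le> 1 + (infdist (a + y) \<xi>)\<^sup>2" if a: "a \<in> \<xi>\<^sup>\<bottom>" and y: "y \<in> \<xi>" for a y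
  proof -
    have "a + y \<in> thickened_parallel_body (\<xi>\<^sup>\<bottom>) K r \<longleftrightarrow> a \<in> parallel_body (\<xi>\<^sup>\<bottom>) K r \<and> y \<in> \<xi>\<^sup>\<bottom>\<^sup>\<bottom> \<inter> cball 0 1"
      unfolding thickened_parallel_body_def
      by (rule orthogonal_sum_in_iff[OF W]) (use a y WW in \<open>auto simp: parallel_body_def\<close>)
    also have "\<dots> \<longleftrightarrow> infdist a K \<le> r \<and> norm y \<le> 1"
      using a y WW by (simp add: parallel_body_infdist[OF K(1,2)])
    also have "\<dots> \<longleftrightarrow> (infdist a K)\<^sup>2 \<le> r\<^sup>2 \<and> (norm y)\<^sup>2 \<le> 1"
      using r infdist_nonneg[of a K] by (simp add: abs_le_square_iff[symmetric] abs_square_le_1)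
    finally have 1: "a + y \<in> thickened_parallel_body (\<xi>\<^sup>\<bottom>) K r \<longleftrightarrow> (infdist a K)\<^sup>2 \<le> r\<^sup>2 \<and> (norm y)\<^sup>2 \<le> 1" .
    have distK: "(dist (a + y) z)\<^sup>2 = (dist a z)\<^sup>2 + (norm y)\<^sup>2" if "z \<in> K" for z
      using pyth[of "a - z" y] that K(3) a y subspace_diff[OF W, of a z] by (auto simp: dist_norm algebra_simps)
    have 2: "(infdist (a + y) K)\<^sup>2 = (infdist a K)\<^sup>2 + (norm y)\<^sup>2"
    proof (rule antisym)
      obtain p where p: "p \<in> K" "infdist a K = dist a p"
        using infdist_attains_inf[OF compact_imp_closed[OF K(1)] K(2), of a] by blast
      have "(infdist (a + y) K)\<^sup>2 \<le> (dist (a + y) p)\<^sup>2"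
        using infdist_le[OF p(1), of "a + y"] infdist_nonneg by (intro power_mono)
      then show "(infdist (a + y) K)\<^sup>2 \<le> (infdist a K)\<^sup>2 + (norm y)\<^sup>2" using distK[OF p(1)] p(2) by simp
      obtain q where q: "q \<in> K" "infdist (a + y) K = dist (a + y) q"
        using infdist_attains_inf[OF compact_imp_closed[OF K(1)] K(2), of "a + y"] by blast
      have "(infdist a K)\<^sup>2 \<le> (dist a q)\<^sup>2"
        using infdist_le[OF q(1), of a] infdist_nonneg by (intro power_mono)
      then show "(infdist a K)\<^sup>2 + (norm y)\<^sup>2 \<le> (infdist (a + y) K)\<^sup>2" using distK[OF q(1)] q(2) by simp
    qed
    have 3: "(infdist (a + y) \<xi>)\<^sup>2 = (norm a)\<^sup>2"
    proof (rule antisym)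
      have "infdist (a + y) \<xi> \<le> dist (a + y) y" by (rule infdist_le[OF y])
      then show "(infdist (a + y) \<xi>)\<^sup>2 \<le> (norm a)\<^sup>2"
        using infdist_nonneg by (intro power_mono) (auto simp: dist_norm)
      obtain z where z: "z \<in> \<xi>" "infdist (a + y) \<xi> = dist (a + y) z"
        using infdist_attains_inf[OF closed_subspace[OF \<xi>], of "a + y"] y by blast
      have "(dist (a + y) z)\<^sup>2 = (norm a)\<^sup>2 + (norm (y - z))\<^sup>2"
        using pyth[OF a subspace_diff[OF \<xi> y z(1)]] by (simp add: dist_norm algebra_simps)
      then show "(norm a)\<^sup>2 \<le> (infdist (a + y) \<xi>)\<^sup>2" using z(2) by simp
    qed
    show ?thesis unfolding 1 2 3 pyth[OF a y] by auto
  qed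
  show ?thesis
  proof (rule set_eqI)
    fix x
    have "x \<in> \<xi> + \<xi>\<^sup>\<bottom>" using subspace_sum_orthogonal_comp[OF \<xi>] by simp
    then obtain y a where "x = y + a" "a \<in> \<xi>\<^sup>\<bottom>" "y \<in> \<xi>" by (auto elim!: set_plus_elim)
    then have "x = a + y" "a \<in> \<xi>\<^sup>\<bottom>" "y \<in> \<xi>" by (simp_all add: add.commute)
    then show "x \<in> thickened_parallel_body (\<xi>\<^sup>\<bottom>) K r \<longleftrightarrow> x \<in> {x. (infdist x K)\<^sup>2 + (infdist x \<xi>)\<^sup>2 \<le> r\<^sup>2 + (norm x)\<^sup>2 \<and>
        (norm x)\<^sup>2 \<le> 1 + (infdist x \<xi>)\<^sup>2}"
      using in_iff by blast
  qed
qed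

definition base_parallel_volume :: "real \<Rightarrow> 'a::euclidean_space set \<Rightarrow> ennreal" where
  "base_parallel_volume r Z = emeasure (lborel_subspace ((direction Z)\<^sup>\<bottom>)) (parallel_body ((direction Z)\<^sup>\<bottom>) (base Z) r)"

text \<open>Up to the volume of the \<open>k\<close>-dimensional unit ball, this is the volume of the sections of a measurable set
  in the product of the space of cylinders with the whole space.\<close>

lemma measurable_base_parallel_volume:
  assumes r: "r \<ge> 0"
  shows "base_parallel_volume r \<in> borel_measurable (cylinder_space k :: 'a::euclidean_space set measure)"
proof -
  let ?M = "cylinder_space k :: 'a set measure"
  note [measurable] = measurable_infdist_base measurable_infdist_direction
  define Q where "Q = {p \<in> space (?M \<Otimes>\<^sub>M borel).
    (infdist (snd p) (base (fst p)))\<^sup>2 + (infdist (snd p) (direction (fst p)))\<^sup>2 \<le> r\<^sup>2 + (norm (snd p))\<^sup>2 \<and>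
    (norm (snd p))\<^sup>2 \<le> 1 + (infdist (snd p) (direction (fst p)))\<^sup>2}"
  have "Q \<in> sets (?M \<Otimes>\<^sub>M borel)" unfolding Q_def by measurable
  also have "sets (?M \<Otimes>\<^sub>M borel) = sets (?M \<Otimes>\<^sub>M lborel)" by (intro sets_pair_measure_cong) auto
  finally have m: "(\<lambda>Z. emeasure lborel (Pair Z -` Q)) \<in> borel_measurable ?M"
    by (rule lborel.measurable_emeasure_Pair)
  define \<kappa> where "\<kappa> = unit_ball_vol (real k)"
  have \<kappa>: "\<kappa> > 0" unfolding \<kappa>_def by (rule unit_ball_vol_pos) simp
  have "base_parallel_volume r Z = emeasure lborel (Pair Z -` Q) * ennreal (1 / \<kappa>)" if Z: "Z \<in> space ?M" for Z
  proof -
    have Zc: "Z \<in> cylinders k" using Z by simp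
    note c = cylinderD[OF Zc]
    have "Pair Z -` Q = thickened_parallel_body ((direction Z)\<^sup>\<bottom>) (base Z) r"
      unfolding thickened_parallel_body_eq[OF c(1,4,5,6) r] using Zc by (auto simp: Q_def space_pair_measure)
    moreover have "emeasure lborel (thickened_parallel_body ((direction Z)\<^sup>\<bottom>) (base Z) r) = base_parallel_volume r Z * ennreal \<kappa>"
      unfolding base_parallel_volume_def
      by (simp add: emeasure_thickened_parallel_body[OF subspace_orthogonal_comp c(4)] orthogonal_comp_self[OF c(1)] c(2) \<kappa>_def)
    ultimately show ?thesis
      using \<kappa> by (simp add: mult.assoc ennreal_mult'[symmetric])
  qed
  then show ?thesis
    using m by (subst measurable_cong[where g = "\<lambda>Z. emeasure lborel (Pair Z -` Q) * ennreal (1 / \<kappa>)"]) auto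
qed

lemma base_parallel_volume_finite:
  "Z \<in> cylinders k \<Longrightarrow> base_parallel_volume r Z < \<infinity>"
  unfolding base_parallel_volume_def
  by (intro emeasure_parallel_body_finite subspace_orthogonal_comp cylinderD(4))

lemma enn2real_base_parallel_volume:
  "enn2real (base_parallel_volume r Z) =
    measure (lborel_subspace ((direction Z)\<^sup>\<bottom>)) (parallel_body ((direction Z)\<^sup>\<bottom>) (base Z) r)"
  by (simp add: base_parallel_volume_def measure_def)

lemma right_limit_eq_from_rationals:
  fixes f g :: "real \<Rightarrow> real"
  assumes mono: "\<And>s t. s \<le> t \<Longrightarrow> f s \<le> f t"
    and lim: "(\<lambda>m. f (\<rho> + inverse (real (Suc m)))) \<longlonglongrightarrow> f \<rho>"
    and g: "isCont g \<rho>" and eq: "\<And>q. q \<in> \<rat> \<Longrightarrow> \<rho> < q \<Longrightarrow> f q = g q"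
  shows "f \<rho> = g \<rho>"
proof -
  have "\<forall>m. \<exists>q. q \<in> \<rat> \<and> \<rho> < q \<and> q < \<rho> + inverse (real (Suc m))"
  proof
    fix m
    have "\<rho> < \<rho> + inverse (real (Suc m))" by simp
    from Rats_dense_in_real[OF this] show "\<exists>q. q \<in> \<rat> \<and> \<rho> < q \<and> q < \<rho> + inverse (real (Suc m))" by blast
  qed
  then obtain q where q: "\<And>m. q m \<in> \<rat>" "\<And>m. \<rho> < q m" "\<And>m. q m < \<rho> + inverse (real (Suc m))"
    unfolding choice_iff by blast
  have "(\<lambda>m. \<rho> + inverse (real (Suc m))) \<longlonglongrightarrow> \<rho> + 0"
    by (intro tendsto_intros LIMSEQ_inverse_real_of_nat)
  then have up: "(\<lambda>m. \<rho> + inverse (real (Suc m))) \<longlonglongrightarrow> \<rho>" by simp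
  have "q \<longlonglongrightarrow> \<rho>"
    by (rule tendsto_sandwich[OF always_eventually always_eventually tendsto_const up]; intro allI less_imp_le q)
  then have "(\<lambda>m. g (q m)) \<longlonglongrightarrow> g \<rho>" by (rule isCont_tendsto_compose[OF g])
  then have 1: "(\<lambda>m. f (q m)) \<longlonglongrightarrow> g \<rho>" using eq[OF q(1,2)] by simp
  have "(\<lambda>m. f (q m)) \<longlonglongrightarrow> f \<rho>"
    by (rule tendsto_sandwich[OF always_eventually always_eventually tendsto_const lim];
        intro allI mono less_imp_le q)
  from LIMSEQ_unique[OF this 1] show ?thesis .
qed

text \<open>If the parallel volume is a polynomial, its coefficients are linear combinations of its values at fixed
  nodes, and otherwise the value is constant. By right-continuity, being a polynomial is a condition on
  countably many distances.\<close>

lemma measurable_intrinsic_volume: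
  assumes k: "k < DIM('a::euclidean_space)" and j: "j \<le> DIM('a) - k"
  shows "(\<lambda>Z :: 'a set. intrinsic_volume ((direction Z)\<^sup>\<bottom>) j (base Z)) \<in> borel_measurable (cylinder_space k)"
proof -
  let ?M = "cylinder_space k :: 'a set measure"
  define n where "n = DIM('a) - k"
  define v where "v r Z = enn2real (base_parallel_volume r Z)" for r and Z :: "'a set"
  have v_meas: "v r \<in> borel_measurable ?M" if "r \<ge> 0" for r
    unfolding v_def by (intro borel_measurable_enn2real measurable_base_parallel_volume that)
  obtain X :: "real set" and L where X: "finite X" "X \<subseteq> {0..}" and degL: "\<And>t. degree (L t) \<le> n" and L:
    "\<And>p s. degree p \<le> n \<Longrightarrow> poly p s = (\<Sum>t\<in>X. poly p t * poly (L t) s)"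
    by (rule poly_interpolation_on[OF infinite_Ici[of "0::real"], where n = n]) (rule that)
  define S where "S = {Z \<in> space ?M. \<forall>\<rho>\<in>\<rat> \<inter> {0..}. v \<rho> Z = (\<Sum>t\<in>X. v t Z * poly (L t) \<rho>)}"
  have S: "S \<in> sets ?M"
    unfolding S_def
  proof (rule sets.sets_Collect_countable_All')
    show "countable (\<rat> \<inter> {0::real..})" by (intro countable_Int1 countable_rat)
    fix \<rho> :: real assume "\<rho> \<in> \<rat> \<inter> {0..}"
    then have [measurable]: "v \<rho> \<in> borel_measurable ?M" using v_meas by simp
    have [measurable]: "(\<lambda>Z. \<Sum>t\<in>X. v t Z * poly (L t) \<rho>) \<in> borel_measurable ?M"
      using X(2) v_meas by (intro borel_measurable_sum borel_measurable_times) auto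
    show "{Z \<in> space ?M. v \<rho> Z = (\<Sum>t\<in>X. v t Z * poly (L t) \<rho>)} \<in> sets ?M" by measurable
  qed
  define V where "V Z = (\<Sum>t\<in>X. v t Z * coeff (L t) (n - j)) / unit_ball_vol (real (n - j))" for Z
  have "(\<lambda>Z. if Z \<in> S then V Z else (THE V :: nat \<Rightarrow> real. False) j) \<in> borel_measurable ?M"
  proof (rule measurable_If_set)
    show "V \<in> borel_measurable ?M"
      unfolding V_def using X(2) v_meas by (intro borel_measurable_divide borel_measurable_sum borel_measurable_times) auto
    show "S \<inter> space ?M \<in> sets ?M" using S by (intro sets.Int sets.top)
  qed simp
  moreover have "intrinsic_volume ((direction Z)\<^sup>\<bottom>) j (base Z) = (if Z \<in> S then V Z else (THE V. False) j)"
    if Z: "Z \<in> space ?M" for Z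
  proof -
    have Zc: "Z \<in> cylinders k" using Z by simp
    note c = cylinderD[OF Zc]
    define W where "W = (direction Z)\<^sup>\<bottom>"
    have W: "subspace W" unfolding W_def by (rule subspace_orthogonal_comp)
    have dimW: "dim W = n" using subspace_dim_orthogonal_comp[OF c(1)] c(2) by (simp add: W_def n_def)
    have v: "v r Z = measure (lborel_subspace W) (parallel_body W (base Z) r)" for r
      by (simp add: v_def enn2real_base_parallel_volume W_def)
    have v_mono: "v s Z \<le> v t Z" if "s \<le> t" for s t
      unfolding v_def base_parallel_volume_def
      using that emeasure_parallel_body_finite[OF subspace_orthogonal_comp c(4), of "direction Z" t]
        parallel_body_sets[OF subspace_orthogonal_comp c(4)]
      by (intro enn2real_mono emeasure_mono parallel_body_mono) auto
    show ?thesis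
    proof (cases "Z \<in> S")
      case True
      define q where "q = (\<Sum>t\<in>X. smult (v t Z) (L t))"
      have q_eval: "poly q \<rho> = (\<Sum>t\<in>X. v t Z * poly (L t) \<rho>)" for \<rho> by (simp add: q_def poly_sum)
      have q: "degree q \<le> dim W"
        unfolding q_def dimW using X(1) by (intro degree_sum_le order_trans[OF degree_smult_le] degL)
      have "v \<rho> Z = poly q \<rho>" if "\<rho> \<ge> 0" for \<rho>
      proof (rule right_limit_eq_from_rationals[where f = "\<lambda>s. v s Z" and g = "poly q", OF v_mono])
        show "(\<lambda>m. v (\<rho> + inverse (real (Suc m))) Z) \<longlonglongrightarrow> v \<rho> Z"
          unfolding v by (rule parallel_volume_tendsto[OF W c(4,5)])
        show "v t Z = poly q t" if "t \<in> \<rat>" "\<rho> < t" for t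
          using True that \<open>\<rho> \<ge> 0\<close> unfolding S_def q_eval by auto
      qed (assumption, rule poly_isCont)
      then have "intrinsic_volume W j (base Z) = coeff q (dim W - j) / unit_ball_vol (real (dim W - j))"
        using j dimW unfolding v n_def[symmetric] by (intro intrinsic_volume_eq_coeff q) auto
      also have "\<dots> = V Z" unfolding V_def dimW by (simp add: q_def coeff_sum)
      finally show ?thesis using True by (simp add: W_def)
    next
      case False
      have "\<nexists>q. degree q \<le> dim W \<and> (\<forall>\<rho>\<ge>0. measure (lborel_subspace W) (parallel_body W (base Z) \<rho>) = poly q \<rho>)"
      proof
        assume "\<exists>q. degree q \<le> dim W \<and> (\<forall>\<rho>\<ge>0. measure (lborel_subspace W) (parallel_body W (base Z) \<rho>) = poly q \<rho>)"
        then obtain q where q: "degree q \<le> n" "\<forall>\<rho>\<ge>0. v \<rho> Z = poly q \<rho>" unfolding v dimW by (elim exE conjE)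
        have "v \<rho> Z = (\<Sum>t\<in>X. v t Z * poly (L t) \<rho>)" if "\<rho> \<ge> 0" for \<rho>
        proof -
          have "v \<rho> Z = poly q \<rho>" using q(2) that by blast
          also have "\<dots> = (\<Sum>t\<in>X. poly q t * poly (L t) \<rho>)" by (rule L[OF q(1)])
          also have "\<dots> = (\<Sum>t\<in>X. v t Z * poly (L t) \<rho>)" using q(2) X(2) by (intro sum.cong) auto
          finally show ?thesis .
        qed
        then show False using False Z unfolding S_def by blast
      qed
      from intrinsic_volume_undefined[OF this, of j] show ?thesis using False by (simp add: W_def)
    qed
  qed
  ultimately show ?thesis by (subst measurable_cong) auto
qed

section \<open>Cylinders hitting a ball\<close>

definition hitting_cylinders :: "nat \<Rightarrow> real \<Rightarrow> 'a::euclidean_space set set" where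
  "hitting_cylinders k r = {Z \<in> cylinders k. Z \<inter> cball 0 r \<noteq> {}}"

text \<open>Orthogonal projection onto \<open>\<xi>\<^sup>\<bottom>\<close> does not increase the norm.\<close>

lemma cylinder_hits_ball_iff:
  fixes \<xi> K :: "'a::euclidean_space set"
  assumes \<xi>: "subspace \<xi>" and K: "K \<subseteq> \<xi>\<^sup>\<bottom>"
  shows "(K + \<xi>) \<inter> cball 0 r \<noteq> {} \<longleftrightarrow> (\<exists>a\<in>K. norm a \<le> r)"
proof
  assume "(K + \<xi>) \<inter> cball 0 r \<noteq> {}"
  then obtain x where x: "x \<in> K + \<xi>" "norm x \<le> r" by auto
  then obtain a y where ay: "a \<in> K" "y \<in> \<xi>" "x = a + y" by (auto elim: set_plus_elim)
  have "a \<bullet> y = 0" using ay K by (auto simp: orthogonal_comp_def orthogonal_def inner_commute)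
  then have "(norm x)\<^sup>2 = (norm a)\<^sup>2 + (norm y)\<^sup>2"
    unfolding ay(3) power2_norm_eq_inner by (simp add: inner_commute algebra_simps)
  then have "(norm a)\<^sup>2 \<le> (norm x)\<^sup>2" by simp
  then have "norm a \<le> norm x" by simp
  then show "\<exists>a\<in>K. norm a \<le> r" using ay(1) x(2) by (intro bexI[of _ a]) auto
next
  assume "\<exists>a\<in>K. norm a \<le> r"
  then obtain a where "a \<in> K" "norm a \<le> r" by blast
  moreover have "a + 0 \<in> K + \<xi>" using \<open>a \<in> K\<close> subspace_0[OF \<xi>] by (rule set_plus_intro)
  ultimately show "(K + \<xi>) \<inter> cball 0 r \<noteq> {}" by auto
qed

lemma hitting_cylinders_sets:
  "(hitting_cylinders k r :: 'a::euclidean_space set set) \<in> sets (cylinder_space k)"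
proof -
  have "Z \<inter> cball 0 r \<noteq> {} \<longleftrightarrow> infdist 0 (base Z) \<le> r" if "Z \<in> cylinders k" for Z :: "'a set"
  proof -
    note c = cylinderD[OF that]
    have "Z \<inter> cball 0 r \<noteq> {} \<longleftrightarrow> (\<exists>a\<in>base Z. norm a \<le> r)"
      using cylinder_hits_ball_iff[OF c(1,6), of r] c(7) by simp
    also have "\<dots> \<longleftrightarrow> 0 \<in> parallel_body UNIV (base Z) r" by (simp add: parallel_body_def)
    also have "\<dots> \<longleftrightarrow> infdist 0 (base Z) \<le> r" by (simp add: parallel_body_infdist[OF c(4,5)])
    finally show ?thesis .
  qed
  then have "(hitting_cylinders k r :: 'a set set) = {Z \<in> space (cylinder_space k). infdist 0 (base Z) \<le> r}"
    unfolding hitting_cylinders_def space_cylinder_space by blast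
  also have "\<dots> \<in> sets (cylinder_space k)"
    by (rule borel_measurable_le[OF measurable_compose[OF measurable_base measurable_infdist_convex_ring]]) simp
  finally show ?thesis .
qed

lemma convex_ring_translation:
  assumes "K \<in> convex_ring"
  shows "(+) x ` K \<in> convex_ring"
proof -
  obtain \<F> where F: "K = \<Union>\<F>" "finite \<F>" "\<F> \<noteq> {}" "\<forall>C\<in>\<F>. C \<noteq> {} \<and> compact C \<and> convex C"
    using assms by (auto simp: convex_ring_def)
  have "(+) x ` K = \<Union>((`) ((+) x) ` \<F>)" unfolding F(1) by auto
  moreover have "\<forall>C\<in>(`) ((+) x) ` \<F>. C \<noteq> {} \<and> compact C \<and> convex C"
    using F(4) by (auto simp: compact_translation convex_translation)
  ultimately show ?thesis using F(2,3) unfolding convex_ring_def by blast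
qed

lemma hitting_cylinders_translate_iff:
  assumes Z: "Z \<in> cylinders k" and x: "x \<in> (direction Z)\<^sup>\<bottom>"
  shows "(+) x ` Z \<in> hitting_cylinders k r \<longleftrightarrow> x \<in> parallel_body ((direction Z)\<^sup>\<bottom>) (uminus ` base Z) r"
proof -
  note c = cylinderD[OF Z]
  have eq: "(+) x ` Z = (+) x ` base Z + direction Z"
  proof -
    have "(+) x ` Z = (+) x ` (base Z + direction Z)" using c(7) by simp
    also have "\<dots> = (+) x ` base Z + direction Z"
    proof (intro equalityI subsetI)
      fix z assume "z \<in> (+) x ` (base Z + direction Z)"
      then obtain a y where "a \<in> base Z" "y \<in> direction Z" "z = (x + a) + y"
        by (auto elim!: set_plus_elim simp: add.assoc)
      then show "z \<in> (+) x ` base Z + direction Z" by (auto intro!: set_plus_intro)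
    next
      fix z assume "z \<in> (+) x ` base Z + direction Z"
      then obtain a y where "a \<in> base Z" "y \<in> direction Z" "z = x + (a + y)"
        by (auto elim!: set_plus_elim simp: add.assoc)
      then show "z \<in> (+) x ` (base Z + direction Z)" by (intro image_eqI[of _ _ "a + y"] set_plus_intro)
    qed
    finally show ?thesis .
  qed
  have sub: "(+) x ` base Z \<subseteq> (direction Z)\<^sup>\<bottom>"
    using c(6) x subspace_add[OF subspace_orthogonal_comp] by blast
  have "is_cylinder_decomp ((+) x ` Z) ((+) x ` base Z) (direction Z)"
    unfolding is_cylinder_decomp_def using eq sub c(1,3) convex_ring_translation by blast
  then have "(+) x ` Z \<in> cylinders k" using cylinder_decomp(1)[OF Z] unfolding cylinders_def by blast
  then have "(+) x ` Z \<in> hitting_cylinders k r \<longleftrightarrow> (\<exists>a\<in>(+) x ` base Z. norm a \<le> r)"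
    unfolding hitting_cylinders_def using cylinder_hits_ball_iff[OF c(1) sub, of r] eq by simp
  also have "\<dots> \<longleftrightarrow> x \<in> parallel_body ((direction Z)\<^sup>\<bottom>) (uminus ` base Z) r"
    using x by (simp add: parallel_body_def dist_norm)
  finally show ?thesis .
qed

lemma distr_lborel_uminus: "distr lborel borel (uminus :: 'a::euclidean_space \<Rightarrow> 'a) = lborel"
proof -
  have "(lborel :: 'a measure) = density (distr lborel borel (\<lambda>x. 0 + (- 1) *\<^sub>R x)) (\<lambda>_. ennreal (\<bar>- 1\<bar> ^ DIM('a)))"
    by (rule lborel_affine) simp
  also have "\<dots> = distr lborel borel uminus" by (simp add: density_1)
  finally show ?thesis ..
qed

lemma in_uminus_image_iff: "x \<in> uminus ` A \<longleftrightarrow> - x \<in> A" for x :: "'a::group_add"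
proof
  assume "- x \<in> A"
  then show "x \<in> uminus ` A" by (intro image_eqI[of _ _ "- x"]) simp_all
qed auto

lemma subspace_neg_iff: "subspace W \<Longrightarrow> - x \<in> W \<longleftrightarrow> x \<in> W"
  using subspace_neg[of W x] subspace_neg[of W "- x"] by auto

lemma uminus_parallel_body:
  fixes W :: "'a::euclidean_space set"
  assumes "subspace W"
  shows "parallel_body W (uminus ` K) r = uminus ` parallel_body W K r"
proof (rule set_eqI)
  fix x :: 'a
  have "dist x (- y) = dist (- x) y" for y using dist_minus[of "- x" y] by simp
  then show "x \<in> parallel_body W (uminus ` K) r \<longleftrightarrow> x \<in> uminus ` parallel_body W K r"
    unfolding in_uminus_image_iff parallel_body_def by (simp add: subspace_neg_iff[OF assms])
qed

text \<open>Point reflection preserves the Lebesgue measure of the thickened bodies.\<close>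

lemma parallel_volume_reflect:
  fixes W :: "'a::euclidean_space set"
  assumes W: "subspace W" and K: "compact K"
  shows "emeasure (lborel_subspace W) (parallel_body W (uminus ` K) r) = emeasure (lborel_subspace W) (parallel_body W K r)"
proof -
  define \<kappa> where "\<kappa> = unit_ball_vol (real (dim (W\<^sup>\<bottom>)))"
  have \<kappa>: "\<kappa> > 0" unfolding \<kappa>_def by (rule unit_ball_vol_pos) simp
  have K': "compact (uminus ` K)" using K by (rule compact_negations)
  have o: "- x \<in> W\<^sup>\<bottom> \<longleftrightarrow> x \<in> W\<^sup>\<bottom>" for x
    by (rule subspace_neg_iff[OF subspace_orthogonal_comp])
  have "x \<in> thickened_parallel_body W (uminus ` K) r \<longleftrightarrow> - x \<in> thickened_parallel_body W K r" for x
  proof -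
    have "x \<in> W + W\<^sup>\<bottom>" using subspace_sum_orthogonal_comp[OF W] by simp
    then obtain a y where ay: "x = a + y" "a \<in> W" "y \<in> W\<^sup>\<bottom>" by (auto elim: set_plus_elim)
    have sub: "parallel_body W C r \<subseteq> W" for C by (auto simp: parallel_body_def)
    have "x \<in> thickened_parallel_body W (uminus ` K) r \<longleftrightarrow> a \<in> parallel_body W (uminus ` K) r \<and> y \<in> W\<^sup>\<bottom> \<inter> cball 0 1"
      unfolding thickened_parallel_body_def ay(1) by (rule orthogonal_sum_in_iff[OF W sub _ ay(2,3)]) simp
    also have "\<dots> \<longleftrightarrow> - a \<in> parallel_body W K r \<and> - y \<in> W\<^sup>\<bottom> \<inter> cball 0 1"
      unfolding uminus_parallel_body[OF W] in_uminus_image_iff using o by simp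
    also have "\<dots> \<longleftrightarrow> - a + - y \<in> thickened_parallel_body W K r"
      unfolding thickened_parallel_body_def
      by (rule orthogonal_sum_in_iff[OF W sub, symmetric]) (use ay o in \<open>simp_all add: subspace_neg_iff[OF W]\<close>)
    finally show ?thesis using ay(1) by simp
  qed
  then have "uminus -` thickened_parallel_body W K r = thickened_parallel_body W (uminus ` K) r" by auto
  then have "emeasure lborel (thickened_parallel_body W (uminus ` K) r) = emeasure (distr lborel borel uminus) (thickened_parallel_body W K r)"
    using compact_thickened_parallel_body[OF W K, of r] by (subst emeasure_distr) (auto simp: compact_imp_closed)
  then have "emeasure (lborel_subspace W) (parallel_body W (uminus ` K) r) * ennreal \<kappa> =
      emeasure (lborel_subspace W) (parallel_body W K r) * ennreal \<kappa>"
    by (simp add: distr_lborel_uminus emeasure_thickened_parallel_body[OF W K] emeasure_thickened_parallel_body[OF W K'] \<kappa>_def)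
  then have "emeasure (lborel_subspace W) (parallel_body W (uminus ` K) r) * ennreal \<kappa> * ennreal (1 / \<kappa>) =
      emeasure (lborel_subspace W) (parallel_body W K r) * ennreal \<kappa> * ennreal (1 / \<kappa>)" by (rule arg_cong)
  then show ?thesis using \<kappa> by (simp add: mult.assoc ennreal_mult'[symmetric])
qed

lemma shape_distribution:
  assumes "sets \<theta> = sets (centered_cylinder_space k)"
  shows "Z \<in> space \<theta> \<Longrightarrow> Z \<in> cylinders k"
    and "f \<in> measurable (cylinder_space k) N \<Longrightarrow> f \<in> measurable \<theta> N"
  using assms sets_eq_imp_space_eq[OF assms]
  by (auto simp: centered_cylinder_space_def space_restrict_space
      intro: measurable_restrict_space1 cong: measurable_cong_sets)

text \<open>For a fixed cylinder with base \<open>K\<close>, the translations after which it hits the ball form the parallel body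
  of \<open>- K\<close>.\<close>

lemma intensity_hitting_cylinders:
  fixes \<Lambda> \<theta> :: "'a::euclidean_space set measure"
  assumes "intensity_and_shape k \<Lambda> c \<theta>" and \<Lambda>: "sets \<Lambda> = sets (cylinder_space k)"
  shows "emeasure \<Lambda> (hitting_cylinders k r) = ennreal c * (\<integral>\<^sup>+Z. base_parallel_volume r Z \<partial>\<theta>)"
proof -
  have \<theta>: "sets \<theta> = sets (centered_cylinder_space k)" using assms(1) by (simp add: intensity_and_shape_def)
  have ind: "indicator (hitting_cylinders k r) \<in> borel_measurable (cylinder_space k)"
    using hitting_cylinders_sets by (rule borel_measurable_indicator)
  have "emeasure \<Lambda> (hitting_cylinders k r) = (\<integral>\<^sup>+Z. indicator (hitting_cylinders k r) Z \<partial>\<Lambda>)"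
    using hitting_cylinders_sets[of k r] \<Lambda> by (intro nn_integral_indicator[symmetric]) auto
  also have "\<dots> = ennreal c * (\<integral>\<^sup>+Z. (\<integral>\<^sup>+x. indicator (hitting_cylinders k r) ((+) x ` Z) \<partial>lborel_subspace ((direction Z)\<^sup>\<bottom>)) \<partial>\<theta>)"
    using assms(1) ind unfolding intensity_and_shape_def by blast
  also have "(\<integral>\<^sup>+Z. (\<integral>\<^sup>+x. indicator (hitting_cylinders k r) ((+) x ` Z) \<partial>lborel_subspace ((direction Z)\<^sup>\<bottom>)) \<partial>\<theta>) =
      (\<integral>\<^sup>+Z. base_parallel_volume r Z \<partial>\<theta>)"
  proof (rule nn_integral_cong)
    fix Z assume "Z \<in> space \<theta>"
    then have Z: "Z \<in> cylinders k" by (rule shape_distribution(1)[OF \<theta>])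
    note c = cylinderD[OF Z]
    let ?W = "(direction Z)\<^sup>\<bottom>" and ?A = "parallel_body ((direction Z)\<^sup>\<bottom>) (uminus ` base Z) r"
    have "(\<integral>\<^sup>+x. indicator (hitting_cylinders k r) ((+) x ` Z) \<partial>lborel_subspace ?W) = (\<integral>\<^sup>+x. indicator ?A x \<partial>lborel_subspace ?W)"
    proof (rule nn_integral_cong_AE)
      show "AE x in lborel_subspace ?W. (indicator (hitting_cylinders k r) ((+) x ` Z) :: ennreal) = indicator ?A x"
        using AE_lborel_subspace[OF subspace_orthogonal_comp, of "direction Z"]
        by eventually_elim (simp add: indicator_def hitting_cylinders_translate_iff[OF Z])
    qed
    also have "\<dots> = emeasure (lborel_subspace ?W) ?A"
      using parallel_body_sets[OF subspace_orthogonal_comp compact_negations[OF c(4)]] by simp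
    also have "\<dots> = base_parallel_volume r Z"
      unfolding base_parallel_volume_def by (rule parallel_volume_reflect[OF subspace_orthogonal_comp c(4)])
    finally show "(\<integral>\<^sup>+x. indicator (hitting_cylinders k r) ((+) x ` Z) \<partial>lborel_subspace ?W) = base_parallel_volume r Z" .
  qed
  finally show ?thesis .
qed

section \<open>Void probabilities of the Poisson process\<close>

lemma metric_borel_singleton:
  assumes "Metric_space M d" "x \<in> M"
  shows "{x} \<in> sets (sigma M {U. openin (Metric_space.mtopology M d) U})" (is "_ \<in> sets ?S")
proof -
  interpret Metric_space M d by fact
  have sp: "space ?S = M" using openin_subset[of mtopology] by (intro space_measure_of) auto
  have "d x \<in> borel_measurable ?S"
  proof (rule lipschitz_measurable_metric_borel[where c = 1, OF assms(1)])
    show "d x y \<le> d x z + 1 * d y z" if "y \<in> M" "z \<in> M" for y z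
      using triangle[OF assms(2) that(2,1)] commute[of y z] by simp
  qed simp
  then have "{y \<in> space ?S. d x y \<le> 0} \<in> sets ?S" by (intro borel_measurable_le) auto
  also have "{y \<in> space ?S. d x y \<le> 0} = {x}"
  proof -
    have "y = x" if "y \<in> M" "d x y \<le> 0" for y
      using zero[OF assms(2) that(1)] nonneg[of x y] that(2) by simp
    moreover have "d x x = 0" using zero[OF assms(2,2)] by simp
    ultimately show ?thesis unfolding sp using assms(2) by auto
  qed
  finally show ?thesis .
qed

lemma cylinder_singleton_sets:
  assumes Z: "Z \<in> cylinders k"
  shows "{Z} \<in> sets (cylinder_space k)"
proof -
  note c = cylinderD[OF Z]
  have "{base Z} \<times> {direction Z} \<in> sets (convex_ring_borel \<Otimes>\<^sub>M grassmannian_borel k)"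
    unfolding convex_ring_borel_def grassmannian_borel_def
    by (intro pair_measureI metric_borel_singleton Metric_space_convex_ring Metric_space_grassmannian c(3)
        cylinder_decomp(1)[OF Z])
  from measurable_sets[OF measurable_base_direction this]
  have "(\<lambda>Z. (base Z, direction Z)) -` ({base Z} \<times> {direction Z}) \<inter> cylinders k \<in> sets (cylinder_space k)" by simp
  also have "(\<lambda>Z. (base Z, direction Z)) -` ({base Z} \<times> {direction Z}) \<inter> cylinders k = {Z}"
  proof -
    have "Z' = Z" if "Z' \<in> cylinders k" "base Z' = base Z" "direction Z' = direction Z" for Z'
      using cylinderD(7)[OF that(1)] c(7) that(2,3) by simp
    then show ?thesis using Z by blast
  qed
  finally show ?thesis .
qed

text \<open>The measure is a countable sum of Dirac measures, and singletons of cylinders are measurable.\<close>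

lemma point_measure_zero_iff:
  assumes \<mu>: "\<mu> \<in> point_measures k" and A: "A \<in> sets (cylinder_space k)"
  shows "emeasure \<mu> A = 0 \<longleftrightarrow> (\<forall>Z\<in>A. emeasure \<mu> {Z} = 0)"
proof -
  obtain I :: "nat set" and Z where Z: "Z \<in> I \<rightarrow> cylinders k" "\<mu> = distr (count_space I) (cylinder_space k) Z"
    using \<mu> by (auto simp: point_measures_def)
  have meas: "Z \<in> count_space I \<rightarrow>\<^sub>M cylinder_space k" using Z(1) by simp
  have em: "emeasure \<mu> B = 0 \<longleftrightarrow> (\<forall>i\<in>I. Z i \<notin> B)" if "B \<in> sets (cylinder_space k)" for B
  proof -
    have "emeasure \<mu> B = emeasure (count_space I) (Z -` B \<inter> I)"
      unfolding Z(2) using that meas by (simp add: emeasure_distr)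
    also have "\<dots> = 0 \<longleftrightarrow> Z -` B \<inter> I = {}" by (subst emeasure_count_space_eq_0) auto
    finally show ?thesis by auto
  qed
  have AC: "A \<subseteq> cylinders k" using sets.sets_into_space[OF A] by simp
  show ?thesis
  proof
    assume "emeasure \<mu> A = 0"
    then have "\<forall>i\<in>I. Z i \<notin> A" using em[OF A] by simp
    then show "\<forall>Z\<in>A. emeasure \<mu> {Z} = 0"
      using em[OF cylinder_singleton_sets] AC by (metis singletonD subsetD)
  next
    assume atoms: "\<forall>Z\<in>A. emeasure \<mu> {Z} = 0"
    have "Z i \<notin> A" if i: "i \<in> I" for i
    proof
      assume "Z i \<in> A"
      then have "emeasure \<mu> {Z i} = 0" using atoms by blast
      then show False using em[OF cylinder_singleton_sets[of "Z i" k]] Z(1) i by blast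
    qed
    then show "emeasure \<mu> A = 0" using em[OF A] by blast
  qed
qed

lemma space_point_measure_space: "space (point_measure_space k) = point_measures k"
  unfolding point_measure_space_def space_Sup_eq_UN using sets.top by auto

lemma measurable_point_evaluation:
  assumes "A \<in> sets (cylinder_space k)"
  shows "(\<lambda>\<mu>. emeasure \<mu> A) \<in> borel_measurable (point_measure_space k)"
  unfolding point_measure_space_def
  by (rule measurable_Sup1[OF imageI[OF assms]]) (auto intro: measurable_vimage_algebra1)

lemma union_set_hits_ball_iff:
  assumes "\<Xi> \<omega> \<in> point_measures k"
  shows "union_set k \<Xi> \<omega> \<inter> cball 0 r \<noteq> {} \<longleftrightarrow> emeasure (\<Xi> \<omega>) (hitting_cylinders k r) \<noteq> 0"
proof -
  have "union_set k \<Xi> \<omega> \<inter> cball 0 r \<noteq> {} \<longleftrightarrow> (\<exists>Z\<in>hitting_cylinders k r. emeasure (\<Xi> \<omega>) {Z} \<noteq> 0)"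
    unfolding union_set_def hitting_cylinders_def zero_less_iff_neq_zero by blast
  then show ?thesis using point_measure_zero_iff[OF assms hitting_cylinders_sets] by blast
qed

lemma emeasure_hitting_cylinders_finite:
  assumes "locally_finite k \<Lambda>"
  shows "emeasure \<Lambda> (hitting_cylinders k r) < \<infinity>"
  unfolding hitting_cylinders_def
  by (rule assms[unfolded locally_finite_def, THEN conjunct2, THEN spec, THEN mp, OF compact_cball])

lemma void_probability:
  assumes P: "poisson_cylinder_process k P \<Xi> \<Lambda>"
  shows "{\<omega> \<in> space P. emeasure (\<Xi> \<omega>) (hitting_cylinders k r) = 0} \<in> sets P" (is "?V \<in> _")
    and "measure P {\<omega> \<in> space P. emeasure (\<Xi> \<omega>) (hitting_cylinders k r) = 0} = exp (- measure \<Lambda> (hitting_cylinders k r))"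
proof -
  let ?F = "hitting_cylinders k r"
  have F: "?F \<in> sets (cylinder_space k)" by (rule hitting_cylinders_sets)
  have "\<Xi> \<in> P \<rightarrow>\<^sub>M point_measure_space k" using P by (simp add: poisson_cylinder_process_def)
  from measurable_compose[OF this measurable_point_evaluation[OF F]]
  have "(\<lambda>\<omega>. emeasure (\<Xi> \<omega>) ?F) \<in> borel_measurable P" .
  from measurable_sets[OF this, of "{0}"] show "?V \<in> sets P" by (simp add: vimage_def Int_def conj_commute)
  have fin: "emeasure \<Lambda> ?F < \<infinity>"
    by (rule emeasure_hitting_cylinders_finite) (use P in \<open>simp add: poisson_cylinder_process_def\<close>)
  have "\<forall>A\<in>sets (cylinder_space k).
        (emeasure \<Lambda> A < \<infinity> \<longrightarrow>
           (\<forall>n::nat. measure P {\<omega>\<in>space P. emeasure (\<Xi> \<omega>) A = of_nat n} =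
              measure \<Lambda> A ^ n / fact n * exp (- measure \<Lambda> A))) \<and>
        (emeasure \<Lambda> A = \<infinity> \<longrightarrow> (AE \<omega> in P. emeasure (\<Xi> \<omega>) A = \<infinity>))"
    using P unfolding poisson_cylinder_process_def by (elim conjE)
  from bspec[OF this F, THEN conjunct1, THEN mp, OF fin, THEN spec, of 0]
  have "measure P {\<omega> \<in> space P. emeasure (\<Xi> \<omega>) ?F = of_nat 0} = measure \<Lambda> ?F ^ 0 / fact 0 * exp (- measure \<Lambda> ?F)" .
  then show "measure P ?V = exp (- measure \<Lambda> ?F)" by simp
qed

lemma spherical_contact_eq:
  assumes P: "poisson_cylinder_process k P \<Xi> \<Lambda>" and r: "r \<ge> 0"
  shows "spherical_contact k P \<Xi> r =
    1 - exp (- (measure \<Lambda> (hitting_cylinders k r) - measure \<Lambda> (hitting_cylinders k 0)))"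
proof -
  interpret prob_space P using P by (simp add: poisson_cylinder_process_def)
  have "\<Xi> \<in> P \<rightarrow>\<^sub>M point_measure_space k" using P by (simp add: poisson_cylinder_process_def)
  then have \<Xi>: "\<Xi> \<omega> \<in> point_measures k" if "\<omega> \<in> space P" for \<omega>
    using measurable_space[of \<Xi> P "point_measure_space k" \<omega>] that by (simp add: space_point_measure_space)
  define V where "V s = {\<omega> \<in> space P. emeasure (\<Xi> \<omega>) (hitting_cylinders k s) = 0}" for s
  have V: "V s \<in> sets P" "measure P (V s) = exp (- measure \<Lambda> (hitting_cylinders k s))" for s
    unfolding V_def by (rule void_probability[OF P])+
  have hits: "union_set k \<Xi> \<omega> \<inter> cball 0 s = {} \<longleftrightarrow> \<omega> \<in> V s" if "\<omega> \<in> space P" for \<omega> s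
    using union_set_hits_ball_iff[of \<Xi> \<omega> k s, OF \<Xi>[OF that]] that by (auto simp: V_def)
  have zero: "0 \<notin> union_set k \<Xi> \<omega> \<longleftrightarrow> \<omega> \<in> V 0" if "\<omega> \<in> space P" for \<omega>
    using hits[OF that, of 0] by simp
  have V_space: "V s \<subseteq> space P" for s by (auto simp: V_def)
  have mono: "V r \<subseteq> V 0"
  proof
    fix \<omega> assume "\<omega> \<in> V r"
    then have "\<omega> \<in> space P" by (simp add: V_def)
    then have "union_set k \<Xi> \<omega> \<inter> cball 0 r = {}" using hits \<open>\<omega> \<in> V r\<close> by blast
    moreover have "cball (0::'b) 0 \<subseteq> cball 0 r" using r by simp
    ultimately show "\<omega> \<in> V 0" using hits[OF \<open>\<omega> \<in> space P\<close>, of 0] by blast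
  qed
  have "{\<omega> \<in> space P. union_set k \<Xi> \<omega> \<inter> cball 0 r \<noteq> {} \<and> 0 \<notin> union_set k \<Xi> \<omega>} = V 0 - V r"
    using hits zero V_space by blast
  moreover have "{\<omega> \<in> space P. 0 \<notin> union_set k \<Xi> \<omega>} = V 0"
    using zero V_space by blast
  ultimately have "spherical_contact k P \<Xi> r = measure P (V 0 - V r) / measure P (V 0)"
    unfolding spherical_contact_def cond_prob_def by simp
  also have "\<dots> = 1 - measure P (V r) / measure P (V 0)"
    using mono V(1) by (simp add: finite_measure_Diff diff_divide_distrib V(2))
  also have "measure P (V r) / measure P (V 0) = exp (- (measure \<Lambda> (hitting_cylinders k r) - measure \<Lambda> (hitting_cylinders k 0)))"
    unfolding V(2) exp_diff[symmetric] by simp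
  finally show ?thesis .
qed

text \<open>Local finiteness of \<open>\<Lambda>\<close> makes the parallel volumes integrable, and with them the intrinsic volumes; this
  justifies integrating Steiner's formula term by term.\<close>

lemma intensity_hitting_cylinders_steiner:
  fixes \<Lambda> \<theta> :: "'a::euclidean_space set measure"
  assumes k: "k < DIM('a)" and \<Lambda>: "locally_finite k \<Lambda>" and I: "intensity_and_shape k \<Lambda> c \<theta>"
    and conv: "AE Z in \<theta>. convex (base Z)" and r: "r \<ge> 0"
  shows "measure \<Lambda> (hitting_cylinders k r) = c * (\<Sum>i\<le>DIM('a) - k. unit_ball_vol (real i) * r ^ i *
        (\<integral>Z. intrinsic_volume ((direction Z)\<^sup>\<bottom>) (DIM('a) - k - i) (base Z) \<partial>\<theta>))"
proof (cases "c = 0")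
  \<comment> \<open>Local finiteness of \<open>\<Lambda>\<close> gives no integrability if \<open>c = 0\<close>, but both sides vanish then.\<close>
  case True
  have "sets \<Lambda> = sets (cylinder_space k)" using \<Lambda> by (simp add: locally_finite_def)
  from intensity_hitting_cylinders[OF I this, of r] True show ?thesis by (simp add: measure_def)
next
  case False
  define n where "n = DIM('a) - k"
  define v where "v s Z = enn2real (base_parallel_volume s Z)" for s and Z :: "'a set"
  define V where "V j Z = intrinsic_volume ((direction Z)\<^sup>\<bottom>) j (base Z)" for j and Z :: "'a set"
  have c: "c > 0" and \<theta>: "sets \<theta> = sets (centered_cylinder_space k)"
    using I False by (auto simp: intensity_and_shape_def)
  note space\<theta> = shape_distribution(1)[OF \<theta>] and meas\<theta> = shape_distribution(2)[OF \<theta>]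
  have \<Lambda>s: "sets \<Lambda> = sets (cylinder_space k)" using \<Lambda> by (simp add: locally_finite_def)
  note hit = intensity_hitting_cylinders[OF I \<Lambda>s]
  have v_meas: "v s \<in> borel_measurable \<theta>" if "s \<ge> 0" for s
    unfolding v_def by (intro borel_measurable_enn2real meas\<theta> measurable_base_parallel_volume that)
  have V_meas: "V j \<in> borel_measurable \<theta>" if "j \<le> n" for j
    unfolding V_def using that by (intro meas\<theta> measurable_intrinsic_volume[OF k]) (simp add: n_def)
  have v_nn: "(\<integral>\<^sup>+Z. ennreal (v s Z) \<partial>\<theta>) = (\<integral>\<^sup>+Z. base_parallel_volume s Z \<partial>\<theta>)" for s
    unfolding v_def using base_parallel_volume_finite[OF space\<theta>] by (intro nn_integral_cong) simp
  have fin: "ennreal c * (\<integral>\<^sup>+Z. ennreal (v s Z) \<partial>\<theta>) < \<infinity>" for s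
    unfolding v_nn hit[symmetric]
    by (rule emeasure_hitting_cylinders_finite[OF \<Lambda>])
  have v_int: "integrable \<theta> (v s)" if "s \<ge> 0" for s
  proof (rule integrableI_nonneg[OF v_meas[OF that]])
    show "(\<integral>\<^sup>+Z. ennreal (v s Z) \<partial>\<theta>) < \<infinity>"
      using fin[of s] c by (auto simp: ennreal_mult_less_top ennreal_eq_0_iff)
  qed (simp add: v_def)
  have cyl: "subspace ((direction Z)\<^sup>\<bottom>) \<and> dim ((direction Z)\<^sup>\<bottom>) = n \<and> compact (base Z) \<and> base Z \<noteq> {} \<and>
      base Z \<subseteq> (direction Z)\<^sup>\<bottom>" if "Z \<in> space \<theta>" for Z
    using cylinderD[OF space\<theta>[OF that]] subspace_dim_orthogonal_comp[of "direction Z"] subspace_orthogonal_comp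
    by (auto simp: n_def)
  \<comment> \<open>Almost surely, \<open>V j\<close> is the linear combination of parallel volumes given by interpolation.\<close>
  have V_int: "integrable \<theta> (V j)" if j: "j \<le> n" for j
  proof -
    obtain X w where X: "finite X" "X \<subseteq> {0..}" and w:
      "\<And>(W :: 'a set) K. subspace W \<Longrightarrow> dim W = n \<Longrightarrow> compact K \<Longrightarrow> convex K \<Longrightarrow> K \<noteq> {} \<Longrightarrow> K \<subseteq> W \<Longrightarrow>
        intrinsic_volume W j K = (\<Sum>t\<in>X. w t * measure (lborel_subspace W) (parallel_body W K t))"
      by (rule intrinsic_volume_interpolation[OF j, where 'a = 'a]) (rule that)
    have "AE Z in \<theta>. (\<Sum>t\<in>X. w t * v t Z) = V j Z"
      using conv
    proof (rule AE_mp, intro AE_I2 impI)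
      fix Z assume "Z \<in> space \<theta>" "convex (base Z)"
      then show "(\<Sum>t\<in>X. w t * v t Z) = V j Z"
        unfolding V_def v_def enn2real_base_parallel_volume using cyl w by simp
    qed
    moreover have int: "integrable \<theta> (\<lambda>Z. \<Sum>t\<in>X. w t * v t Z)"
      using X(2) by (intro Bochner_Integration.integrable_sum integrable_mult_right v_int) auto
    ultimately show ?thesis
      using V_meas[OF j] by (subst integrable_cong_AE[symmetric]) (auto dest: borel_measurable_integrable)
  qed
  have steiner: "AE Z in \<theta>. v r Z = (\<Sum>i\<le>n. unit_ball_vol (real i) * r ^ i * V (n - i) Z)"
    using conv
  proof (rule AE_mp, intro AE_I2 impI)
    fix Z assume Z: "Z \<in> space \<theta>" "convex (base Z)"
    show "v r Z = (\<Sum>i\<le>n. unit_ball_vol (real i) * r ^ i * V (n - i) Z)"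
      unfolding V_def v_def enn2real_base_parallel_volume
      using steiner_formula[of "(direction Z)\<^sup>\<bottom>" "base Z" r] cyl[OF Z(1)] Z(2) r by simp
  qed
  have sum_int: "integrable \<theta> (\<lambda>Z. \<Sum>i\<le>n. unit_ball_vol (real i) * r ^ i * V (n - i) Z)"
    by (intro Bochner_Integration.integrable_sum integrable_mult_right V_int) simp
  have "measure \<Lambda> (hitting_cylinders k r) = enn2real (ennreal c * (\<integral>\<^sup>+Z. ennreal (v r Z) \<partial>\<theta>))"
    unfolding measure_def hit v_nn ..
  also have "\<dots> = c * enn2real (\<integral>\<^sup>+Z. ennreal (v r Z) \<partial>\<theta>)"
    using c by (simp add: enn2real_mult)
  also have "enn2real (\<integral>\<^sup>+Z. ennreal (v r Z) \<partial>\<theta>) = (\<integral>Z. v r Z \<partial>\<theta>)"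
    by (intro integral_eq_nn_integral[symmetric] v_meas r AE_I2) (simp add: v_def)
  also have "\<dots> = (\<integral>Z. (\<Sum>i\<le>n. unit_ball_vol (real i) * r ^ i * V (n - i) Z) \<partial>\<theta>)"
    using steiner v_meas[OF r] borel_measurable_integrable[OF sum_int] by (intro integral_cong_AE)
  also have "\<dots> = (\<Sum>i\<le>n. unit_ball_vol (real i) * r ^ i * (\<integral>Z. V (n - i) Z \<partial>\<theta>))"
    by (subst Bochner_Integration.integral_sum) (auto intro!: V_int integrable_mult_right)
  finally show ?thesis unfolding n_def V_def .
qed

theorem mainTheorem7:
  fixes P :: "'w measure"
    and \<Xi> :: "'w \<Rightarrow> 'a::euclidean_space set measure"
    and \<Lambda> \<theta> :: "'a set measure"
    and k :: nat
    and c r :: real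
  assumes "k < DIM('a)"
    and "poisson_cylinder_process k P \<Xi> \<Lambda>"
    and "simple_process k P \<Xi>"
    and "stationary_process k P \<Xi>"
    and "intensity_and_shape k \<Lambda> c \<theta>"
    and "0 < volume_fraction k P \<Xi>" and "volume_fraction k P \<Xi> < 1"
    and "AE Z in \<theta>. convex (base Z)"
    and "r > 0"
  shows "spherical_contact k P \<Xi> r =
    1 - exp (- c * (\<Sum>i=1..DIM('a) - k. unit_ball_vol (real i) * r ^ i *
        (\<integral>Z. intrinsic_volume ((direction Z)\<^sup>\<bottom>) (DIM('a) - k - i) (base Z) \<partial>\<theta>)))"
proof -
  define n where "n = DIM('a) - k"
  define I where "I i = (\<integral>Z. intrinsic_volume ((direction Z)\<^sup>\<bottom>) (n - i) (base Z) \<partial>\<theta>)" for i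
  have \<Lambda>: "locally_finite k \<Lambda>" using assms(2) by (simp add: poisson_cylinder_process_def)
  have meas: "measure \<Lambda> (hitting_cylinders k s) = c * (\<Sum>i\<le>n. unit_ball_vol (real i) * s ^ i * I i)" if "s \<ge> 0" for s
    unfolding n_def I_def by (rule intensity_hitting_cylinders_steiner[OF assms(1) \<Lambda> assms(5,8) that])
  have split: "(\<Sum>i\<le>n. unit_ball_vol (real i) * s ^ i * I i) =
      unit_ball_vol 0 * I 0 + (\<Sum>i=1..n. unit_ball_vol (real i) * s ^ i * I i)" for s
    by (simp add: sum.atMost_shift sum.atLeast1_atMost_eq lessThan_Suc_atMost)
  have zero: "(\<Sum>i=1..n. unit_ball_vol (real i) * 0 ^ i * I i) = 0" by (intro sum.neutral) auto
  have "measure \<Lambda> (hitting_cylinders k r) - measure \<Lambda> (hitting_cylinders k 0) =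
      c * (\<Sum>i=1..n. unit_ball_vol (real i) * r ^ i * I i)"
    using assms(9) unfolding meas[OF order_refl] meas[OF less_imp_le[OF assms(9)]] split zero
    by (simp add: algebra_simps)
  then have "spherical_contact k P \<Xi> r = 1 - exp (- (c * (\<Sum>i=1..n. unit_ball_vol (real i) * r ^ i * I i)))"
    using spherical_contact_eq[OF assms(2) less_imp_le[OF assms(9)]] by (simp only:)
  then show ?thesis by (simp only: n_def I_def mult_minus_left)
qed

end
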